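(* Let $\tau\in i\mathbb R_{>0}$ and let $\eta\in(0,1)$ be real with $\eta\neq\frac12$. The formulas (with $m$ ranging in $[0,|\tau|]$ and $u\in\mathbb R/\mathbb Z$) $$\rho(S_0)=\vartheta_1(\eta)\frac{\vartheta_3(2u+\eta+im)}{d(u)d(-u-\eta)}V+\vartheta_1(\eta)\frac{\vartheta_3(2u-\eta-im)}{d(u)d(-u+\eta)}V^*,$$ $$\rho(S_1)=-i\,\vartheta_2(\eta)\frac{\vartheta_4(2u+\eta+im)}{d(u)d(-u-\eta)}V+i\,\vartheta_2(\eta)\frac{\vartheta_4(2u-\eta-im)}{d(u)d(-u+\eta)}V^*,$$ $$\rho(S_2)=\vartheta_3(\eta)\frac{\vartheta_1(2u+\eta+im)}{d(u)d(-u-\eta)}V+\vartheta_3(\eta)\frac{\vartheta_1(2u-\eta-im)}{d(u)d(-u+\eta)}V^*,$$ $$\rho(S_3)=-\vartheta_4(\eta)\frac{\vartheta_2(2u+\eta+im)}{d(u)d(-u-\eta)}V-\vartheta_4(\eta)\frac{\vartheta_2(2u-\eta-im)}{d(u)d(-u+\eta)}V^*$$ define a $*$-homomorphism $\rho$ from the Sklyanin algebra to $C^\infty(\mathbb T^2_\eta)\,\widehat\otimes\,C^\infty([0,|\tau|])$.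
   Context: Theta functions: with $q=e^{\pi i\tau}$, $\vartheta_3(z)=\sum_{n\in\mathbb Z}q^{n^2}e^{2\pi inz}$, $i\vartheta_1(z)=q^{1/4}e^{\pi iz}\vartheta_3(z+\frac12+\frac\tau2)$, $\vartheta_2(z)=\vartheta_1(z+\frac12)$, $\vartheta_4(z)=\vartheta_3(z+\frac12)$. The function $d$ is $$d(u)=\frac{\vartheta_3(u)\vartheta_4(u)+i\,\vartheta_1(u)\vartheta_2(u)}{c},\qquad c>0,\ c^2=\vartheta_3(0)^2\vartheta_4(0).$$ The Sklyanin algebra here is the $*$-algebra generated by self-adjoint $S_0,S_1,S_2,S_3$ with relations, for $(k,\ell,m)$ cyclic permutations of $(1,2,3)$, $$S_\ell S_m-S_mS_\ell=i(S_0S_k+S_kS_0),\qquad S_0S_k-S_kS_0=i\,J_{\ell m}(S_\ell S_m+S_mS_\ell),$$ $$J_{12}=\frac{\vartheta_1(\eta)^2\vartheta_4(\eta)^2}{\vartheta_2(\eta)^2\vartheta_3(\eta)^2},\quad J_{23}=\frac{\vartheta_1(\eta)^2\vartheta_2(\eta)^2}{\vartheta_3(\eta)^2\vartheta_4(\eta)^2},\quad J_{31}=-\frac{\vartheta_1(\eta)^2\vartheta_3(\eta)^2}{\vartheta_2(\eta)^2\vartheta_4(\eta)^2}.$$ $C^\infty(\mathbb T^2_\eta)=C^\infty(\mathbb R/\mathbb Z)\rtimes_\eta\mathbb Z$ is the smooth crossed product: elements are rapidly decaying sums $\sum_nf_nV^n$, $f_n\in C^\infty(\mathbb R/\mathbb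 Z)$, with $V$ unitary and $(VfV^{-1})(u)=f(u+\eta)$. *)

theory Defs
  imports
    "HOL-Analysis.Analysis"
    "HOL-Algebra.QuotRing"
    "HOL-Algebra.Module"
    "HOL-Library.Poly_Mapping"
begin

section \<open>Theta functions\<close>

definition theta_q :: "complex \<Rightarrow> complex" where
  "theta_q \<tau> = exp (of_real pi * \<i> * \<tau>)"

definition theta3 :: "complex \<Rightarrow> complex \<Rightarrow> complex" where
  "theta3 \<tau> z = (\<Sum>\<^sub>\<infinity>n\<in>(UNIV :: int set).
     theta_q \<tau> powi (n\<^sup>2) * exp (2 * of_real pi * \<i> * of_int n * z))"

text \<open>The branch of \<open>q\<^sup>1\<^sup>/\<^sup>4\<close> is \<open>exp (\<pi>\<i>\<tau>/4)\<close>; for purely imaginary \<open>\<tau>\<close> it is the positive root.\<close>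

definition theta1 :: "complex \<Rightarrow> complex \<Rightarrow> complex" where
  "theta1 \<tau> z = - \<i> * (exp (of_real pi * \<i> * \<tau> / 4) * exp (of_real pi * \<i> * z)
                     * theta3 \<tau> (z + 1/2 + \<tau>/2))"

definition theta2 :: "complex \<Rightarrow> complex \<Rightarrow> complex" where
  "theta2 \<tau> z = theta1 \<tau> (z + 1/2)"

definition theta4 :: "complex \<Rightarrow> complex \<Rightarrow> complex" where
  "theta4 \<tau> z = theta3 \<tau> (z + 1/2)"

definition theta_d :: "complex \<Rightarrow> real \<Rightarrow> complex \<Rightarrow> complex" where
  "theta_d \<tau> c u = (theta3 \<tau> u * theta4 \<tau> u + \<i> * theta1 \<tau> u * theta2 \<tau> u) / of_real c"


section \<open>Complex *-algebras and their homomorphisms\<close>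

record ('a, 'b) star_algebra = "('a, 'b) module" +
  adj :: "'b \<Rightarrow> 'b"

definition star_alg_hom ::
    "(complex, 'a, 'm) star_algebra_scheme \<Rightarrow> (complex, 'b, 'n) star_algebra_scheme \<Rightarrow> ('a \<Rightarrow> 'b) set" where
  "star_alg_hom A B = {h \<in> ring_hom A B.
     (\<forall>c. \<forall>x\<in>carrier A. h (c \<odot>\<^bsub>A\<^esub> x) = c \<odot>\<^bsub>B\<^esub> h x) \<and>
     (\<forall>x\<in>carrier A. h (adj A x) = adj B (h x))}"

definition quotient_star_alg ::
    "(complex, 'a, 'm) star_algebra_scheme \<Rightarrow> 'a set \<Rightarrow> (complex, 'a set) star_algebra" where
  "quotient_star_alg A I =
     \<lparr>carrier = carrier (A Quot I), mult = mult (A Quot I), one = one (A Quot I),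
      zero = zero (A Quot I), add = add (A Quot I),
      smult = (\<lambda>c X. \<Union>x\<in>X. I +>\<^bsub>A\<^esub> (c \<odot>\<^bsub>A\<^esub> x)),
      adj = (\<lambda>X. \<Union>x\<in>X. I +>\<^bsub>A\<^esub> adj A x)\<rparr>"

text \<open>A two-sided ideal of a unital algebra is automatically a complex subspace, and the
  two-sided ideal generated by an \<open>adj\<close>-stable set is \<open>adj\<close>-stable.\<close>

definition star_ideal_generated :: "(complex, 'a, 'm) star_algebra_scheme \<Rightarrow> 'a set \<Rightarrow> 'a set" where
  "star_ideal_generated A R = Idl\<^bsub>A\<^esub> (R \<union> adj A ` R)"


section \<open>The free *-algebra on self-adjoint generators\<close>

datatype 'g free_word = Word (letters: "'g list")

instantiation free_word :: (type) monoid_add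
begin
definition zero_free_word :: "'a free_word" where
  "0 = Word []"
definition plus_free_word :: "'a free_word \<Rightarrow> 'a free_word \<Rightarrow> 'a free_word" where
  "v + w = Word (letters v @ letters w)"
instance
  by standard (simp_all add: zero_free_word_def plus_free_word_def)
end

text \<open>Finitely supported functions on words, with the convolution product of
  \<^theory>\<open>HOL-Library.Poly_Mapping\<close>, are the free unital algebra.  The adjoint reverses words and
  conjugates coefficients, so that the generators are self-adjoint.\<close>

type_synonym 'g free_alg_elem = "'g free_word \<Rightarrow>\<^sub>0 complex"

definition rev_word :: "'g free_word \<Rightarrow> 'g free_word" where
  "rev_word w = Word (rev (letters w))"

lemma rev_word_rev_word [simp]: "rev_word (rev_word w) = w"
  by (simp add: rev_word_def)

lift_definition free_adj :: "'g free_alg_elem \<Rightarrow> 'g free_alg_elem" is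
  "\<lambda>f w. cnj (f (rev_word w))"
proof -
  fix f :: "'g free_word \<Rightarrow> complex"
  assume "finite {w. f w \<noteq> 0}"
  moreover have "{w. cnj (f (rev_word w)) \<noteq> 0} \<subseteq> rev_word ` {w. f w \<noteq> 0}"
    by (auto intro!: image_eqI[where x = "rev_word _"])
  ultimately show "finite {w. cnj (f (rev_word w)) \<noteq> 0}"
    by (meson finite_imageI finite_subset)
qed

definition free_star_alg :: "(complex, 'g free_alg_elem) star_algebra" where
  "free_star_alg = \<lparr>carrier = UNIV, mult = (*), one = 1, zero = 0, add = (+),
     smult = (\<lambda>c x. Poly_Mapping.single 0 c * x), adj = free_adj\<rparr>"

definition free_gen :: "'g \<Rightarrow> 'g free_alg_elem" where
  "free_gen g = Poly_Mapping.single (Word [g]) 1"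

lemma ring_free_star_alg: "ring free_star_alg"
proof (rule ringI)
  show "abelian_group free_star_alg"
  proof (rule abelian_groupI)
    fix x assume "x \<in> carrier free_star_alg"
    show "\<exists>y\<in>carrier free_star_alg. y \<oplus>\<^bsub>free_star_alg\<^esub> x = \<zero>\<^bsub>free_star_alg\<^esub>"
      by (rule bexI[of _ "- x"]) (simp_all add: free_star_alg_def)
  qed (simp_all add: free_star_alg_def ac_simps)
  show "monoid free_star_alg"
    by (rule monoidI) (simp_all add: free_star_alg_def mult.assoc)
qed (simp_all add: free_star_alg_def distrib_left distrib_right)

lemma free_adj_gen: "free_adj (free_gen g) = free_gen g"
  unfolding free_gen_def
  by (rule poly_mapping_eqI)
     (simp add: free_adj.rep_eq lookup_single when_def rev_word_def, metis free_word.collapse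
        free_word.sel rev.simps(1) rev_singleton_conv)


section \<open>The Sklyanin algebra\<close>

datatype sklyanin_index = G0 | G1 | G2 | G3

definition J12 :: "complex \<Rightarrow> real \<Rightarrow> complex" where
  "J12 \<tau> \<eta> = (theta1 \<tau> \<eta>)\<^sup>2 * (theta4 \<tau> \<eta>)\<^sup>2 / ((theta2 \<tau> \<eta>)\<^sup>2 * (theta3 \<tau> \<eta>)\<^sup>2)"

definition J23 :: "complex \<Rightarrow> real \<Rightarrow> complex" where
  "J23 \<tau> \<eta> = (theta1 \<tau> \<eta>)\<^sup>2 * (theta2 \<tau> \<eta>)\<^sup>2 / ((theta3 \<tau> \<eta>)\<^sup>2 * (theta4 \<tau> \<eta>)\<^sup>2)"

definition J31 :: "complex \<Rightarrow> real \<Rightarrow> complex" where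
  "J31 \<tau> \<eta> = - ((theta1 \<tau> \<eta>)\<^sup>2 * (theta3 \<tau> \<eta>)\<^sup>2 / ((theta2 \<tau> \<eta>)\<^sup>2 * (theta4 \<tau> \<eta>)\<^sup>2))"

text \<open>The tuples are \<open>(k, l, m, J\<^sub>l\<^sub>m)\<close>; a relation \<open>a = b\<close> is encoded as the element \<open>a - b\<close>.\<close>

definition sklyanin_relations :: "complex \<Rightarrow> real \<Rightarrow> sklyanin_index free_alg_elem set" where
  "sklyanin_relations \<tau> \<eta> =
     (\<Union>(k, l, m, J) \<in> {(G1, G2, G3, J23 \<tau> \<eta>), (G2, G3, G1, J31 \<tau> \<eta>), (G3, G1, G2, J12 \<tau> \<eta>)}.
        let S = free_gen; scal = (\<lambda>c x. c \<odot>\<^bsub>free_star_alg\<^esub> x) in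
        {(S l * S m - S m * S l) - scal \<i> (S G0 * S k + S k * S G0),
         (S G0 * S k - S k * S G0) - scal (\<i> * J) (S l * S m + S m * S l)})"

definition sklyanin_ideal :: "complex \<Rightarrow> real \<Rightarrow> sklyanin_index free_alg_elem set" where
  "sklyanin_ideal \<tau> \<eta> = star_ideal_generated free_star_alg (sklyanin_relations \<tau> \<eta>)"

definition sklyanin_algebra ::
    "complex \<Rightarrow> real \<Rightarrow> (complex, sklyanin_index free_alg_elem set) star_algebra" where
  "sklyanin_algebra \<tau> \<eta> = quotient_star_alg free_star_alg (sklyanin_ideal \<tau> \<eta>)"

definition sklyanin_gen ::
    "complex \<Rightarrow> real \<Rightarrow> sklyanin_index \<Rightarrow> sklyanin_index free_alg_elem set" where
  "sklyanin_gen \<tau> \<eta> j = sklyanin_ideal \<tau> \<eta> +>\<^bsub>free_star_alg\<^esub> free_gen j"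


section \<open>Smooth functions of a real variable\<close>

definition nderiv_within :: "real set \<Rightarrow> nat \<Rightarrow> (real \<Rightarrow> complex) \<Rightarrow> real \<Rightarrow> complex" where
  "nderiv_within S k = ((\<lambda>g x. vector_derivative g (at x within S)) ^^ k)"

definition smooth_within :: "real set \<Rightarrow> (real \<Rightarrow> complex) \<Rightarrow> bool" where
  "smooth_within S f \<longleftrightarrow> (\<forall>k. nderiv_within S k f differentiable_on S)"

text \<open>Functions on \<open>\<real>/\<int>\<close> are 1-periodic functions on \<open>\<real>\<close>.\<close>

definition smooth_circle :: "(real \<Rightarrow> complex) set" where
  "smooth_circle = {f. smooth_within UNIV f \<and> (\<forall>u. f (u + 1) = f u)}"

text \<open>Functions on \<open>[0, L]\<close> are extended by zero, so that equality in HOL is equality on the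
  interval; derivatives at the end points are one-sided.\<close>

definition smooth_interval :: "real \<Rightarrow> (real \<Rightarrow> complex) set" where
  "smooth_interval L = {b. smooth_within {0..L} b \<and> (\<forall>m. m \<notin> {0..L} \<longrightarrow> b m = 0)}"

definition interval_seminorm :: "real \<Rightarrow> nat \<Rightarrow> (real \<Rightarrow> complex) \<Rightarrow> real" where
  "interval_seminorm L N b = (SUP m\<in>{0..L}. \<Sum>i\<le>N. norm (nderiv_within {0..L} i b m))"

definition interval_one :: "real \<Rightarrow> real \<Rightarrow> complex" where
  "interval_one L m = of_bool (m \<in> {0..L})"


section \<open>The smooth noncommutative torus\<close>

text \<open>The sum of the \<open>f\<^sub>n V\<^sup>n\<close> is the function \<open>\<lambda>n u. f\<^sub>n u\<close>.  Since \<open>V\<^sup>k g V\<^sup>-\<^sup>k = g(\<cdot> + k\<eta>)\<close>,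
  \<open>(f V\<^sup>k)(g V\<^sup>l) = f g(\<cdot> + k\<eta>) V\<^sup>k\<^sup>+\<^sup>l\<close> and \<open>(f V\<^sup>n)\<^sup>* = cnj f(\<cdot> - n\<eta>) V\<^sup>-\<^sup>n\<close>.\<close>

type_synonym torus_elem = "int \<Rightarrow> real \<Rightarrow> complex"

definition torus_weight :: "nat \<Rightarrow> nat \<Rightarrow> torus_elem \<Rightarrow> int \<times> real \<Rightarrow> real" where
  "torus_weight j k a = (\<lambda>(n, u). (1 + \<bar>real_of_int n\<bar>) ^ k * norm (nderiv_within UNIV j (a n) u))"

definition torus_seminorm :: "nat \<Rightarrow> torus_elem \<Rightarrow> real" where
  "torus_seminorm N a = (SUP p. \<Sum>j\<le>N. torus_weight j N a p)"

definition smooth_torus :: "real \<Rightarrow> (complex, torus_elem) star_algebra" where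
  "smooth_torus \<eta> =
     \<lparr>carrier = {a. (\<forall>n. a n \<in> smooth_circle) \<and> (\<forall>j k. bdd_above (range (torus_weight j k a)))},
      mult = (\<lambda>a b n u. \<Sum>\<^sub>\<infinity>k\<in>UNIV. a k u * b (n - k) (u + of_int k * \<eta>)),
      one = (\<lambda>n u. of_bool (n = 0)),
      zero = (\<lambda>n u. 0),
      add = (\<lambda>a b n u. a n u + b n u),
      smult = (\<lambda>c a n u. c * a n u),
      adj = (\<lambda>a n u. cnj (a (- n) (u + of_int n * \<eta>)))\<rparr>"

definition torus_V :: torus_elem where
  "torus_V = (\<lambda>n u. of_bool (n = 1))"

definition torus_fun :: "(real \<Rightarrow> complex) \<Rightarrow> torus_elem" where
  "torus_fun f = (\<lambda>n u. of_bool (n = 0) * f u)"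

lemma torus_fun_mult:
  "mult (smooth_torus \<eta>) (torus_fun f) a = (\<lambda>n u. f u * a n u)"
proof (intro ext)
  fix n u
  have "(\<Sum>\<^sub>\<infinity>k\<in>UNIV. torus_fun f k u * a (n - k) (u + of_int k * \<eta>))
      = (\<Sum>\<^sub>\<infinity>k\<in>{0}. torus_fun f k u * a (n - k) (u + of_int k * \<eta>))"
    by (rule infsum_cong_neutral) (auto simp: torus_fun_def)
  then show "mult (smooth_torus \<eta>) (torus_fun f) a n u = f u * a n u"
    by (simp add: smooth_torus_def torus_fun_def)
qed

lemma torus_V_mult:
  "mult (smooth_torus \<eta>) torus_V a = (\<lambda>n u. a (n - 1) (u + \<eta>))"
proof (intro ext)
  fix n u
  have "(\<Sum>\<^sub>\<infinity>k\<in>UNIV. torus_V k u * a (n - k) (u + of_int k * \<eta>))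
      = (\<Sum>\<^sub>\<infinity>k\<in>{1}. torus_V k u * a (n - k) (u + of_int k * \<eta>))"
    by (rule infsum_cong_neutral) (auto simp: torus_V_def)
  then show "mult (smooth_torus \<eta>) torus_V a n u = a (n - 1) (u + \<eta>)"
    by (simp add: smooth_torus_def torus_V_def)
qed

lemma torus_V_unitary:
  "torus_V \<otimes>\<^bsub>smooth_torus \<eta>\<^esub> adj (smooth_torus \<eta>) torus_V = \<one>\<^bsub>smooth_torus \<eta>\<^esub>"
  by (simp only: torus_V_mult)
     (auto simp: fun_eq_iff smooth_torus_def torus_V_def)

lemma torus_V_conj:
  "torus_V \<otimes>\<^bsub>smooth_torus \<eta>\<^esub> (torus_fun f \<otimes>\<^bsub>smooth_torus \<eta>\<^esub> adj (smooth_torus \<eta>) torus_V)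
     = torus_fun (\<lambda>u. f (u + \<eta>))"
  by (simp only: torus_V_mult torus_fun_mult)
     (auto simp: fun_eq_iff smooth_torus_def torus_V_def torus_fun_def)


section \<open>The completed tensor product\<close>

text \<open>An elementary tensor \<open>a \<otimes> b\<close> is realised as the function \<open>m \<mapsto> b(m) a\<close> with values in the
  first factor; this realisation of the algebraic tensor product of two spaces of functions is
  faithful.\<close>

definition elem_tensor ::
    "('n \<Rightarrow> 'u \<Rightarrow> complex) \<Rightarrow> ('m \<Rightarrow> complex) \<Rightarrow> 'm \<Rightarrow> 'n \<Rightarrow> 'u \<Rightarrow> complex" where
  "elem_tensor a b = (\<lambda>m n u. a n u * b m)"

definition tensor_repr ::
    "('n \<Rightarrow> 'u \<Rightarrow> complex) set \<Rightarrow> ('m \<Rightarrow> complex) set \<Rightarrow>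
     (('n \<Rightarrow> 'u \<Rightarrow> complex) \<times> ('m \<Rightarrow> complex)) list \<Rightarrow> ('m \<Rightarrow> 'n \<Rightarrow> 'u \<Rightarrow> complex) \<Rightarrow> bool" where
  "tensor_repr E F xs t \<longleftrightarrow> set xs \<subseteq> E \<times> F \<and>
     t = (\<lambda>m n u. \<Sum>(a, b)\<leftarrow>xs. elem_tensor a b m n u)"

definition alg_tensor ::
    "('n \<Rightarrow> 'u \<Rightarrow> complex) set \<Rightarrow> ('m \<Rightarrow> complex) set \<Rightarrow> ('m \<Rightarrow> 'n \<Rightarrow> 'u \<Rightarrow> complex) set" where
  "alg_tensor E F = {t. \<exists>xs. tensor_repr E F xs t}"

definition proj_seminorm ::
    "('n \<Rightarrow> 'u \<Rightarrow> complex) set \<Rightarrow> ('m \<Rightarrow> complex) set \<Rightarrow>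
     (('n \<Rightarrow> 'u \<Rightarrow> complex) \<Rightarrow> real) \<Rightarrow> (('m \<Rightarrow> complex) \<Rightarrow> real) \<Rightarrow>
     ('m \<Rightarrow> 'n \<Rightarrow> 'u \<Rightarrow> complex) \<Rightarrow> real" where
  "proj_seminorm E F p q t = Inf {\<Sum>(a, b)\<leftarrow>xs. p a * q b | xs. tensor_repr E F xs t}"

text \<open>Completion of the algebraic tensor product for the projective seminorms, where \<open>P\<close> and \<open>Q\<close>
  are countable directed families of seminorms defining the topologies of \<open>E\<close> and \<open>F\<close> (below:
  increasing sequences) and making the point evaluations continuous.  A Cauchy sequence then converges pointwise, and the element
  of the completion is identified with the limit function.  For the nuclear Frechet spaces used
  below no information is lost (the completion injects into the functions), and the topology does
  not depend on the choice of a tensor norm.\<close>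

definition completed_tensor ::
    "('n \<Rightarrow> 'u \<Rightarrow> complex) set \<Rightarrow> (('n \<Rightarrow> 'u \<Rightarrow> complex) \<Rightarrow> real) set \<Rightarrow>
     ('m \<Rightarrow> complex) set \<Rightarrow> (('m \<Rightarrow> complex) \<Rightarrow> real) set \<Rightarrow>
     ('m \<Rightarrow> 'n \<Rightarrow> 'u \<Rightarrow> complex) set" where
  "completed_tensor E P F Q =
     {t. \<exists>s :: nat \<Rightarrow> _. (\<forall>i. s i \<in> alg_tensor E F) \<and>
        (\<forall>p\<in>P. \<forall>q\<in>Q. \<forall>\<epsilon>>0. \<exists>N. \<forall>i\<ge>N. \<forall>j\<ge>N.
            proj_seminorm E F p q (\<lambda>m n u. s i m n u - s j m n u) < \<epsilon>) \<and>
        (\<forall>m n u. (\<lambda>i. s i m n u) \<longlonglongrightarrow> t m n u)}"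

text \<open>The operations are pointwise in \<open>m\<close>, which extends
  \<open>(a \<otimes> b)(a' \<otimes> b') = aa' \<otimes> bb'\<close> and \<open>(a \<otimes> b)\<^sup>* = a\<^sup>* \<otimes> b\<^sup>*\<close>.\<close>

definition torus_tensor_interval ::
    "real \<Rightarrow> real \<Rightarrow> (complex, real \<Rightarrow> torus_elem) star_algebra" where
  "torus_tensor_interval \<eta> L = (let A = smooth_torus \<eta> in
     \<lparr>carrier = completed_tensor (carrier A) (range torus_seminorm)
                  (smooth_interval L) (range (interval_seminorm L)),
      mult = (\<lambda>x y m. x m \<otimes>\<^bsub>A\<^esub> y m),
      one = elem_tensor \<one>\<^bsub>A\<^esub> (interval_one L),
      zero = (\<lambda>m. \<zero>\<^bsub>A\<^esub>),
      add = (\<lambda>x y m. x m \<oplus>\<^bsub>A\<^esub> y m),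
      smult = (\<lambda>c x m. c \<odot>\<^bsub>A\<^esub> x m),
      adj = (\<lambda>x m. adj A (x m))\<rparr>)"

lemma elem_tensor_mult:
  "elem_tensor a b \<otimes>\<^bsub>torus_tensor_interval \<eta> L\<^esub> elem_tensor a' b'
     = elem_tensor (a \<otimes>\<^bsub>smooth_torus \<eta>\<^esub> a') (\<lambda>m. b m * b' m)"
proof (intro ext)
  fix m n u
  have "(\<Sum>\<^sub>\<infinity>k\<in>UNIV. a k u * b m * (a' (n - k) (u + of_int k * \<eta>) * b' m))
      = (\<Sum>\<^sub>\<infinity>k\<in>UNIV. a k u * a' (n - k) (u + of_int k * \<eta>) * (b m * b' m))"
    by (simp add: mult_ac)
  also have "\<dots> = (\<Sum>\<^sub>\<infinity>k\<in>UNIV. a k u * a' (n - k) (u + of_int k * \<eta>)) * (b m * b' m)"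
    by (rule infsum_cmult_left')
  finally show "(elem_tensor a b \<otimes>\<^bsub>torus_tensor_interval \<eta> L\<^esub> elem_tensor a' b') m n u
     = elem_tensor (a \<otimes>\<^bsub>smooth_torus \<eta>\<^esub> a') (\<lambda>m. b m * b' m) m n u"
    by (simp add: torus_tensor_interval_def smooth_torus_def elem_tensor_def Let_def)
qed

lemma elem_tensor_adj:
  "adj (torus_tensor_interval \<eta> L) (elem_tensor a b)
     = elem_tensor (adj (smooth_torus \<eta>) a) (\<lambda>m. cnj (b m))"
  by (simp add: torus_tensor_interval_def smooth_torus_def elem_tensor_def Let_def)

text \<open>\<open>g u m\<close> as a function of \<open>u \<in> \<real>/\<int>\<close> and \<open>m \<in> [0, L]\<close>, and \<open>V \<otimes> 1\<close>.\<close>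

definition tensor_fun :: "real \<Rightarrow> (real \<Rightarrow> real \<Rightarrow> complex) \<Rightarrow> real \<Rightarrow> torus_elem" where
  "tensor_fun L g = (\<lambda>m n u. torus_fun (\<lambda>u. g u m) n u * interval_one L m)"

definition tensor_V :: "real \<Rightarrow> real \<Rightarrow> torus_elem" where
  "tensor_V L = elem_tensor torus_V (interval_one L)"

end

(*  The addition formulas for the pairs (theta_1 theta_2, theta_3 theta_4) and
    (theta_1 theta_4, theta_2 theta_3) follow from one product formula relating tau to 2 tau;
    tau -> tau + 1 exchanges theta_3 and theta_4 and yields those for (theta_1 theta_3, theta_2 theta_4).
    They give d(u) d(-u) = theta_4(2u), and they make each coefficient (of V^2, 1, V^-2) of each
    Sklyanin relation collapse: the two contributions to the coefficient of 1 are opposite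
    multiples of a ratio theta_j(2u) / theta_4(2u).  Real zeros of theta_3 and theta_2 are excluded by
    passing from tau to 2 tau until the nome is small.

    The images of the generators lie in the completed tensor product because their coefficients are
    power series in m whose coefficients are holomorphic in u on a strip around the real axis and decay
    faster than geometrically; Cauchy's estimates control all the seminorms.  Such elements with
    finitely many powers of V form a *-algebra, so the universal property of the free algebra applies. *)

theory Submission
  imports Defs "HOL-Complex_Analysis.Complex_Analysis"
begin

section \<open>Theta series and their addition formulas\<close>

text \<open>The target consists of limits of sums of products a(u) b(m), so the two variables have
  to be separated. The denominators are free of m; only the numerators theta_j(2u +- (\<eta> + i m))
  are expanded, and they are entire. Hence the zeros of d restrict the width of the strip in u, but
  never the radius of convergence in m. A homomorphism is only asked to preserve the operations. The
  algebra laws therefore have to be known only on a class containing the images, where every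
  convolution sum is finite. Nonvanishing enters at three places: theta_4(2u) below the ratio,
  theta_2, theta_3, theta_4 at \<eta> below the structure constants, and the values at 0 by which
  the addition formulas are divided. The condition \<eta> \<noteq> 1/2 keeps theta_2(\<eta>) away
  from 0. The identities are proved for complex h and \<mu> in place of \<eta> and i m, because (h,
  \<mu>) -> (-h, -\<mu>) exchanges V and V^-1: this yields the coefficient of V^-2 from that of V^2,
  and makes the cancellation in the coefficient of 1 a matter of parity.\<close>

definition theta_term :: "complex \<Rightarrow> real \<Rightarrow> complex \<Rightarrow> int \<Rightarrow> complex" where
  "theta_term \<tau> a z n =
     exp (of_real pi * \<i> * (\<tau> * (of_int n + of_real a)\<^sup>2 + 2 * (of_int n + of_real a) * z))"

text \<open>The theta function with characteristics \<open>a\<close> and 0. All four classical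
  functions come from \<open>a = 0\<close> and \<open>a = 1/2\<close> by translation by 1/2, so
  convergence, holomorphy and the product formula are proved once.\<close>

definition theta_char :: "complex \<Rightarrow> real \<Rightarrow> complex \<Rightarrow> complex" where
  "theta_char \<tau> a z = (\<Sum>\<^sub>\<infinity>n. theta_term \<tau> a z n)"

text \<open>Majorant valid on the whole strip |Im z| \<le> Y: completing the square in the Gaussian
  exponent costs the constant factor and leaves a geometric one.\<close>

definition theta_bound :: "real \<Rightarrow> real \<Rightarrow> real \<Rightarrow> int \<Rightarrow> real" where
  "theta_bound t a Y n = exp (pi * (\<bar>a\<bar> + (2 * Y + 1)\<^sup>2 / (4 * t))) * exp (- pi) ^ nat \<bar>n\<bar>"

lemma summable_on_power_abs_int:
  fixes r :: real
  assumes "0 \<le> r" "r < 1"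
  shows "(\<lambda>n :: int. r ^ nat \<bar>n\<bar>) summable_on UNIV"
proof -
  have g: "(\<lambda>n :: nat. r ^ n) summable_on UNIV"
    using assms by (intro summable_nonneg_imp_summable_on summable_geometric) auto
  have 1: "(\<lambda>n. r ^ nat \<bar>n\<bar>) summable_on range int"
    using g by (subst summable_on_reindex) (auto simp: o_def)
  have 2: "(\<lambda>n. r ^ nat \<bar>n\<bar>) summable_on range (\<lambda>n. - int n)"
    using g by (subst summable_on_reindex) (auto simp: o_def inj_on_def)
  have "(UNIV :: int set) = range int \<union> range (\<lambda>n. - int n)"
    by (rule UNIV_eq_I) (metis UnI1 UnI2 int_cases2 rangeI)
  then show ?thesis
    using summable_on_union[OF 1 2] by simp
qed

lemma summable_theta_bound: "theta_bound t a Y summable_on UNIV"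
  unfolding theta_bound_def
  by (intro summable_on_cmult_right summable_on_power_abs_int) auto

lemma norm_theta_term:
  "norm (theta_term \<tau> a z n) = exp (- pi * (Im \<tau> * (of_int n + a)\<^sup>2 + 2 * (of_int n + a) * Im z))"
proof -
  define s where "s = of_int n + a"
  have s: "of_int n + of_real a = complex_of_real s" by (simp add: s_def)
  show ?thesis
    unfolding theta_term_def s s_def[symmetric]
    by (simp add: power2_eq_square algebra_simps)
qed

lemma norm_theta_term_le:
  assumes t: "Im \<tau> > 0" and Y: "\<bar>Im z\<bar> \<le> Y"
  shows "norm (theta_term \<tau> a z n) \<le> theta_bound (Im \<tau>) a Y n"
proof -
  define s where "s = of_int n + a"
  define t where "t = Im \<tau>"
  \<comment> \<open>The part 2 Y absorbs the term of the exponent that is linear in Im z; the extra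
    1 leaves |s| over, hence the factor exp (-pi |n|).\<close>
  define k where "k = 2 * Y + 1"
  have tp: "t > 0" using t by (simp add: t_def)
  have "0 \<le> (2 * t * \<bar>s\<bar> - k)\<^sup>2 / (4 * t)" using tp by simp
  also have "(2 * t * \<bar>s\<bar> - k)\<^sup>2 / (4 * t) = t * \<bar>s\<bar>\<^sup>2 - k * \<bar>s\<bar> + k\<^sup>2 / (4 * t)"
    using tp by (simp add: power2_diff power_mult_distrib field_simps power2_eq_square del: power2_abs abs_mult_self_eq)
  finally have "k * \<bar>s\<bar> - k\<^sup>2 / (4 * t) \<le> t * s\<^sup>2"
    by simp
  moreover have "- (2 * s * Im z) \<le> 2 * \<bar>s\<bar> * Y"
  proof -
    have "- (s * Im z) \<le> \<bar>s * Im z\<bar>" by simp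
    also have "\<dots> \<le> \<bar>s\<bar> * Y" unfolding abs_mult using Y by (intro mult_left_mono) auto
    finally show ?thesis by (simp add: mult.commute)
  qed
  moreover have "k * \<bar>s\<bar> = 2 * \<bar>s\<bar> * Y + \<bar>s\<bar>" by (simp add: k_def algebra_simps)
  moreover have "\<bar>s\<bar> \<ge> \<bar>real_of_int n\<bar> - \<bar>a\<bar>" by (simp add: s_def)
  ultimately have "- (t * s\<^sup>2 + 2 * s * Im z) \<le> \<bar>a\<bar> + k\<^sup>2 / (4 * t) - \<bar>real_of_int n\<bar>"
    by linarith
  then have "pi * (- (t * s\<^sup>2 + 2 * s * Im z)) \<le> pi * (\<bar>a\<bar> + k\<^sup>2 / (4 * t) - \<bar>real_of_int n\<bar>)"
    by (intro mult_left_mono) auto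
  then have "norm (theta_term \<tau> a z n) \<le> exp (pi * (\<bar>a\<bar> + k\<^sup>2 / (4 * t) - \<bar>real_of_int n\<bar>))"
    unfolding norm_theta_term s_def[symmetric] t_def[symmetric] by (simp add: algebra_simps)
  also have "\<dots> = exp (pi * (\<bar>a\<bar> + k\<^sup>2 / (4 * t))) * exp (- pi) ^ nat \<bar>n\<bar>"
    by (simp add: exp_of_nat_mult[symmetric] exp_add[symmetric] algebra_simps)
  finally show ?thesis unfolding theta_bound_def k_def t_def .
qed

lemma abs_summable_theta_term:
  assumes "Im \<tau> > 0"
  shows "(\<lambda>n. norm (theta_term \<tau> a z n)) summable_on UNIV"
  using norm_theta_term_le[OF assms order_refl]
  by (intro summable_on_comparison_test[OF summable_theta_bound]) auto

lemma summable_theta_term: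
  assumes "Im \<tau> > 0"
  shows "theta_term \<tau> a z summable_on UNIV"
  using abs_summable_theta_term[OF assms] by (rule abs_summable_summable)

lemma has_sum_theta_char:
  assumes "Im \<tau> > 0"
  shows "(theta_term \<tau> a z has_sum theta_char \<tau> a z) UNIV"
  unfolding theta_char_def using summable_theta_term[OF assms] by (rule has_sum_infsum)

lemma norm_theta_char_le:
  assumes "Im \<tau> > 0" "\<bar>Im z\<bar> \<le> Y"
  shows "norm (theta_char \<tau> a z) \<le> (\<Sum>\<^sub>\<infinity>n. theta_bound (Im \<tau>) a Y n)"
  unfolding theta_char_def
  by (rule norm_infsum_le[OF has_sum_infsum[OF summable_theta_term] has_sum_infsum[OF summable_theta_bound]])
     (use assms norm_theta_term_le[OF assms] in auto)

lemma holomorphic_theta_char: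
  assumes "Im \<tau> > 0"
  shows "theta_char \<tau> a holomorphic_on UNIV"
proof -
  have "theta_char \<tau> a holomorphic_on ball 0 R" if R: "R > 0" for R
  proof -
    have ul: "uniform_limit (cball 0 R) (\<lambda>X z. \<Sum>n\<in>X. theta_term \<tau> a z n)
            (\<lambda>z. \<Sum>\<^sub>\<infinity>n\<in>UNIV. theta_term \<tau> a z n) (finite_subsets_at_top UNIV)"
    proof (rule Weierstrass_m_test_general)
      show "norm (theta_term \<tau> a z n) \<le> theta_bound (Im \<tau>) a R n" if "z \<in> cball 0 R" for n z
        using that abs_Im_le_cmod[of z] by (intro norm_theta_term_le assms) auto
    qed (rule summable_theta_bound)
    have ev: "\<forall>\<^sub>F X in finite_subsets_at_top UNIV.
        continuous_on (cball 0 R) (\<lambda>z. \<Sum>n\<in>X. theta_term \<tau> a z n) \<and>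
        (\<lambda>z. \<Sum>n\<in>X. theta_term \<tau> a z n) holomorphic_on ball 0 R"
      unfolding theta_term_def
      by (intro always_eventually allI conjI continuous_intros holomorphic_intros)
    show ?thesis
      by (rule holomorphic_uniform_limit[OF ev ul finite_subsets_at_top_neq_bot])
         (simp add: theta_char_def[abs_def])
  qed
  then have "theta_char \<tau> a holomorphic_on (\<Union>R\<in>{0<..}. ball 0 R)"
    by (intro holomorphic_on_UN_open) auto
  also have "(\<Union>R\<in>{0<..}. ball 0 R) = (UNIV :: complex set)"
  proof -
    have "z \<in> ball 0 (norm z + 1)" "norm z + 1 \<in> {0<..}" for z :: complex
      by (auto simp: add_nonneg_pos)
    then show ?thesis by blast
  qed
  finally show ?thesis .
qed

section \<open>Parity and translations of theta series, and the four classical functions\<close>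

lemma theta_char_add_1: "theta_char \<tau> (a + 1) z = theta_char \<tau> a z"
  unfolding theta_char_def
  by (rule infsum_reindex_bij_witness[where i = "\<lambda>n. n - 1" and j = "\<lambda>n. n + 1"])
     (auto simp: theta_term_def add_ac)

lemma theta_char_minus: "theta_char \<tau> a (- z) = theta_char \<tau> (- a) z"
  unfolding theta_char_def
proof (rule infsum_reindex_bij_witness[where i = uminus and j = uminus])
  fix n :: int
  have "(of_int (- n) + of_real (- a))\<^sup>2 = (of_int n + of_real a :: complex)\<^sup>2"
    by (simp add: power2_eq_square algebra_simps)
  moreover have "2 * (of_int (- n) + of_real (- a)) * z = 2 * (of_int n + of_real a) * (- z)"
    by (simp add: algebra_simps)
  ultimately show "theta_term \<tau> (- a) z (- n) = theta_term \<tau> a (- z) n"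
    unfolding theta_term_def by simp
qed auto

lemma theta_term_shift_1:
  "theta_term \<tau> a (z + 1) n = exp (2 * of_real pi * \<i> * of_real a) * theta_term \<tau> a z n"
proof -
  have "of_real pi * \<i> * (\<tau> * (of_int n + of_real a)\<^sup>2 + 2 * (of_int n + of_real a) * (z + 1))
      = 2 * of_int n * (of_real pi * \<i>) + (2 * of_real pi * \<i> * of_real a +
        of_real pi * \<i> * (\<tau> * (of_int n + of_real a)\<^sup>2 + 2 * (of_int n + of_real a) * z))"
    by (simp add: algebra_simps)
  then have "theta_term \<tau> a (z + 1) n = exp (2 * of_int n * (of_real pi * \<i>)) *
      (exp (2 * of_real pi * \<i> * of_real a) * theta_term \<tau> a z n)"
    unfolding theta_term_def by (simp only: exp_add)
  also have "exp (2 * of_int n * (of_real pi * \<i>)) = 1"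
    by (simp add: exp_eq_1)
  finally show ?thesis by simp
qed

lemma theta_char_shift_1:
  "theta_char \<tau> a (z + 1) = exp (2 * of_real pi * \<i> * of_real a) * theta_char \<tau> a z"
  unfolding theta_char_def theta_term_shift_1 by (rule infsum_cmult_right')

lemma theta_char_half_shift_1: "theta_char \<tau> (1/2) (z + 1) = - theta_char \<tau> (1/2) z"
  using theta_char_shift_1[of \<tau> "1/2" z] by (simp add: mult_ac)

lemma theta_char_0_shift_1: "theta_char \<tau> 0 (z + 1) = theta_char \<tau> 0 z"
  using theta_char_shift_1[of \<tau> 0 z] by simp

lemma theta_char_half_minus: "theta_char \<tau> (1/2) (- z) = theta_char \<tau> (1/2) z"
  using theta_char_minus[of \<tau> "1/2" z] theta_char_add_1[of \<tau> "-1/2" z] by simp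

lemma theta_char_0_minus: "theta_char \<tau> 0 (- z) = theta_char \<tau> 0 z"
  using theta_char_minus[of \<tau> 0 z] by simp

lemma theta3_eq: "theta3 \<tau> z = theta_char \<tau> 0 z"
  unfolding theta3_def theta_char_def theta_term_def theta_q_def
  by (simp add: exp_power_int exp_add[symmetric] algebra_simps)

lemma theta4_eq: "theta4 \<tau> z = theta_char \<tau> 0 (z + 1/2)"
  unfolding theta4_def theta3_eq ..

lemma exp_i_half_pi: "exp (\<i> * (of_real pi / 2)) = \<i>"
  using cis_pi_half by (simp add: cis_conv_exp)

text \<open>Translation by tau/2 moves the characteristic from 0 to 1/2: the prefactor in
  \<open>theta1\<close> completes the square in the exponent. The leftover constant -i * i is
  1.\<close>

lemma theta2_eq: "theta2 \<tau> z = theta_char \<tau> (1/2) z"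
proof -
  define w where "w = z + \<tau>/2"
  have 1: "exp (of_real pi * \<i> * \<tau> / 4) * exp (of_real pi * \<i> * z) * theta_term \<tau> 0 w n
      = theta_term \<tau> (1/2) z n" for n
  proof -
    have "of_real pi * \<i> * \<tau> / 4 + of_real pi * \<i> * z +
        of_real pi * \<i> * (\<tau> * (of_int n + of_real 0)\<^sup>2 + 2 * (of_int n + of_real 0) * w)
      = of_real pi * \<i> * (\<tau> * (of_int n + of_real (1/2))\<^sup>2 + 2 * (of_int n + of_real (1/2)) * z)"
      by (simp add: power2_eq_square algebra_simps w_def)
    then show ?thesis
      unfolding theta_term_def by (simp only: exp_add[symmetric])
  qed
  have "z + 1/2 + 1/2 + \<tau>/2 = w + 1" by (simp add: w_def)
  then have t: "theta3 \<tau> (z + 1/2 + 1/2 + \<tau>/2) = theta_char \<tau> 0 w"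
    unfolding theta3_eq by (simp only: theta_char_0_shift_1)
  have e: "exp (of_real pi * \<i> * (z + 1/2)) = \<i> * exp (of_real pi * \<i> * z)"
  proof -
    have "of_real pi * \<i> * (z + 1/2) = \<i> * (of_real pi / 2) + of_real pi * \<i> * z"
      by (simp add: algebra_simps)
    then show ?thesis
      by (simp only: exp_add) (simp add: exp_i_half_pi[simplified])
  qed
  have "theta2 \<tau> z = - \<i> * \<i> *
      (exp (of_real pi * \<i> * \<tau> / 4) * exp (of_real pi * \<i> * z) * theta_char \<tau> 0 w)"
    unfolding theta2_def theta1_def e t by (simp only: mult_ac)
  also have "\<dots> = theta_char \<tau> (1/2) z"
    unfolding theta_char_def infsum_cmult_right'[symmetric] 1 by simp
  finally show ?thesis .
qed

lemma theta1_eq: "theta1 \<tau> z = - theta_char \<tau> (1/2) (z + 1/2)"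
  using theta2_eq[of \<tau> "z - 1/2"] theta_char_half_shift_1[of \<tau> "z - 1/2"]
  by (simp add: theta2_def add.commute[of _ "1/2"])

section \<open>Products of two theta series and the passage from tau to 2 tau\<close>

lemma has_sum_times:
  fixes f :: "'a \<Rightarrow> complex" and g :: "'b \<Rightarrow> complex"
  assumes f: "(f has_sum S) A" "(\<lambda>x. norm (f x)) summable_on A"
    and g: "(g has_sum T) B" "(\<lambda>y. norm (g y)) summable_on B"
  shows "((\<lambda>(x, y). f x * g y) has_sum S * T) (A \<times> B)"
proof (rule has_sum_SigmaI)
  show "((\<lambda>y. case (x, y) of (x, y) \<Rightarrow> f x * g y) has_sum f x * T) B" for x
    using has_sum_cmult_right[OF g(1)] by simp
  show "((\<lambda>x. f x * T) has_sum S * T) A"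
    by (rule has_sum_cmult_left[OF f(1)])
  have "(\<lambda>(x, y). norm (f x) * norm (g y)) summable_on A \<times> B"
  proof (rule summable_on_SigmaI)
    show "((\<lambda>y. case (x, y) of (x, y) \<Rightarrow> norm (f x) * norm (g y))
        has_sum norm (f x) * infsum (\<lambda>y. norm (g y)) B) B" for x
      using has_sum_cmult_right[OF has_sum_infsum[OF g(2)]] by simp
    show "(\<lambda>x. norm (f x) * infsum (\<lambda>y. norm (g y)) B) summable_on A"
      by (rule summable_on_cmult_left[OF f(2)])
  qed auto
  then have "(\<lambda>p. norm (case p of (x, y) \<Rightarrow> f x * g y)) summable_on A \<times> B"
    by (simp add: case_prod_unfold norm_mult)
  then show "(\<lambda>(x, y). f x * g y) summable_on A \<times> B"
    by (rule abs_summable_summable)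
qed

lemma has_sum_theta_char_times:
  assumes "Im \<tau> > 0"
  shows "((\<lambda>(n, m). theta_term \<tau> a z n * theta_term \<tau> b w m)
           has_sum theta_char \<tau> a z * theta_char \<tau> b w) UNIV"
  using has_sum_times[OF has_sum_theta_char[OF assms] abs_summable_theta_term[OF assms]
      has_sum_theta_char[OF assms] abs_summable_theta_term[OF assms]]
  by simp

text \<open>From (s + d)^2 + (s - d)^2 = 2 s^2 + 2 d^2: the cross terms cancel, which doubles tau
  and separates x from y.\<close>

lemma theta_term_times_even:
  "theta_term \<tau> a (x + y) (s + d) * theta_term \<tau> b (x - y) (s - d) =
   theta_term (2 * \<tau>) ((a + b) / 2) (2 * x) s * theta_term (2 * \<tau>) ((a - b) / 2) (2 * y) d"
proof -
  define S D A B where "S = complex_of_int s" and "D = complex_of_int d"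
    and "A = complex_of_real a" and "B = complex_of_real b"
  have "\<tau> * (S + D + A)\<^sup>2 + 2 * (S + D + A) * (x + y) + (\<tau> * (S - D + B)\<^sup>2 + 2 * (S - D + B) * (x - y))
      = 2 * \<tau> * (S + (A + B) / 2)\<^sup>2 + 2 * (S + (A + B) / 2) * (2 * x) +
        (2 * \<tau> * (D + (A - B) / 2)\<^sup>2 + 2 * (D + (A - B) / 2) * (2 * y))"
    by (simp add: power2_eq_square field_simps)
  then show ?thesis
    unfolding theta_term_def exp_add[symmetric] distrib_left[symmetric]
    by (simp add: S_def D_def A_def B_def)
qed

text \<open>A pair of indices with odd sum is reduced to the even case by moving the surplus 1 into
  the characteristic.\<close>

lemma theta_term_times_odd:
  "theta_term \<tau> a (x + y) (s + d + 1) * theta_term \<tau> b (x - y) (s - d) =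
   theta_term (2 * \<tau>) ((a + b + 1) / 2) (2 * x) s * theta_term (2 * \<tau>) ((a - b + 1) / 2) (2 * y) d"
proof -
  have "theta_term \<tau> a (x + y) (s + d + 1) = theta_term \<tau> (a + 1) (x + y) (s + d)"
    by (simp add: theta_term_def add_ac)
  then show ?thesis
    using theta_term_times_even[of \<tau> "a + 1" x y s d b] by (simp add: algebra_simps)
qed

text \<open>Summing over \<open>\<int>\<^sup>2\<close> in the coordinates \<open>n + m\<close>, \<open>n - m\<close>, the two summands collect the pairs with
  \<open>n + m\<close> even and odd.\<close>

lemma theta_char_product:
  assumes t: "Im \<tau> > 0"
  shows "theta_char \<tau> a (x + y) * theta_char \<tau> b (x - y) =
    theta_char (2 * \<tau>) ((a + b) / 2) (2 * x) * theta_char (2 * \<tau>) ((a - b) / 2) (2 * y) +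
    theta_char (2 * \<tau>) ((a + b + 1) / 2) (2 * x) * theta_char (2 * \<tau>) ((a - b + 1) / 2) (2 * y)"
proof -
  have t2: "Im (2 * \<tau>) > 0" using t by simp
  let ?P = "\<lambda>(n, m). theta_term \<tau> a (x + y) n * theta_term \<tau> b (x - y) m"
  define E where "E = {p :: int \<times> int. even (fst p + snd p)}"
  define O' where "O' = {p :: int \<times> int. odd (fst p + snd p)}"
  have "((\<lambda>(n, m). theta_term (2 * \<tau>) ((a + b) / 2) (2 * x) n * theta_term (2 * \<tau>) ((a - b) / 2) (2 * y) m)
      has_sum S) UNIV \<longleftrightarrow> (?P has_sum S) E" for S
    by (rule has_sum_reindex_bij_witness[where i = "\<lambda>(n, m). ((n + m) div 2, (n - m) div 2)"
          and j = "\<lambda>(s, d). (s + d, s - d)"];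
        clarsimp simp: E_def theta_term_times_even; presburger?)
  then have "(?P has_sum theta_char (2 * \<tau>) ((a + b) / 2) (2 * x) * theta_char (2 * \<tau>) ((a - b) / 2) (2 * y)) E"
    using has_sum_theta_char_times[OF t2] by blast
  moreover have "((\<lambda>(n, m). theta_term (2 * \<tau>) ((a + b + 1) / 2) (2 * x) n *
        theta_term (2 * \<tau>) ((a - b + 1) / 2) (2 * y) m)
      has_sum S) UNIV \<longleftrightarrow> (?P has_sum S) O'" for S
    by (rule has_sum_reindex_bij_witness[where i = "\<lambda>(n, m). ((n + m) div 2, (n - m) div 2)"
          and j = "\<lambda>(s, d). (s + d + 1, s - d)"];
        clarsimp simp: O'_def theta_term_times_odd; presburger?)
  then have "(?P has_sum theta_char (2 * \<tau>) ((a + b + 1) / 2) (2 * x) *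
      theta_char (2 * \<tau>) ((a - b + 1) / 2) (2 * y)) O'"
    using has_sum_theta_char_times[OF t2] by blast
  ultimately have "(?P has_sum (theta_char (2 * \<tau>) ((a + b) / 2) (2 * x) * theta_char (2 * \<tau>) ((a - b) / 2) (2 * y) +
    theta_char (2 * \<tau>) ((a + b + 1) / 2) (2 * x) * theta_char (2 * \<tau>) ((a - b + 1) / 2) (2 * y))) (E \<union> O')"
    by (rule has_sum_Un_disjoint) (auto simp: E_def O'_def)
  moreover have "E \<union> O' = UNIV" by (auto simp: E_def O'_def)
  ultimately show ?thesis
    using has_sum_theta_char_times[OF t] has_sum_unique by metis
qed

lemma theta3_product:
  assumes "Im \<tau> > 0"
  shows "theta3 \<tau> (x + y) * theta3 \<tau> (x - y) =
    theta3 (2 * \<tau>) (2 * x) * theta3 (2 * \<tau>) (2 * y) + theta2 (2 * \<tau>) (2 * x) * theta2 (2 * \<tau>) (2 * y)"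
  using theta_char_product[OF assms, of 0 x y 0] by (simp add: theta3_eq theta2_eq)

lemma theta2_product:
  assumes "Im \<tau> > 0"
  shows "theta2 \<tau> (x + y) * theta2 \<tau> (x - y) =
    theta2 (2 * \<tau>) (2 * x) * theta3 (2 * \<tau>) (2 * y) + theta3 (2 * \<tau>) (2 * x) * theta2 (2 * \<tau>) (2 * y)"
  using theta_char_product[OF assms, of "1/2" x y "1/2"] theta_char_add_1[of "2 * \<tau>" 0]
  by (simp add: theta3_eq theta2_eq)

lemma theta_minus:
  "theta1 \<tau> (- z) = - theta1 \<tau> z" "theta2 \<tau> (- z) = theta2 \<tau> z"
  "theta3 \<tau> (- z) = theta3 \<tau> z" "theta4 \<tau> (- z) = theta4 \<tau> z"
proof -
  show "theta2 \<tau> (- z) = theta2 \<tau> z" "theta3 \<tau> (- z) = theta3 \<tau> z"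
    by (simp_all add: theta2_eq theta3_eq theta_char_half_minus theta_char_0_minus)
  have "theta_char \<tau> (1/2) (- z + 1/2) = - theta_char \<tau> (1/2) (- z - 1/2)"
    using theta_char_half_shift_1[of \<tau> "- z - 1/2"] by (simp add: algebra_simps)
  also have "theta_char \<tau> (1/2) (- z - 1/2) = theta_char \<tau> (1/2) (z + 1/2)"
    using theta_char_half_minus[of \<tau> "z + 1/2"] by simp
  finally show "theta1 \<tau> (- z) = - theta1 \<tau> z" by (simp add: theta1_eq)
  have "theta_char \<tau> 0 (- z + 1/2) = theta_char \<tau> 0 (- z - 1/2)"
    using theta_char_0_shift_1[of \<tau> "- z - 1/2"] by (simp add: algebra_simps)
  also have "theta_char \<tau> 0 (- z - 1/2) = theta_char \<tau> 0 (z + 1/2)"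
    using theta_char_0_minus[of \<tau> "z + 1/2"] by simp
  finally show "theta4 \<tau> (- z) = theta4 \<tau> z" by (simp add: theta4_eq)
qed

lemma theta1_0 [simp]: "theta1 \<tau> 0 = 0"
  using theta_minus(1)[of \<tau> 0] by simp

lemma theta_shift_1:
  "theta1 \<tau> (z + 1) = - theta1 \<tau> z" "theta2 \<tau> (z + 1) = - theta2 \<tau> z"
  "theta3 \<tau> (z + 1) = theta3 \<tau> z" "theta4 \<tau> (z + 1) = theta4 \<tau> z"
  using theta_char_half_shift_1[of \<tau> "z + 1/2"] theta_char_half_shift_1[of \<tau> z]
    theta_char_0_shift_1[of \<tau> "z + 1/2"] theta_char_0_shift_1[of \<tau> z]
  by (simp_all add: theta1_eq theta2_eq theta3_eq theta4_eq add_ac)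

lemma theta_shift_half:
  "theta1 \<tau> (z + 1/2) = theta2 \<tau> z" "theta2 \<tau> (z + 1/2) = - theta1 \<tau> z"
  "theta3 \<tau> (z + 1/2) = theta4 \<tau> z" "theta4 \<tau> (z + 1/2) = theta3 \<tau> z"
  using theta_shift_1(3)[of \<tau> z]
  by (simp_all add: theta2_def theta4_def add.assoc) (simp_all add: theta_shift_1)

text \<open>Adding 1/4 to both x and y in \<open>theta3_product\<close> moves x + y by 1/2 and fixes
  x - y, while both doubled arguments move by 1/2.\<close>

lemma theta43_landen:
  assumes "Im \<tau> > 0"
  shows "theta4 \<tau> (x + y) * theta3 \<tau> (x - y) =
    theta4 (2 * \<tau>) (2 * x) * theta4 (2 * \<tau>) (2 * y) + theta1 (2 * \<tau>) (2 * x) * theta1 (2 * \<tau>) (2 * y)"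
  using theta3_product[OF assms, of "x + 1/4" "y + 1/4"]
    theta_shift_half(2,3)[of "2 * \<tau>" "2 * x"] theta_shift_half(2,3)[of "2 * \<tau>" "2 * y"]
    theta_shift_half(3)[of \<tau> "x + y"]
  by (simp add: algebra_simps)

lemma theta12_landen:
  assumes "Im \<tau> > 0"
  shows "theta1 \<tau> (x + y) * theta2 \<tau> (x - y) =
    theta1 (2 * \<tau>) (2 * x) * theta4 (2 * \<tau>) (2 * y) + theta4 (2 * \<tau>) (2 * x) * theta1 (2 * \<tau>) (2 * y)"
proof -
  have e: "x + 1/4 + (y + 1/4) = x + y + 1/2" "x + 1/4 - (y + 1/4) = x - y"
    "2 * (x + 1/4) = 2 * x + 1/2" "2 * (y + 1/4) = 2 * y + 1/2" by simp_all
  show ?thesis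
    using theta2_product[OF assms, of "x + 1/4" "y + 1/4"]
    unfolding e theta_shift_half by (simp add: minus_equation_iff[of "_ * _"] algebra_simps)
qed

text \<open>\<open>theta2_product\<close> is used at (x + y)/2, (x - y)/2 and again with 1/2 added
  to the first argument. The translation changes the sign of just one of the two terms on the right,
  so the difference isolates that term.\<close>

lemma theta23_landen:
  assumes "Im \<tau> > 0"
  shows "2 * (theta2 (2 * \<tau>) (x + y) * theta3 (2 * \<tau>) (x - y)) =
    theta2 \<tau> x * theta2 \<tau> y - theta1 \<tau> x * theta1 \<tau> y"
proof -
  have e: "(x + y)/2 + 1/2 + (x - y)/2 = x + 1/2" "(x + y)/2 + 1/2 - (x - y)/2 = y + 1/2"
     "(x + y)/2 + (x - y)/2 = x" "(x + y)/2 - (x - y)/2 = y"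
     "2 * ((x + y)/2 + 1/2) = (x + y) + 1" "2 * ((x + y)/2) = x + y" "2 * ((x - y)/2) = x - y"
    by (simp_all add: field_simps)
  show ?thesis
    using theta2_product[OF assms, of "(x + y)/2" "(x - y)/2"]
      theta2_product[OF assms, of "(x + y)/2 + 1/2" "(x - y)/2"]
    unfolding e theta_shift_half theta_shift_1 by simp
qed

lemma theta14_landen:
  assumes "Im \<tau> > 0"
  shows "2 * (theta1 (2 * \<tau>) (x + y) * theta4 (2 * \<tau>) (x - y)) =
    theta1 \<tau> x * theta2 \<tau> y + theta2 \<tau> x * theta1 \<tau> y"
proof -
  have e: "x + 1/2 + y = x + y + 1/2" "x + 1/2 - y = x - y + 1/2"
    by simp_all
  show ?thesis
    using theta23_landen[OF assms, of "x + 1/2" y]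
    unfolding e theta_shift_half by (simp add: algebra_simps)
qed

section \<open>Addition formulas for the three ways of pairing the theta functions\<close>

lemma theta12_34_add:
  assumes "Im \<tau> > 0"
  shows "theta1 \<tau> (x + y) * theta2 \<tau> (x - y) * (theta3 \<tau> 0 * theta4 \<tau> 0) =
      (theta1 \<tau> x * theta2 \<tau> x) * (theta3 \<tau> y * theta4 \<tau> y) + (theta3 \<tau> x * theta4 \<tau> x) * (theta1 \<tau> y * theta2 \<tau> y)"
    and "theta3 \<tau> (x + y) * theta4 \<tau> (x - y) * (theta3 \<tau> 0 * theta4 \<tau> 0) =
      (theta3 \<tau> x * theta4 \<tau> x) * (theta3 \<tau> y * theta4 \<tau> y) - (theta1 \<tau> x * theta2 \<tau> x) * (theta1 \<tau> y * theta2 \<tau> y)"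
proof -
  define a1 a4 where "a1 = theta1 (2 * \<tau>)" and "a4 = theta4 (2 * \<tau>)"
  \<comment> \<open>At y = 0 one term of the Landen formula vanishes with theta_1(0), so a product
    at one point is a single value at 2 z times \<open>a4 0\<close>. Both claims are then the Landen
    formulas themselves, multiplied by the square of \<open>a4 0\<close>.\<close>
  have p34: "theta3 \<tau> z * theta4 \<tau> z = a4 (2 * z) * a4 0" for z
    using theta43_landen[OF assms, of z 0] by (simp add: a4_def mult.commute)
  have p12: "theta1 \<tau> z * theta2 \<tau> z = a1 (2 * z) * a4 0" for z
    using theta12_landen[OF assms, of z 0] by (simp add: a4_def a1_def)
  have "theta1 \<tau> (x + y) * theta2 \<tau> (x - y) = a1 (2 * x) * a4 (2 * y) + a4 (2 * x) * a1 (2 * y)"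
    using theta12_landen[OF assms, of x y] by (simp add: a1_def a4_def)
  then show "theta1 \<tau> (x + y) * theta2 \<tau> (x - y) * (theta3 \<tau> 0 * theta4 \<tau> 0) =
      (theta1 \<tau> x * theta2 \<tau> x) * (theta3 \<tau> y * theta4 \<tau> y) + (theta3 \<tau> x * theta4 \<tau> x) * (theta1 \<tau> y * theta2 \<tau> y)"
    unfolding p34 p12 by (simp only:) (simp add: algebra_simps)
  have "theta3 \<tau> (x + y) * theta4 \<tau> (x - y) = a4 (2 * x) * a4 (2 * y) - a1 (2 * x) * a1 (2 * y)"
    using theta43_landen[OF assms, of x "- y"] by (simp add: a1_def a4_def theta_minus mult.commute)
  then show "theta3 \<tau> (x + y) * theta4 \<tau> (x - y) * (theta3 \<tau> 0 * theta4 \<tau> 0) =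
      (theta3 \<tau> x * theta4 \<tau> x) * (theta3 \<tau> y * theta4 \<tau> y) - (theta1 \<tau> x * theta2 \<tau> x) * (theta1 \<tau> y * theta2 \<tau> y)"
    unfolding p34 p12 by (simp only:) (simp add: algebra_simps)
qed

text \<open>The same argument one level down: for this pairing the products at tau are bilinear in
  theta_1 and theta_2 at tau/2.\<close>

lemma theta14_23_add:
  assumes "Im \<tau> > 0"
  shows "theta1 \<tau> (x + y) * theta4 \<tau> (x - y) * (theta2 \<tau> 0 * theta3 \<tau> 0) =
      (theta1 \<tau> x * theta4 \<tau> x) * (theta2 \<tau> y * theta3 \<tau> y) + (theta2 \<tau> x * theta3 \<tau> x) * (theta1 \<tau> y * theta4 \<tau> y)"
    and "theta2 \<tau> (x + y) * theta3 \<tau> (x - y) * (theta2 \<tau> 0 * theta3 \<tau> 0) =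
      (theta2 \<tau> x * theta3 \<tau> x) * (theta2 \<tau> y * theta3 \<tau> y) - (theta1 \<tau> x * theta4 \<tau> x) * (theta1 \<tau> y * theta4 \<tau> y)"
proof -
  define b1 b2 where "b1 = theta1 (\<tau> / 2)" and "b2 = theta2 (\<tau> / 2)"
  have t: "Im (\<tau> / 2) > 0" using assms by simp
  have p23: "theta2 \<tau> (x + y) * theta3 \<tau> (x - y) = (b2 x * b2 y - b1 x * b1 y) / 2" for x y
    using theta23_landen[OF t, of x y] by (simp add: b1_def b2_def eq_divide_eq mult.commute[of _ 2])
  have p14: "theta1 \<tau> (x + y) * theta4 \<tau> (x - y) = (b1 x * b2 y + b2 x * b1 y) / 2" for x y
    using theta14_landen[OF t, of x y] by (simp add: b1_def b2_def eq_divide_eq mult.commute[of _ 2])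
  have z: "b1 0 = 0" by (simp add: b1_def)
  have q23: "theta2 \<tau> z * theta3 \<tau> z = b2 z * b2 0 / 2" for z using p23[of z 0] by (simp add: z)
  have q14: "theta1 \<tau> z * theta4 \<tau> z = b1 z * b2 0 / 2" for z using p14[of z 0] by (simp add: z)
  show "theta1 \<tau> (x + y) * theta4 \<tau> (x - y) * (theta2 \<tau> 0 * theta3 \<tau> 0) =
      (theta1 \<tau> x * theta4 \<tau> x) * (theta2 \<tau> y * theta3 \<tau> y) + (theta2 \<tau> x * theta3 \<tau> x) * (theta1 \<tau> y * theta4 \<tau> y)"
    unfolding p14 q23 q14 by (simp add: field_simps)
  show "theta2 \<tau> (x + y) * theta3 \<tau> (x - y) * (theta2 \<tau> 0 * theta3 \<tau> 0) =
      (theta2 \<tau> x * theta3 \<tau> x) * (theta2 \<tau> y * theta3 \<tau> y) - (theta1 \<tau> x * theta4 \<tau> x) * (theta1 \<tau> y * theta4 \<tau> y)"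
    unfolding p23 q23 q14 by (simp add: field_simps)
qed

text \<open>As n^2 and n have the same parity, tau -> tau + 1 acts on characteristic 0 as z -> z +
  1/2. For characteristic 1/2, (n + 1/2)^2 is 1/4 plus an even integer, which leaves only the
  constant \<omega>.\<close>

lemma theta_modular:
  defines "\<omega> \<equiv> exp (of_real pi * \<i> / 4)"
  shows "theta1 (\<tau> + 1) z = \<omega> * theta1 \<tau> z" "theta2 (\<tau> + 1) z = \<omega> * theta2 \<tau> z"
    "theta3 (\<tau> + 1) z = theta4 \<tau> z" "theta4 (\<tau> + 1) z = theta3 \<tau> z"
proof -
  have pe: "even (n\<^sup>2 + n)" for n :: int by simp
  have 0: "theta_term (\<tau> + 1) 0 z n = theta_term \<tau> 0 (z + 1/2) n" for z n
  proof -
    obtain k where k: "n\<^sup>2 - n = 2 * k" by (metis evenE even_diff pe)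
    have "(of_int n :: complex)\<^sup>2 - of_int n = 2 * of_int k"
      using arg_cong[OF k, of complex_of_int] by simp
    then have "of_real pi * \<i> * ((\<tau> + 1) * (of_int n + of_real 0)\<^sup>2 + 2 * (of_int n + of_real 0) * z)
      = 2 * of_int k * (of_real pi * \<i>) +
        of_real pi * \<i> * (\<tau> * (of_int n + of_real 0)\<^sup>2 + 2 * (of_int n + of_real 0) * (z + 1/2))"
      by (simp add: algebra_simps)
    then show ?thesis
      unfolding theta_term_def by (simp only: exp_add) (simp add: exp_eq_1)
  qed
  have 1: "theta_term (\<tau> + 1) (1/2) z n = \<omega> * theta_term \<tau> (1/2) z n" for z n
  proof -
    obtain k where k: "n\<^sup>2 + n = 2 * k" by (metis evenE pe)
    have "(of_int n :: complex)\<^sup>2 + of_int n = 2 * of_int k"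
      using arg_cong[OF k, of complex_of_int] by simp
    then have "(of_int n + of_real (1/2) :: complex)\<^sup>2 = 2 * of_int k + 1/4"
      by (simp add: power2_sum power_divide)
    then have "of_real pi * \<i> * ((\<tau> + 1) * (of_int n + of_real (1/2))\<^sup>2 + 2 * (of_int n + of_real (1/2)) * z)
      = 2 * of_int k * (of_real pi * \<i>) + of_real pi * \<i> / 4 +
        of_real pi * \<i> * (\<tau> * (of_int n + of_real (1/2))\<^sup>2 + 2 * (of_int n + of_real (1/2)) * z)"
      by (simp add: distrib_left distrib_right mult.assoc mult.left_commute)
    then show ?thesis
      unfolding theta_term_def \<omega>_def by (simp only: exp_add) (simp add: exp_eq_1)
  qed
  have c0: "theta_char (\<tau> + 1) 0 z = theta_char \<tau> 0 (z + 1/2)" for z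
    unfolding theta_char_def 0 ..
  have c1: "theta_char (\<tau> + 1) (1/2) z = \<omega> * theta_char \<tau> (1/2) z" for z
    unfolding theta_char_def 1 by (rule infsum_cmult_right')
  show "theta1 (\<tau> + 1) z = \<omega> * theta1 \<tau> z" "theta2 (\<tau> + 1) z = \<omega> * theta2 \<tau> z"
    "theta3 (\<tau> + 1) z = theta4 \<tau> z"
    by (simp_all add: theta1_eq theta2_eq theta3_eq theta4_eq c0 c1)
  show "theta4 (\<tau> + 1) z = theta3 \<tau> z"
    using theta_char_0_shift_1[of \<tau> z] by (simp add: theta3_eq theta4_eq c0 add.assoc)
qed

text \<open>\<open>theta14_23_add\<close> at tau + 1, where theta_3 and theta_4 have changed places;
  every term contains exactly two factors \<omega>, which cancel.\<close>

lemma theta13_24_add: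
  assumes "Im \<tau> > 0"
  shows "theta1 \<tau> (x + y) * theta3 \<tau> (x - y) * (theta2 \<tau> 0 * theta4 \<tau> 0) =
      (theta1 \<tau> x * theta3 \<tau> x) * (theta2 \<tau> y * theta4 \<tau> y) + (theta2 \<tau> x * theta4 \<tau> x) * (theta1 \<tau> y * theta3 \<tau> y)"
    and "theta2 \<tau> (x + y) * theta4 \<tau> (x - y) * (theta2 \<tau> 0 * theta4 \<tau> 0) =
      (theta2 \<tau> x * theta4 \<tau> x) * (theta2 \<tau> y * theta4 \<tau> y) - (theta1 \<tau> x * theta3 \<tau> x) * (theta1 \<tau> y * theta3 \<tau> y)"
proof -
  have t: "Im (\<tau> + 1) > 0" using assms by simp
  define \<omega> where "\<omega> = exp (of_real pi * \<i> / 4 :: complex)"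
  have w: "\<omega> * \<omega> \<noteq> 0" by (simp add: \<omega>_def)
  have "\<omega> * \<omega> * (theta1 \<tau> (x + y) * theta3 \<tau> (x - y) * (theta2 \<tau> 0 * theta4 \<tau> 0)) =
      \<omega> * \<omega> * ((theta1 \<tau> x * theta3 \<tau> x) * (theta2 \<tau> y * theta4 \<tau> y) + (theta2 \<tau> x * theta4 \<tau> x) * (theta1 \<tau> y * theta3 \<tau> y))"
    using theta14_23_add(1)[OF t, of x y]
    unfolding theta_modular \<omega>_def[symmetric] by (simp only: algebra_simps)
  then show "theta1 \<tau> (x + y) * theta3 \<tau> (x - y) * (theta2 \<tau> 0 * theta4 \<tau> 0) =
      (theta1 \<tau> x * theta3 \<tau> x) * (theta2 \<tau> y * theta4 \<tau> y) + (theta2 \<tau> x * theta4 \<tau> x) * (theta1 \<tau> y * theta3 \<tau> y)"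
    using w by simp
  have "\<omega> * \<omega> * (theta2 \<tau> (x + y) * theta4 \<tau> (x - y) * (theta2 \<tau> 0 * theta4 \<tau> 0)) =
      \<omega> * \<omega> * ((theta2 \<tau> x * theta4 \<tau> x) * (theta2 \<tau> y * theta4 \<tau> y) - (theta1 \<tau> x * theta3 \<tau> x) * (theta1 \<tau> y * theta3 \<tau> y))"
    using theta14_23_add(2)[OF t, of x y]
    unfolding theta_modular \<omega>_def[symmetric] by (simp only: algebra_simps)
  then show "theta2 \<tau> (x + y) * theta4 \<tau> (x - y) * (theta2 \<tau> 0 * theta4 \<tau> 0) =
      (theta2 \<tau> x * theta4 \<tau> x) * (theta2 \<tau> y * theta4 \<tau> y) - (theta1 \<tau> x * theta3 \<tau> x) * (theta1 \<tau> y * theta3 \<tau> y)"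
    using w by simp
qed

section \<open>Zeros of theta functions on the real line\<close>

lemma has_sum_int_fold:
  fixes f :: "int \<Rightarrow> complex"
  assumes "(f has_sum S) UNIV"
  shows "(\<lambda>n. f (int n) + f (- 1 - int n)) sums S"
proof -
  have f: "f summable_on A" for A
    using assms summable_on_subset_banach[OF has_sum_imp_summable[OF assms]] by simp
  have "((\<lambda>n. f (int n)) has_sum infsum f (range int)) UNIV"
    using has_sum_infsum[OF f[of "range int"]] by (subst (asm) has_sum_reindex) (auto simp: o_def)
  moreover have "((\<lambda>n. f (- 1 - int n)) has_sum infsum f (range (\<lambda>n. - 1 - int n))) UNIV"
    using has_sum_infsum[OF f[of "range (\<lambda>n. - 1 - int n)"]]
    by (subst (asm) has_sum_reindex) (auto simp: o_def inj_on_def)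
  ultimately have "((\<lambda>n. f (int n) + f (- 1 - int n)) has_sum
      infsum f (range int) + infsum f (range (\<lambda>n. - 1 - int n))) UNIV"
    by (rule has_sum_add)
  moreover have "infsum f (range int) + infsum f (range (\<lambda>n. - 1 - int n)) = S"
  proof -
    have "n \<in> range int \<union> range (\<lambda>n. - 1 - int n)" for n
      by (cases "n \<ge> 0") (auto simp: image_iff intro: exI[of _ "nat (- n - 1)"] dest: nonneg_int_cases)
    then have "range int \<union> range (\<lambda>n. - 1 - int n) = UNIV" by blast
    moreover have "range int \<inter> range (\<lambda>n. - 1 - int n) = {}" by auto
    ultimately show ?thesis
      using infsum_Un_disjoint[OF f f, of "range int" "range (\<lambda>n. - 1 - int n)"] infsumI[OF assms]
      by simp
  qed
  ultimately show ?thesis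
    using has_sum_imp_sums by metis
qed

lemma sums_geometric_tail_bound:
  fixes g :: "nat \<Rightarrow> complex"
  assumes g: "g sums S" and s: "0 \<le> s" "s < 1" and le: "\<And>n. n \<ge> 1 \<Longrightarrow> norm (g n) \<le> K * s ^ n"
  shows "norm (S - g 0) \<le> K * s / (1 - s)"
proof -
  have "(\<lambda>n. g (Suc n)) sums (S - g 0)"
    using g by (simp add: sums_Suc_iff)
  moreover have "(\<lambda>n. K * s * s ^ n) sums (K * s * (1 / (1 - s)))"
    using s by (intro sums_mult geometric_sums) auto
  moreover have "norm (g (Suc n)) \<le> K * s * s ^ n" for n
    using le[of "Suc n"] by (simp add: mult.assoc)
  ultimately have "norm (S - g 0) \<le> K * s * (1 / (1 - s))"
    by (rule norm_sums_le)
  then show ?thesis by simp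
qed

lemma exp_neg_pi_less:
  assumes "t \<ge> 1"
  shows "exp (- pi * t) < 1 / 3"
proof -
  have "pi \<le> pi * t" using assms by simp
  then have "3 < 1 + pi * t" using pi_gt3 by linarith
  also have "\<dots> \<le> exp (pi * t)" by (rule exp_ge_add_one_self)
  finally show ?thesis by (simp add: exp_minus field_simps)
qed

text \<open>The terms for n = 0 and n = -1 add up to at least 1 - r in modulus, and all others to at
  most (1 + r) r / (1 - r). Equating the sum to 0 would force 3 r \<ge> 1, which is why
  \<open>exp_neg_pi_less\<close> has the constant 1/3.\<close>

lemma theta3_nonzero_large:
  assumes "Im \<tau> \<ge> 1" "Im v = 0"
  shows "theta3 \<tau> v \<noteq> 0"
proof
  assume "theta3 \<tau> v = 0"
  define r where "r = exp (- pi * Im \<tau>)"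
  have r: "0 < r" "r < 1 / 3" using exp_neg_pi_less[OF assms(1)] by (auto simp: r_def)
  let ?f = "theta_term \<tau> 0 v"
  define g where "g n = ?f (int n) + ?f (- 1 - int n)" for n
  have t: "Im \<tau> > 0" using assms(1) by simp
  have g: "g sums 0"
    using has_sum_int_fold[OF has_sum_theta_char[OF t, of 0 v]] \<open>theta3 \<tau> v = 0\<close>
    by (simp add: theta3_eq g_def[abs_def])
  have nf: "norm (?f n) = r ^ nat (n\<^sup>2)" for n
    using assms(2) by (simp add: norm_theta_term r_def exp_of_nat_mult[symmetric] algebra_simps)
  have nf_le: "norm (?f n) \<le> r ^ m" if "int m \<le> n\<^sup>2" for n m
    unfolding nf using r that by (intro power_decreasing) auto
  have "norm (0 - g 0) \<le> (1 + r) * r / (1 - r)"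
  proof (rule sums_geometric_tail_bound[OF g])
    fix n :: nat assume "n \<ge> 1"
    have sq: "int k \<le> (int k)\<^sup>2" for k
      by (simp add: power2_nat_le_imp_le power2_eq_square mult_le_cancel_left1 flip: of_nat_mult)
    have "norm (g n) \<le> r ^ n + r ^ Suc n"
      unfolding g_def using sq[of n] sq[of "Suc n"]
      by (intro order_trans[OF norm_triangle_ineq] add_mono nf_le)
         (auto simp: power2_eq_square algebra_simps)
    then show "norm (g n) \<le> (1 + r) * r ^ n" by (simp add: algebra_simps)
  qed (use r in auto)
  moreover have "norm (g 0) \<ge> 1 - r"
  proof -
    have "?f 0 = 1" by (simp add: theta_term_def)
    moreover have "norm (?f (- 1)) = r" by (simp add: nf)
    ultimately show ?thesis
      using norm_diff_ineq[of "?f 0" "?f (- 1)"] by (simp add: g_def)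
  qed
  ultimately have "1 - r \<le> (1 + r) * r / (1 - r)" by simp
  then have "(1 - r) * (1 - r) \<le> (1 + r) * r"
    using r by (simp add: pos_le_divide_eq)
  then show False using r by (simp add: algebra_simps)
qed

text \<open>Extracts the factor cos x from every term of the theta_2 series, so that the leading
  term dominates the rest even arbitrarily close to a zero of the cosine.\<close>

lemma abs_cos_odd_mult_le: "\<bar>cos ((2 * real n + 1) * x)\<bar> \<le> (2 * real n + 1) * \<bar>cos x\<bar>"
proof (induction n)
  case (Suc n)
  have s2: "\<bar>sin (2 * x)\<bar> \<le> 2 * \<bar>cos x\<bar>"
    by (simp add: sin_double abs_mult mult_left_le_one_le)
  have "(2 * real (Suc n) + 1) * x = (2 * real n + 1) * x + 2 * x" by (simp add: algebra_simps)
  then have "cos ((2 * real (Suc n) + 1) * x) =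
      cos ((2 * real n + 1) * x) * cos (2 * x) - sin ((2 * real n + 1) * x) * sin (2 * x)"
    by (simp only: cos_add)
  also have "\<bar>\<dots>\<bar> \<le> \<bar>cos ((2 * real n + 1) * x)\<bar> * \<bar>cos (2 * x)\<bar> + \<bar>sin ((2 * real n + 1) * x)\<bar> * \<bar>sin (2 * x)\<bar>"
    by (metis abs_mult abs_triangle_ineq4)
  also have "\<dots> \<le> \<bar>cos ((2 * real n + 1) * x)\<bar> * 1 + 1 * \<bar>sin (2 * x)\<bar>"
    by (intro add_mono mult_left_mono mult_right_mono) auto
  also have "\<dots> \<le> (2 * real n + 1) * \<bar>cos x\<bar> + 2 * \<bar>cos x\<bar>"
    using Suc s2 by simp
  finally show ?case by (simp add: algebra_simps)
qed simp

lemma theta2_nonzero_large: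
  fixes v :: real
  assumes t: "Im \<tau> \<ge> 1" and v: "cos (pi * v) \<noteq> 0"
  shows "theta2 \<tau> v \<noteq> 0"
proof
  assume 0: "theta2 \<tau> v = 0"
  define r where "r = exp (- pi * Im \<tau>)"
  have r: "0 < r" "r < 1 / 3" using exp_neg_pi_less[OF assms(1)] by (auto simp: r_def)
  define f where "f = theta_term \<tau> (1/2) v"
  \<comment> \<open>The indices n and -1 - n have the same (n + 1/2)^2, so each pair combines into a
    single cosine.\<close>
  define g where "g n = f (int n) + f (- 1 - int n)" for n
  define q where "q = exp (of_real pi * \<i> * \<tau> / 4)"
  have g: "g sums 0"
    using has_sum_int_fold[OF has_sum_theta_char[of \<tau> "1/2" v]] 0 t
    by (simp add: theta2_eq g_def[abs_def] f_def)
  have g_eq: "g n = q * exp (of_real pi * \<i> * \<tau> * of_nat (n * n + n)) * of_real (2 * cos ((2 * real n + 1) * (pi * v)))" for n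
  proof -
    let ?w = "\<i> * of_real ((2 * real n + 1) * (pi * v))"
    let ?Q = "of_real pi * \<i> * \<tau> / 4 + of_real pi * \<i> * \<tau> * of_nat (n * n + n)"
    have "f (int n) = exp (?Q + ?w)" "f (- 1 - int n) = exp (?Q + - ?w)"
      unfolding f_def theta_term_def
      by (rule arg_cong[where f = exp], simp add: power2_eq_square field_simps)+
    then have "g n = exp ?Q * (exp ?w + exp (- ?w))"
      by (simp only: g_def exp_add distrib_left)
    also have "exp ?w + exp (- ?w) = of_real (2 * cos ((2 * real n + 1) * (pi * v)))"
    proof -
      have "exp (\<i> * of_real x) + exp (- (\<i> * of_real x)) = of_real (2 * cos x)" for x
        using cos_exp_eq[of "of_real x"] by (simp add: cos_of_real mult.commute[of _ 2])
      then show ?thesis .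
    qed
    finally show ?thesis by (simp add: q_def exp_add)
  qed
  have ne: "norm (exp (of_real pi * \<i> * \<tau> * of_nat k)) = r ^ k" for k
    by (simp add: r_def exp_of_nat_mult[symmetric] algebra_simps)
  have ng: "norm (g n) = 2 * norm q * r ^ (n * n + n) * \<bar>cos ((2 * real n + 1) * (pi * v))\<bar>" for n
    unfolding g_eq norm_mult ne norm_of_real by (simp add: abs_mult)
  \<comment> \<open>For n \<ge> 1, n^2 + n \<ge> 2 n and 2 n + 1 \<le> 3^n, so the n-th term is at
    most (3 r^2)^n times the leading one. The bound s < 1/2 makes the tail ratio s / (1 - s) less
    than 1.\<close>
  define s where "s = 3 * r\<^sup>2"
  have s: "0 < s" "s < 1 / 2"
  proof -
    have "r * r < (1 / 3) * (1 / 3)" using r by (intro mult_strict_mono) auto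
    then show "s < 1 / 2" by (simp add: s_def power2_eq_square)
  qed (use r in \<open>simp add: s_def\<close>)
  have "norm (0 - g 0) \<le> (2 * norm q * \<bar>cos (pi * v)\<bar>) * s / (1 - s)"
  proof (rule sums_geometric_tail_bound[OF g])
    fix n :: nat assume n: "n \<ge> 1"
    have three: "2 * real n + 1 \<le> 3 ^ n" for n
      by (induction n) auto
    have "n * n + n \<ge> 2 * n" using n by simp
    then have "r ^ (n * n + n) \<le> r ^ (2 * n)" using r by (intro power_decreasing) auto
    then have "norm (g n) \<le> 2 * norm q * r ^ (2 * n) * ((2 * real n + 1) * \<bar>cos (pi * v)\<bar>)"
      unfolding ng using r abs_cos_odd_mult_le[of n "pi * v"]
      by (intro mult_mono) auto
    also have "\<dots> \<le> 2 * norm q * r ^ (2 * n) * (3 ^ n * \<bar>cos (pi * v)\<bar>)"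
      using r three by (intro mult_left_mono mult_right_mono) auto
    also have "\<dots> = 2 * norm q * \<bar>cos (pi * v)\<bar> * s ^ n"
      by (simp add: s_def power_mult_distrib power_mult)
    finally show "norm (g n) \<le> 2 * norm q * \<bar>cos (pi * v)\<bar> * s ^ n" .
  qed (use s in auto)
  then have "(2 * norm q * \<bar>cos (pi * v)\<bar>) * 1 \<le> (2 * norm q * \<bar>cos (pi * v)\<bar>) * (s / (1 - s))"
    using ng[of 0] by simp
  moreover have "2 * norm q * \<bar>cos (pi * v)\<bar> > 0" using v by (simp add: q_def)
  ultimately have "1 \<le> s / (1 - s)"
    by (simp only: mult_le_cancel_left_pos)
  then show False using s by (simp add: field_simps)
qed

text \<open>Im tau doubles at each step, so finitely many steps reach Im tau \<ge> 1, where a series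
  is dominated by its first terms.\<close>

lemma double_descent:
  assumes step: "\<And>\<tau>. Im \<tau> > 0 \<Longrightarrow> P (2 * \<tau>) \<Longrightarrow> P \<tau>"
    and large: "\<And>\<tau>. Im \<tau> \<ge> 1 \<Longrightarrow> P \<tau>"
    and t: "Im \<tau> > 0"
  shows "P \<tau>"
proof -
  have "P \<tau>" if "2 ^ n * Im \<tau> \<ge> 1" "Im \<tau> > 0" for n \<tau>
    using that
  proof (induction n arbitrary: \<tau>)
    case (Suc n)
    then have "P (2 * \<tau>)" by (intro Suc.IH) (auto simp: mult_ac)
    then show ?case using step Suc.prems by blast
  qed (use large in auto)
  moreover obtain n where "1 / Im \<tau> < 2 ^ n" using real_arch_pow[of 2] by auto
  then have "2 ^ n * Im \<tau> \<ge> 1" using t by (simp add: field_simps)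
  ultimately show ?thesis using t by blast
qed

lemma theta3_nonzero:
  assumes t: "Im \<tau> > 0" and v: "Im v = 0"
  shows "theta3 \<tau> v \<noteq> 0"
proof -
  have "\<forall>v. Im v = 0 \<longrightarrow> theta3 \<tau> v \<noteq> 0"
  proof (rule double_descent[OF _ _ t])
    fix \<tau> assume t: "Im \<tau> > 0" and IH: "\<forall>v. Im v = 0 \<longrightarrow> theta3 (2 * \<tau>) v \<noteq> 0"
    \<comment> \<open>At y = 0 the Landen formula writes this product as two values of theta_4 for 2
      tau at real points, and theta_4 is theta_3 at a real translate.\<close>
    have "theta4 \<tau> v * theta3 \<tau> v \<noteq> 0" if "Im v = 0" for v
      using theta43_landen[OF t, of v 0] IH that by (simp add: theta4_def)
    then show "\<forall>v. Im v = 0 \<longrightarrow> theta3 \<tau> v \<noteq> 0" by auto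
  qed (use theta3_nonzero_large in blast)
  then show ?thesis using v by blast
qed

lemma theta4_nonzero:
  assumes "Im \<tau> > 0" "Im v = 0"
  shows "theta4 \<tau> v \<noteq> 0"
  unfolding theta4_def using assms by (intro theta3_nonzero) auto

lemma theta2_nonzero:
  fixes v :: real
  assumes t: "Im \<tau> > 0" and v: "cos (pi * v) \<noteq> 0"
  shows "theta2 \<tau> v \<noteq> 0"
proof -
  have "\<forall>v :: real. cos (pi * v) \<noteq> 0 \<longrightarrow> theta2 \<tau> v \<noteq> 0"
  proof (rule double_descent[OF _ _ t])
    fix \<tau> assume t: "Im \<tau> > 0" and IH: "\<forall>v :: real. cos (pi * v) \<noteq> 0 \<longrightarrow> theta2 (2 * \<tau>) v \<noteq> 0"
    have t2: "Im (2 * \<tau>) > 0" using t by simp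
    have z: "theta2 \<tau> 0 \<noteq> 0"
    proof
      assume "theta2 \<tau> 0 = 0"
      then have "theta2 (2 * \<tau>) 0 * theta3 (2 * \<tau>) 0 = 0"
        using theta2_product[OF t, of 0 0] by simp
      then show False using IH[rule_format, of 0] theta3_nonzero[OF t2, of 0] by simp
    qed
    show "\<forall>v :: real. cos (pi * v) \<noteq> 0 \<longrightarrow> theta2 \<tau> v \<noteq> 0"
    proof (intro allI impI notI)
      fix v :: real assume v: "cos (pi * v) \<noteq> 0" and 0: "theta2 \<tau> v = 0"
      \<comment> \<open>A zero of theta_2 at v gives a zero of theta_1 for 2 tau at 2 v, that is of
        theta_2 at 2 v - 1/2, hence sin (2 pi v) = 0. Since cos (pi v) is not 0, v is an integer,
        where theta_2 equals theta_2(0) up to sign.\<close>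
      have "theta1 (2 * \<tau>) (2 * v) = 0"
        using theta12_landen[OF t, of v 0] theta4_nonzero[OF t2, of 0] 0 by simp
      then have "theta2 (2 * \<tau>) (complex_of_real (2 * v - 1/2)) = 0"
        using theta2_def[of "2 * \<tau>" "complex_of_real (2 * v - 1/2)"] by simp
      then have "cos (pi * (2 * v - 1/2)) = 0" using IH by blast
      then have "sin (2 * (pi * v)) = 0"
        by (simp add: algebra_simps cos_diff)
      then have "sin (pi * v) = 0" using v by (simp add: sin_double)
      then obtain n :: int where n: "v = of_int n" using sin_zero_iff_int2[of "pi * v"] by auto
      have "theta2 \<tau> (of_int n) = theta2 \<tau> 0 \<or> theta2 \<tau> (of_int n) = - theta2 \<tau> 0" for n :: int
      proof (induction n rule: int_induct[of _ 0])
        case (step1 i) then show ?case by (auto simp: theta_shift_1)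
      next
        case (step2 i) then show ?case using theta_shift_1(2)[of \<tau> "of_int i - 1"]
          by (auto simp: minus_equation_iff)
      qed simp
      then show False using 0 n z by (metis neg_equal_0_iff_equal of_real_of_int_eq)
    qed
  qed (use theta2_nonzero_large in blast)
  then show ?thesis using v by blast
qed

lemma cos_pi_eq_0_unit_interval:
  assumes "0 < v" "v < 1" "cos (pi * v) = 0"
  shows "v = 1 / 2"
proof -
  have "pi * v = pi / 2"
    by (rule cos_inj_pi) (use assms in simp_all)
  then show ?thesis by simp
qed

section \<open>Complex conjugation, and the function d\<close>

lemma cnj_theta_char:
  assumes "Re \<tau> = 0"
  shows "cnj (theta_char \<tau> a z) = theta_char \<tau> a (- cnj z)"
proof -
  have "cnj \<tau> = - \<tau>" using assms by (simp add: complex_eq_iff)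
  then have "cnj (theta_term \<tau> a z n) = theta_term \<tau> a (- cnj z) n" for n
    unfolding theta_term_def exp_cnj by (intro arg_cong[of _ _ exp]) (simp add: algebra_simps)
  then show ?thesis
    unfolding theta_char_def infsum_cnj[symmetric] by simp
qed

lemma cnj_theta:
  assumes "Re \<tau> = 0"
  shows "cnj (theta1 \<tau> z) = theta1 \<tau> (cnj z)" "cnj (theta2 \<tau> z) = theta2 \<tau> (cnj z)"
    "cnj (theta3 \<tau> z) = theta3 \<tau> (cnj z)" "cnj (theta4 \<tau> z) = theta4 \<tau> (cnj z)"
proof -
  note c = cnj_theta_char[OF assms]
  have h: "- (cnj z + 1/2) = - cnj z - 1/2" for z by simp
  show "cnj (theta2 \<tau> z) = theta2 \<tau> (cnj z)" "cnj (theta3 \<tau> z) = theta3 \<tau> (cnj z)"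
    by (simp_all add: theta2_eq theta3_eq c theta_char_half_minus theta_char_0_minus)
  show "cnj (theta1 \<tau> z) = theta1 \<tau> (cnj z)" "cnj (theta4 \<tau> z) = theta4 \<tau> (cnj z)"
    using theta_char_half_minus[of \<tau> "cnj z + 1/2"] theta_char_0_minus[of \<tau> "cnj z + 1/2"]
    by (simp_all add: theta1_eq theta4_eq c h)
qed

text \<open>Conjugation changes the sign of i, and the oddness of theta_1 turns this into a change
  of sign of the argument. On the real line, conj d(u) = d(-u).\<close>

lemma cnj_theta_d:
  assumes "Re \<tau> = 0"
  shows "cnj (theta_d \<tau> c z) = theta_d \<tau> c (- cnj z)"
  by (simp add: theta_d_def cnj_theta[OF assms] theta_minus)

text \<open>Up to the factor c^-2 the product is a sum of two squares, which the addition formula at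
  z and -z evaluates. The normalisation of \<open>c\<close> is the one that leaves no
  constant.\<close>

lemma theta_d_times_minus:
  assumes t: "Im \<tau> > 0" and c: "c \<noteq> 0" "(of_real c)\<^sup>2 = (theta3 \<tau> 0)\<^sup>2 * theta4 \<tau> 0"
  shows "theta_d \<tau> c z * theta_d \<tau> c (- z) = theta4 \<tau> (2 * z)"
proof -
  have "theta_d \<tau> c z * theta_d \<tau> c (- z) * (of_real c)\<^sup>2 =
      (theta3 \<tau> z * theta4 \<tau> z)\<^sup>2 + (theta1 \<tau> z * theta2 \<tau> z)\<^sup>2"
    using c(1) by (simp add: theta_d_def theta_minus power2_eq_square field_simps)
  also have "\<dots> = theta4 \<tau> (2 * z) * (of_real c)\<^sup>2"
    using theta12_34_add(2)[OF t, of z "- z"] unfolding c(2)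
    by (simp add: theta_minus power2_eq_square mult_ac)
  finally show ?thesis using c(1) by simp
qed

lemma theta_d_nonzero:
  assumes "Im \<tau> > 0" "c \<noteq> 0" "(of_real c)\<^sup>2 = (theta3 \<tau> 0)\<^sup>2 * theta4 \<tau> 0" "Im z = 0"
  shows "theta_d \<tau> c z \<noteq> 0"
  using theta_d_times_minus[OF assms(1-3), of z] theta4_nonzero[OF assms(1), of "2 * z"] assms(4) by auto

lemma theta_d_shift_1: "theta_d \<tau> c (z + 1) = theta_d \<tau> c z"
  by (simp add: theta_d_def theta_shift_1)

lemma holomorphic_theta [holomorphic_intros]:
  assumes "Im \<tau> > 0" "f holomorphic_on A"
  shows "(\<lambda>z. theta1 \<tau> (f z)) holomorphic_on A" "(\<lambda>z. theta2 \<tau> (f z)) holomorphic_on A"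
    "(\<lambda>z. theta3 \<tau> (f z)) holomorphic_on A" "(\<lambda>z. theta4 \<tau> (f z)) holomorphic_on A"
proof -
  have "(\<lambda>z. theta_char \<tau> a (g z)) holomorphic_on A" if "g holomorphic_on A" for a g
    using holomorphic_on_compose[OF that holomorphic_on_subset[OF holomorphic_theta_char[OF assms(1)]]]
    by (simp add: o_def)
  note h = this
  show "(\<lambda>z. theta1 \<tau> (f z)) holomorphic_on A" "(\<lambda>z. theta2 \<tau> (f z)) holomorphic_on A"
    "(\<lambda>z. theta3 \<tau> (f z)) holomorphic_on A" "(\<lambda>z. theta4 \<tau> (f z)) holomorphic_on A"
    unfolding theta1_eq theta2_eq theta3_eq theta4_eq
    by (intro holomorphic_intros h assms)+
qed

lemma holomorphic_theta_d [holomorphic_intros]: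
  assumes "Im \<tau> > 0" "f holomorphic_on A"
  shows "(\<lambda>z. theta_d \<tau> c (f z)) holomorphic_on A"
  unfolding theta_d_def divide_inverse using assms by (intro holomorphic_intros)

lemma norm_theta_le:
  assumes "Im \<tau> > 0"
  shows "\<exists>K. \<forall>z. \<bar>Im z\<bar> \<le> Y \<longrightarrow> norm (theta1 \<tau> z) \<le> K \<and> norm (theta2 \<tau> z) \<le> K \<and>
           norm (theta3 \<tau> z) \<le> K \<and> norm (theta4 \<tau> z) \<le> K"
proof -
  define K where "K a = (\<Sum>\<^sub>\<infinity>n. theta_bound (Im \<tau>) a Y n)" for a
  have "norm (theta_char \<tau> a z) \<le> K a" if "\<bar>Im z\<bar> \<le> Y" for a z
    unfolding K_def by (rule norm_theta_char_le[OF assms that])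
  then show ?thesis
    by (intro exI[of _ "max (K 0) (K (1/2))"])
       (auto simp: theta1_eq theta2_eq theta3_eq theta4_eq le_max_iff_disj)
qed

section \<open>Analyticity on strips\<close>

definition strip :: "real \<Rightarrow> complex set" where
  "strip \<delta> = {z. \<bar>Im z\<bar> < \<delta>}"

lemma open_strip: "open (strip \<delta>)"
  unfolding strip_def by (intro open_Collect_less continuous_intros)

lemma strip_shift [simp]: "Im x = 0 \<Longrightarrow> z + x \<in> strip \<delta> \<longleftrightarrow> z \<in> strip \<delta>"
  by (simp add: strip_def)

lemma of_real_in_strip: "0 < \<delta> \<Longrightarrow> complex_of_real u \<in> strip \<delta>"
  by (simp add: strip_def)

text \<open>Bridge from complex derivatives to real ones, one-sided at end points. Nontriviality of
  the filter makes the derivative within \<open>S\<close> unique.\<close>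

lemma nderiv_within_holomorphic:
  assumes F: "F holomorphic_on U" "open U" and S: "\<And>x. x \<in> S \<Longrightarrow> of_real x \<in> U"
    and f: "\<And>x. x \<in> S \<Longrightarrow> f x = F (of_real x)" and lim: "\<And>x. x \<in> S \<Longrightarrow> at x within S \<noteq> bot"
  shows "\<And>x. x \<in> S \<Longrightarrow> nderiv_within S k f x = (deriv ^^ k) F (of_real x)"
    and "smooth_within S f"
proof -
  have step: "(g has_vector_derivative (deriv ^^ Suc k) F (of_real x)) (at x within S)"
    if g: "\<And>x. x \<in> S \<Longrightarrow> g x = (deriv ^^ k) F (of_real x)" and x: "x \<in> S" for g k x
  proof (rule has_vector_derivative_transform[OF x g])
    have "(deriv ^^ k) F holomorphic_on U" by (rule holomorphic_higher_deriv[OF F])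
    then have "((deriv ^^ k) F has_field_derivative deriv ((deriv ^^ k) F) (of_real x)) (at (of_real x))"
      by (rule holomorphic_derivI[OF _ F(2) S[OF x]])
    then show "((\<lambda>x. (deriv ^^ k) F (of_real x)) has_vector_derivative (deriv ^^ Suc k) F (of_real x)) (at x within S)"
      by (simp add: has_vector_derivative_real_field)
  qed
  have nd: "nderiv_within S k f x = (deriv ^^ k) F (of_real x)" if "x \<in> S" for k x
    using that
  proof (induction k arbitrary: x)
    case (Suc k)
    then show ?case
      using vector_derivative_within[OF lim step[of "nderiv_within S k f" k x]]
      by (simp add: nderiv_within_def)
  qed (simp add: nderiv_within_def f)
  then show "\<And>x. x \<in> S \<Longrightarrow> nderiv_within S k f x = (deriv ^^ k) F (of_real x)" .
  show "smooth_within S f"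
    unfolding smooth_within_def differentiable_on_def
    using step[OF nd] by (auto intro: differentiableI_vector)
qed

lemma norm_higher_deriv_le:
  assumes F: "F holomorphic_on U" and "0 < r" "cball x r \<subseteq> U" and le: "\<And>z. z \<in> U \<Longrightarrow> norm (F z) \<le> A"
  shows "norm ((deriv ^^ k) F x) \<le> fact k * A / r ^ k"
proof (rule Cauchy_inequality)
  show "F holomorphic_on ball x r"
    using F assms(3) ball_subset_cball by (blast intro: holomorphic_on_subset)
  show "continuous_on (cball x r) F"
    using F assms(3) by (blast intro: continuous_on_subset holomorphic_on_imp_continuous_on)
  show "norm (F z) \<le> A" if "norm (x - z) = r" for z
    using that assms(3) by (intro le) (auto simp: dist_norm)
qed fact

lemma cball_subset_strip:
  assumes "0 < \<delta>" shows "cball (complex_of_real u) (\<delta> / 2) \<subseteq> strip \<delta>"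
proof
  fix z assume "z \<in> cball (complex_of_real u) (\<delta> / 2)"
  then have "norm (complex_of_real u - z) \<le> \<delta> / 2" by (simp add: dist_norm)
  moreover have "\<bar>Im (complex_of_real u - z)\<bar> \<le> norm (complex_of_real u - z)" by (rule abs_Im_le_cmod)
  ultimately show "z \<in> strip \<delta>" using assms by (simp add: strip_def)
qed

text \<open>One bound \<open>A\<close> on one strip controls every seminorm of the torus linearly in
  \<open>A\<close>; this is what allows series of such elements to be estimated term by
  term.\<close>

definition analytic_torus :: "real \<Rightarrow> int \<Rightarrow> real \<Rightarrow> (int \<Rightarrow> complex \<Rightarrow> complex) \<Rightarrow> bool" where
  "analytic_torus \<delta> N A a \<longleftrightarrow> (\<forall>n. a n holomorphic_on strip \<delta>) \<and>
     (\<forall>n. \<forall>z\<in>strip \<delta>. norm (a n z) \<le> A \<and> a n (z + 1) = a n z) \<and> (\<forall>n z. N < \<bar>n\<bar> \<longrightarrow> a n z = 0)"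

text \<open>Cauchy's estimate on discs of radius \<delta>/2 about real points, times the largest
  weight that occurs.\<close>

definition torus_const :: "real \<Rightarrow> int \<Rightarrow> nat \<Rightarrow> nat \<Rightarrow> real" where
  "torus_const \<delta> N j k = (1 + \<bar>of_int N\<bar>) ^ k * (fact j / (\<delta> / 2) ^ j)"

lemma torus_const_nonneg: "0 < \<delta> \<Longrightarrow> 0 \<le> torus_const \<delta> N j k"
  by (simp add: torus_const_def)

lemma torus_weight_analytic_le:
  assumes d: "0 < \<delta>" and a: "analytic_torus \<delta> N A a"
  shows "torus_weight j k (\<lambda>n u. a n (of_real u)) p \<le> torus_const \<delta> N j k * A"
proof (cases p)
  case (Pair n u)
  have nd: "nderiv_within UNIV j (\<lambda>u. a n (of_real u)) u = (deriv ^^ j) (a n) (of_real u)"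
    using a d by (intro nderiv_within_holomorphic[where U = "strip \<delta>"])
      (auto simp: analytic_torus_def open_strip of_real_in_strip)
  have A: "A \<ge> 0"
  proof -
    have "norm (a 0 0) \<le> A"
      using a d by (auto simp: analytic_torus_def strip_def)
    then show ?thesis using norm_ge_zero order_trans by blast
  qed
  \<comment> \<open>For |n| > N the coefficient vanishes and Cauchy's estimate is applied with bound
    0, so that the growth of the weight in n does no harm.\<close>
  define B where "B = (if \<bar>n\<bar> \<le> N then A else 0)"
  have "norm ((deriv ^^ j) (a n) (of_real u)) \<le> fact j * B / (\<delta> / 2) ^ j"
    using a d by (intro norm_higher_deriv_le[OF _ _ cball_subset_strip[OF d]])
      (auto simp: analytic_torus_def B_def)
  then have "torus_weight j k (\<lambda>n u. a n (of_real u)) p \<le> (1 + \<bar>of_int n\<bar>) ^ k * (fact j * B / (\<delta> / 2) ^ j)"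
    unfolding Pair torus_weight_def by (simp only: nd split_conv) (intro mult_left_mono; simp)
  also have "\<dots> \<le> (1 + \<bar>of_int N\<bar>) ^ k * (fact j * A / (\<delta> / 2) ^ j)"
  proof (cases "\<bar>n\<bar> \<le> N")
    case True
    then have "\<bar>real_of_int n\<bar> \<le> \<bar>of_int N\<bar>" by linarith
    then show ?thesis
      using d A True unfolding B_def by (intro mult_mono power_mono) auto
  qed (use d A in \<open>simp add: B_def\<close>)
  finally show ?thesis by (simp add: torus_const_def)
qed

lemma analytic_torus_carrier:
  assumes d: "0 < \<delta>" and a: "analytic_torus \<delta> N A a"
  shows "(\<lambda>n u. a n (of_real u)) \<in> carrier (smooth_torus \<eta>)"
proof -
  have "smooth_within UNIV (\<lambda>u. a n (of_real u))" for n
    using a d by (intro nderiv_within_holomorphic[where U = "strip \<delta>" and F = "a n"])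
      (auto simp: analytic_torus_def open_strip of_real_in_strip)
  moreover have "a n (of_real u + 1) = a n (of_real u)" for n u
    using a of_real_in_strip[OF d] by (auto simp: analytic_torus_def)
  moreover have "bdd_above (range (torus_weight j k (\<lambda>n u. a n (of_real u))))" for j k
    using torus_weight_analytic_le[OF assms] by (auto intro!: bdd_aboveI)
  ultimately show ?thesis
    by (simp add: smooth_torus_def smooth_circle_def)
qed

lemma torus_seminorm_analytic_le:
  assumes d: "0 < \<delta>" and a: "analytic_torus \<delta> N A a"
  shows "torus_seminorm M (\<lambda>n u. a n (of_real u)) \<le> (\<Sum>j\<le>M. torus_const \<delta> N j M) * A"
  unfolding torus_seminorm_def sum_distrib_right
  by (intro cSUP_least sum_mono torus_weight_analytic_le assms) simp

text \<open>A real supremum lies above the values of the family only if these are bounded; the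
  carrier condition supplies that before one point is compared with the supremum.\<close>

lemma torus_seminorm_nonneg:
  assumes "a \<in> carrier (smooth_torus \<eta>)"
  shows "0 \<le> torus_seminorm N a"
proof -
  have "\<exists>B. \<forall>p. torus_weight j k a p \<le> B" for j k
    using assms by (force simp: smooth_torus_def bdd_above_def)
  then obtain B where "\<And>j p. torus_weight j N a p \<le> B j" for j p
    using choice[of "\<lambda>j B. \<forall>p. torus_weight j N a p \<le> B"] by blast
  then have "(\<Sum>j\<le>N. torus_weight j N a p) \<le> (\<Sum>j\<le>N. B j)" for p by (intro sum_mono)
  then have "bdd_above (range (\<lambda>p. \<Sum>j\<le>N. torus_weight j N a p))" by (auto intro!: bdd_aboveI)
  then have "(\<Sum>j\<le>N. torus_weight j N a (0, 0)) \<le> torus_seminorm N a"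
    unfolding torus_seminorm_def by (rule cSUP_upper[OF UNIV_I])
  moreover have "0 \<le> (\<Sum>j\<le>N. torus_weight j N a (0, 0))"
    by (intro sum_nonneg) (simp add: torus_weight_def)
  ultimately show ?thesis by simp
qed

definition interval_monom :: "real \<Rightarrow> nat \<Rightarrow> real \<Rightarrow> complex" where
  "interval_monom L j m = of_real m ^ j * interval_one L m"

lemma at_within_interval_neq_bot: "0 < L \<Longrightarrow> x \<in> {0..L} \<Longrightarrow> at x within {0..L :: real} \<noteq> bot"
  by (simp add: trivial_limit_within islimpt_Icc)

lemma interval_monom_smooth:
  assumes "0 < L" shows "interval_monom L j \<in> smooth_interval L"
proof -
  have "smooth_within {0..L} (interval_monom L j)"
    by (rule nderiv_within_holomorphic(2)[where U = UNIV and F = "\<lambda>z. z ^ j"])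
       (use assms at_within_interval_neq_bot in \<open>auto intro!: holomorphic_intros simp: interval_monom_def interval_one_def\<close>)
  then show ?thesis by (simp add: smooth_interval_def interval_monom_def interval_one_def)
qed

lemma interval_seminorm_monom_le:
  assumes "0 < L"
  shows "interval_seminorm L M (interval_monom L j) \<le> (\<Sum>i\<le>M. fact i) * (L + 1) ^ j"
  unfolding interval_seminorm_def sum_distrib_right
proof (intro cSUP_least sum_mono)
  fix m i assume m: "m \<in> {0..L}"
  have "nderiv_within {0..L} i (interval_monom L j) m = (deriv ^^ i) (\<lambda>z. z ^ j) (of_real m)"
    by (rule nderiv_within_holomorphic(1)[where U = UNIV and S = "{0..L}" and F = "\<lambda>z. z ^ j"])
       (use assms m at_within_interval_neq_bot in \<open>auto intro!: holomorphic_intros simp: interval_monom_def interval_one_def\<close>)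
  \<comment> \<open>Cauchy's estimate on discs of radius 1, on which |z^j| is at most (L + 1)^j; the
    dependence on j is thus purely geometric.\<close>
  moreover have "norm ((deriv ^^ i) (\<lambda>z. z ^ j) (complex_of_real m)) \<le> fact i * (L + 1) ^ j / 1 ^ i"
  proof (rule norm_higher_deriv_le[where U = "cball 0 (L + 1)"])
    show "cball (complex_of_real m) 1 \<subseteq> cball 0 (L + 1)"
      using m by (simp add: cball_subset_cball_iff)
  qed (auto intro!: holomorphic_intros power_mono simp: norm_power)
  ultimately show "norm (nderiv_within {0..L} i (interval_monom L j) m) \<le> fact i * (L + 1) ^ j" by simp
qed (use assms in auto)

lemma interval_seminorm_nonneg:
  assumes L: "0 < L" and b: "b \<in> smooth_interval L"
  shows "0 \<le> interval_seminorm L N b"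
proof -
  define h where "h m = (\<Sum>i\<le>N. norm (nderiv_within {0..L} i b m))" for m
  have "continuous_on {0..L} h"
    unfolding h_def using b
    by (intro continuous_intros differentiable_imp_continuous_on)
       (auto simp: smooth_interval_def smooth_within_def)
  then have "bdd_above (h ` {0..L})"
    by (intro bounded_imp_bdd_above compact_imp_bounded compact_continuous_image) auto
  then have "h 0 \<le> interval_seminorm L N b"
    unfolding interval_seminorm_def h_def[symmetric] using L by (intro cSUP_upper) auto
  moreover have "0 \<le> h 0" unfolding h_def by (intro sum_nonneg) simp
  ultimately show ?thesis by simp
qed

lemma proj_seminorm_le:
  assumes "\<And>a. a \<in> E \<Longrightarrow> 0 \<le> p a" "\<And>b. b \<in> F \<Longrightarrow> 0 \<le> q b" "tensor_repr E F xs t"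
  shows "proj_seminorm E F p q t \<le> (\<Sum>(a, b)\<leftarrow>xs. p a * q b)"
  unfolding proj_seminorm_def
proof (rule cInf_lower)
  show "(\<Sum>(a, b)\<leftarrow>xs. p a * q b) \<in> {\<Sum>(a, b)\<leftarrow>xs. p a * q b |xs. tensor_repr E F xs t}"
    using assms(3) by blast
  have "0 \<le> (\<Sum>(a, b)\<leftarrow>xs. p a * q b)" if "tensor_repr E F xs t" for xs
    using that assms(1,2) by (intro sum_list_nonneg) (auto simp: tensor_repr_def)
  then show "bdd_below {\<Sum>(a, b)\<leftarrow>xs. p a * q b |xs. tensor_repr E F xs t}"
    by (auto intro!: bdd_belowI)
qed

section \<open>Elements given by power series in \<open>m\<close>\<close>

text \<open>Summability for every \<open>R\<close> says that the series is entire in m. It absorbs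
  the factor (L + 1)^j from the seminorms of the monomials and is stable under Cauchy
  products.\<close>

definition analytic_series :: "real \<Rightarrow> (nat \<Rightarrow> real) \<Rightarrow> (nat \<Rightarrow> complex \<Rightarrow> complex) \<Rightarrow> bool" where
  "analytic_series \<delta> A b \<longleftrightarrow> (\<forall>j. b j holomorphic_on strip \<delta>) \<and>
     (\<forall>j. \<forall>z\<in>strip \<delta>. norm (b j z) \<le> A j \<and> b j (z + 1) = b j z) \<and> (\<forall>R. summable (\<lambda>j. A j * R ^ j))"

definition series_val :: "(nat \<Rightarrow> complex \<Rightarrow> complex) \<Rightarrow> real \<Rightarrow> real \<Rightarrow> complex" where
  "series_val b u m = suminf (\<lambda>j. b j (of_real u) * of_real m ^ j)"

definition analytic_elem :: "real \<Rightarrow> real \<Rightarrow> int \<Rightarrow> (nat \<Rightarrow> real) \<Rightarrow> (int \<Rightarrow> nat \<Rightarrow> complex \<Rightarrow> complex) \<Rightarrow>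
    (real \<Rightarrow> torus_elem) \<Rightarrow> bool" where
  "analytic_elem L \<delta> N A a t \<longleftrightarrow> 0 < \<delta> \<and> (\<forall>n. analytic_series \<delta> A (a n)) \<and>
     (\<forall>n j z. N < \<bar>n\<bar> \<longrightarrow> a n j z = 0) \<and> t = (\<lambda>m n u. series_val (a n) u m * interval_one L m)"

definition analytic_elems :: "real \<Rightarrow> (real \<Rightarrow> torus_elem) set" where
  "analytic_elems L = {t. \<exists>\<delta> N A a. analytic_elem L \<delta> N A a t}"

lemma analytic_series_norm_summable:
  assumes "0 < \<delta>" "analytic_series \<delta> A b"
  shows "summable (\<lambda>j. norm (b j (of_real u) * of_real m ^ j))"
proof (rule summable_comparison_test')
  show "summable (\<lambda>j. A j * \<bar>m\<bar> ^ j)" using assms by (auto simp: analytic_series_def)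
  show "norm (norm (b j (of_real u) * of_real m ^ j)) \<le> A j * \<bar>m\<bar> ^ j" for j
    using assms of_real_in_strip[OF assms(1), of u]
    by (auto simp: analytic_series_def norm_mult norm_power intro!: mult_right_mono)
qed

lemma analytic_series_bound_nonneg:
  assumes "0 < \<delta>" "analytic_series \<delta> A b"
  shows "0 \<le> A j"
proof -
  have "norm (b j 0) \<le> A j" using assms by (auto simp: analytic_series_def strip_def)
  then show ?thesis using norm_ge_zero order_trans by blast
qed

text \<open>Partial sums of the power series in m are finite sums of elementary tensors. The
  projective seminorm of a block of terms is at most the sum of the products of seminorms, hence at
  most a constant times the same block of the convergent series of A j (L + 1)^j.\<close>

lemma analytic_elems_completed:
  assumes L: "0 < L" and t: "t \<in> analytic_elems L"
  shows "t \<in> carrier (torus_tensor_interval \<eta> L)"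
proof -
  obtain \<delta> N A a where d: "0 < \<delta>" and a: "\<And>n. analytic_series \<delta> A (a n)"
    and N: "\<And>n j z. N < \<bar>n\<bar> \<Longrightarrow> a n j z = 0" and t: "t = (\<lambda>m n u. series_val (a n) u m * interval_one L m)"
    using t unfolding analytic_elems_def analytic_elem_def by blast
  let ?E = "carrier (smooth_torus \<eta>)" and ?F = "smooth_interval L"
  \<comment> \<open>Only \<sigma> = 1 and \<sigma> = -1 are used. The sign is placed in the first
    factor, since differences of partial sums occur with both signs and each must be a sum of
    elementary tensors.\<close>
  define e where "e \<sigma> j = (\<lambda>(n::int) u. \<sigma> * a n j (of_real u))" for \<sigma> :: complex and j
  have at: "analytic_torus \<delta> N (A j) (\<lambda>n z. \<sigma> * a n j z)" if "norm \<sigma> = 1" for \<sigma> j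
    using a N that by (auto simp: analytic_torus_def analytic_series_def norm_mult intro!: holomorphic_intros)
  define P where "P \<sigma> i k = (\<lambda>m n u. \<Sum>j=i..<k. elem_tensor (e \<sigma> j) (interval_monom L j) m n u)" for \<sigma> i k
  define xs where "xs \<sigma> i k = map (\<lambda>j. (e \<sigma> j, interval_monom L j)) [i..<k]" for \<sigma> i k
  have repr: "tensor_repr ?E ?F (xs \<sigma> i k) (P \<sigma> i k)" if s: "norm \<sigma> = 1" for \<sigma> i k
    unfolding tensor_repr_def xs_def P_def
    using analytic_torus_carrier[OF d at[OF s]] interval_monom_smooth[OF L]
    by (auto simp: interv_sum_list_conv_sum_set_nat o_def e_def)
  define C where "C M M' = (\<Sum>j\<le>M. torus_const \<delta> N j M) * (\<Sum>i\<le>M'. fact i)" for M M'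
  have C: "0 \<le> C M M'" for M M'
    unfolding C_def using d by (intro mult_nonneg_nonneg sum_nonneg torus_const_nonneg) auto
  have est: "proj_seminorm ?E ?F (torus_seminorm M) (interval_seminorm L M') (P \<sigma> i k)
      \<le> C M M' * (\<Sum>j=i..<k. A j * (L + 1) ^ j)" if s: "norm \<sigma> = 1" for M M' \<sigma> i k
  proof -
    have "proj_seminorm ?E ?F (torus_seminorm M) (interval_seminorm L M') (P \<sigma> i k)
        \<le> (\<Sum>(a, b)\<leftarrow>xs \<sigma> i k. torus_seminorm M a * interval_seminorm L M' b)"
      by (rule proj_seminorm_le[OF torus_seminorm_nonneg interval_seminorm_nonneg[OF L] repr[OF s]])
    also have "\<dots> = (\<Sum>j=i..<k. torus_seminorm M (e \<sigma> j) * interval_seminorm L M' (interval_monom L j))"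
      by (simp add: xs_def interv_sum_list_conv_sum_set_nat o_def)
    also have "\<dots> \<le> (\<Sum>j=i..<k. ((\<Sum>j\<le>M. torus_const \<delta> N j M) * A j) * ((\<Sum>i\<le>M'. fact i) * (L + 1) ^ j))"
    proof (intro sum_mono mult_mono)
      fix j
      show "torus_seminorm M (e \<sigma> j) \<le> (\<Sum>j\<le>M. torus_const \<delta> N j M) * A j"
        unfolding e_def by (rule torus_seminorm_analytic_le[OF d at[OF s]])
      show "0 \<le> (\<Sum>j\<le>M. torus_const \<delta> N j M) * A j"
        using d analytic_series_bound_nonneg[OF d a]
        by (intro mult_nonneg_nonneg sum_nonneg torus_const_nonneg) auto
    qed (use L interval_seminorm_monom_le interval_seminorm_nonneg interval_monom_smooth in auto)
    finally show ?thesis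
      unfolding C_def sum_distrib_left[of "_ * _"] by (simp only: mult_ac)
  qed
  have "t \<in> completed_tensor ?E (range torus_seminorm) ?F (range (interval_seminorm L))"
    unfolding completed_tensor_def mem_Collect_eq
  proof (intro exI[of _ "P 1 0"] conjI allI ballI impI)
    show "P 1 0 i \<in> alg_tensor ?E ?F" for i
      unfolding alg_tensor_def using repr[of 1 0 i] by auto
    have "(\<lambda>i. \<Sum>j<i. a n j (of_real u) * of_real m ^ j) \<longlonglongrightarrow> series_val (a n) u m" for m n u
      unfolding series_val_def
      by (intro summable_LIMSEQ summable_norm_cancel[OF analytic_series_norm_summable[OF d a]])
    then have "(\<lambda>i. (\<Sum>j<i. a n j (of_real u) * of_real m ^ j) * interval_one L m) \<longlonglongrightarrow> t m n u" for m n u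
      unfolding t by (intro tendsto_intros)
    then show "(\<lambda>i. P 1 0 i m n u) \<longlonglongrightarrow> t m n u" for m n u
      by (simp add: P_def elem_tensor_def e_def interval_monom_def sum_distrib_right mult.assoc atLeast0LessThan)
    fix p q and \<epsilon> :: real
    assume "p \<in> range torus_seminorm" "q \<in> range (interval_seminorm L)" and eps: "\<epsilon> > 0"
    then obtain M M' where pq: "p = torus_seminorm M" "q = interval_seminorm L M'" by blast
    \<comment> \<open>The added 1 keeps the denominator positive also when the constant is
      0.\<close>
    have "\<epsilon> / (C M M' + 1) > 0" using eps C[of M M'] by (intro divide_pos_pos) linarith+
    moreover have "summable (\<lambda>j. A j * (L + 1) ^ j)" using a[of 0] by (simp add: analytic_series_def)
    ultimately obtain K where K: "norm (\<Sum>j=i..<k. A j * (L + 1) ^ j) < \<epsilon> / (C M M' + 1)" if "i \<ge> K" for i k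
      unfolding summable_Cauchy by meson
    have small: "proj_seminorm ?E ?F p q (P \<sigma> i k) < \<epsilon>" if "norm \<sigma> = 1" "i \<ge> K" for \<sigma> i k
    proof -
      have "proj_seminorm ?E ?F p q (P \<sigma> i k) \<le> C M M' * (\<Sum>j=i..<k. A j * (L + 1) ^ j)"
        unfolding pq by (rule est[OF that(1)])
      also have "\<dots> \<le> C M M' * (\<epsilon> / (C M M' + 1))"
        using K[OF that(2), of k] C[of M M'] by (intro mult_left_mono) auto
      also have "\<dots> < \<epsilon>" using eps C[of M M'] by (simp add: field_simps)
      finally show ?thesis .
    qed
    have diff: "(\<lambda>m n u. P 1 0 i m n u - P 1 0 k m n u) = (if i \<le> k then P (- 1) i k else P 1 k i)" for i k
    proof (intro ext)
      fix m n u
      define h where "h j = a n j (of_real u) * interval_monom L j m" for j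
      have "P \<sigma> i k m n u = \<sigma> * (\<Sum>j=i..<k. h j)" for \<sigma> i k
        by (simp add: P_def h_def elem_tensor_def e_def sum_distrib_left mult.assoc)
      moreover have "(\<Sum>j=0..<k. h j) = (\<Sum>j=0..<i. h j) + (\<Sum>j=i..<k. h j)" if "i \<le> k" for i k
        using that by (simp add: sum.atLeastLessThan_concat)
      note this[of i k] this[of k i]
      ultimately show "P 1 0 i m n u - P 1 0 k m n u = (if i \<le> k then P (- 1) i k else P 1 k i) m n u"
        by (cases "i \<le> k") (auto simp: algebra_simps)
    qed
    show "\<exists>K. \<forall>i\<ge>K. \<forall>k\<ge>K. proj_seminorm ?E ?F p q (\<lambda>m n u. P 1 0 i m n u - P 1 0 k m n u) < \<epsilon>"
      unfolding diff using small by (intro exI[of _ K]) simp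
  qed
  then show ?thesis by (simp add: torus_tensor_interval_def Let_def)
qed

section \<open>Sums and products of power series in m\<close>

lemma analytic_series_mono:
  assumes "analytic_series \<delta> A b" "\<delta>' \<le> \<delta>" "\<And>j. A j \<le> B j" "\<And>R. summable (\<lambda>j. B j * R ^ j)"
  shows "analytic_series \<delta>' B b"
proof -
  have "strip \<delta>' \<subseteq> strip \<delta>" using assms(2) by (auto simp: strip_def)
  then show ?thesis
    using assms unfolding analytic_series_def
    by (meson holomorphic_on_subset order_trans subsetD)
qed

lemma analytic_series_add:
  assumes "analytic_series \<delta> A a" "analytic_series \<delta> B b"
  shows "analytic_series \<delta> (\<lambda>j. A j + B j) (\<lambda>j z. a j z + b j z)"
  unfolding analytic_series_def
proof (intro conjI allI ballI)
  show "norm (a j z + b j z) \<le> A j + B j" if "z \<in> strip \<delta>" for j z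
    using assms that unfolding analytic_series_def by (intro norm_triangle_mono) auto
  show "summable (\<lambda>j. (A j + B j) * R ^ j)" for R
    unfolding distrib_right using assms unfolding analytic_series_def by (intro summable_add) auto
qed (use assms in \<open>auto simp: analytic_series_def intro!: holomorphic_intros\<close>)

lemma series_val_add:
  assumes "0 < \<delta>" "analytic_series \<delta> A a" "analytic_series \<delta> B b"
  shows "series_val (\<lambda>j z. a j z + b j z) u m = series_val a u m + series_val b u m"
  unfolding series_val_def distrib_right using assms
  by (intro suminf_add[symmetric] summable_norm_cancel[OF analytic_series_norm_summable])

text \<open>Cauchy product in m. The real translation of the second factor comes from moving a power
  of V past a coefficient; the strip is invariant under it, and the majorants form the Cauchy
  product too.\<close>

lemma analytic_series_mult:
  assumes d: "0 < \<delta>" and a: "analytic_series \<delta> A a" and b: "analytic_series \<delta> B b" and x: "Im x = 0"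
  shows "analytic_series \<delta> (\<lambda>j. \<Sum>i\<le>j. A i * B (j - i)) (\<lambda>j z. \<Sum>i\<le>j. a i z * b (j - i) (z + x))"
  unfolding analytic_series_def
proof (intro conjI allI ballI)
  fix j
  have "(\<lambda>z. b j (z + x)) holomorphic_on strip \<delta>" for j
  proof -
    have "b j \<circ> (\<lambda>z. z + x) holomorphic_on strip \<delta>"
      by (rule holomorphic_on_compose_gen[where t = "strip \<delta>"])
         (use b x in \<open>auto simp: analytic_series_def intro!: holomorphic_intros\<close>)
    then show ?thesis by (simp add: o_def)
  qed
  then show "(\<lambda>z. \<Sum>i\<le>j. a i z * b (j - i) (z + x)) holomorphic_on strip \<delta>"
    using a unfolding analytic_series_def by (intro holomorphic_intros) auto
  fix z assume z: "z \<in> strip \<delta>"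
  then have zx: "z + x \<in> strip \<delta>" using x by simp
  show "norm (\<Sum>i\<le>j. a i z * b (j - i) (z + x)) \<le> (\<Sum>i\<le>j. A i * B (j - i))"
    using a b z zx analytic_series_bound_nonneg[OF d a] unfolding analytic_series_def
    by (intro sum_norm_le) (auto simp: norm_mult intro!: mult_mono)
  have "b i (z + 1 + x) = b i (z + x)" for i
    using b zx unfolding analytic_series_def by (metis add.commute add.left_commute)
  then show "(\<Sum>i\<le>j. a i (z + 1) * b (j - i) (z + 1 + x)) = (\<Sum>i\<le>j. a i z * b (j - i) (z + x))"
    using a z by (simp add: analytic_series_def)
next
  fix R :: real
  have "summable (\<lambda>j. norm (A j * R ^ j))" if "analytic_series \<delta> A a" for A a
  proof -
    have "summable (\<lambda>j. A j * \<bar>R\<bar> ^ j)" using that by (auto simp: analytic_series_def)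
    then show ?thesis
      using analytic_series_bound_nonneg[OF d that] by (simp add: abs_mult power_abs)
  qed
  from summable_Cauchy_product[OF this[OF a] this[OF b]]
  have "summable (\<lambda>j. \<Sum>i\<le>j. A i * R ^ i * (B (j - i) * R ^ (j - i)))" .
  moreover have "(\<Sum>i\<le>j. A i * R ^ i * (B (j - i) * R ^ (j - i))) = (\<Sum>i\<le>j. A i * B (j - i)) * R ^ j" for j
    unfolding sum_distrib_right
    by (intro sum.cong refl) (simp add: mult_ac, metis power_add le_add_diff_inverse)
  ultimately show "summable (\<lambda>j. (\<Sum>i\<le>j. A i * B (j - i)) * R ^ j)" by simp
qed

lemma series_val_mult:
  assumes d: "0 < \<delta>" and a: "analytic_series \<delta> A a" and b: "analytic_series \<delta> B b"
  shows "series_val (\<lambda>j z. \<Sum>i\<le>j. a i z * b (j - i) (z + of_real x)) u m = series_val a u m * series_val b (u + x) m"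
proof -
  have "(\<lambda>j. \<Sum>i\<le>j. a i (of_real u) * of_real m ^ i * (b (j - i) (of_real (u + x)) * of_real m ^ (j - i)))
      sums (series_val a u m * series_val b (u + x) m)"
    unfolding series_val_def
    by (intro Cauchy_product_sums analytic_series_norm_summable[OF d a] analytic_series_norm_summable[OF d b])
  moreover have "(\<Sum>i\<le>j. a i (of_real u) * of_real m ^ i * (b (j - i) (of_real (u + x)) * of_real m ^ (j - i)))
      = (\<Sum>i\<le>j. a i (of_real u) * b (j - i) (of_real u + of_real x)) * of_real m ^ j" for j
    unfolding sum_distrib_right
    by (intro sum.cong refl) (simp add: mult_ac, metis power_add le_add_diff_inverse)
  ultimately show ?thesis unfolding series_val_def by (simp add: sums_iff)
qed

definition analytic_fun :: "(real \<Rightarrow> real \<Rightarrow> complex) \<Rightarrow> bool" where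
  "analytic_fun f \<longleftrightarrow> (\<exists>\<delta> A b. 0 < \<delta> \<and> analytic_series \<delta> A b \<and> f = series_val b)"

lemma analytic_elems_add:
  assumes "s \<in> analytic_elems L" "t \<in> analytic_elems L"
  shows "(\<lambda>m n u. s m n u + t m n u) \<in> analytic_elems L"
proof -
  obtain \<delta> N A a where s: "0 < \<delta>" "\<And>n. analytic_series \<delta> A (a n)" "\<And>n j z. N < \<bar>n\<bar> \<Longrightarrow> a n j z = 0"
      "s = (\<lambda>m n u. series_val (a n) u m * interval_one L m)"
    using assms(1) unfolding analytic_elems_def analytic_elem_def by blast
  obtain \<delta>' N' B b where t: "0 < \<delta>'" "\<And>n. analytic_series \<delta>' B (b n)" "\<And>n j z. N' < \<bar>n\<bar> \<Longrightarrow> b n j z = 0"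
      "t = (\<lambda>m n u. series_val (b n) u m * interval_one L m)"
    using assms(2) unfolding analytic_elems_def analytic_elem_def by blast
  define d where "d = min \<delta> \<delta>'"
  have d: "0 < d" using s(1) t(1) by (simp add: d_def)
  have a: "analytic_series d A (a n)" for n
    by (rule analytic_series_mono[OF s(2)]) (use s(2) in \<open>auto simp: d_def analytic_series_def\<close>)
  have b: "analytic_series d B (b n)" for n
    by (rule analytic_series_mono[OF t(2)]) (use t(2) in \<open>auto simp: d_def analytic_series_def\<close>)
  have "analytic_elem L d (max N N') (\<lambda>j. A j + B j) (\<lambda>n j z. a n j z + b n j z) (\<lambda>m n u. s m n u + t m n u)"
    unfolding analytic_elem_def using d analytic_series_add[OF a b] series_val_add[OF d a b]
    by (auto simp: s(3,4) t(3,4) distrib_right)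
  then show ?thesis unfolding analytic_elems_def by blast
qed

text \<open>Left multiplication by f V^e is the case x = e \<eta>. With e and x independent, the
  same closure property also gives scalar multiples and multiples of single powers of V.\<close>

lemma analytic_elems_mult:
  assumes f: "analytic_fun f" and t: "t \<in> analytic_elems L"
  shows "(\<lambda>m n u. f u m * t m (n - e) (u + x)) \<in> analytic_elems L"
proof -
  obtain \<delta> A a where f: "0 < \<delta>" "analytic_series \<delta> A a" "f = series_val a"
    using f unfolding analytic_fun_def by blast
  obtain \<delta>' N B b where t: "0 < \<delta>'" "\<And>n. analytic_series \<delta>' B (b n)" "\<And>n j z. N < \<bar>n\<bar> \<Longrightarrow> b n j z = 0"
      "t = (\<lambda>m n u. series_val (b n) u m * interval_one L m)"
    using t unfolding analytic_elems_def analytic_elem_def by blast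
  define d where "d = min \<delta> \<delta>'"
  have d: "0 < d" using f(1) t(1) by (simp add: d_def)
  have a: "analytic_series d A a"
    by (rule analytic_series_mono[OF f(2)]) (use f(2) in \<open>auto simp: d_def analytic_series_def\<close>)
  have b: "analytic_series d B (b n)" for n
    by (rule analytic_series_mono[OF t(2)]) (use t(2) in \<open>auto simp: d_def analytic_series_def\<close>)
  have "analytic_elem L d (N + \<bar>e\<bar>) (\<lambda>j. \<Sum>i\<le>j. A i * B (j - i))
      (\<lambda>n j z. \<Sum>i\<le>j. a i z * b (n - e) (j - i) (z + of_real x)) (\<lambda>m n u. f u m * t m (n - e) (u + x))"
    unfolding analytic_elem_def using d analytic_series_mult[OF d a b, of "of_real x"] series_val_mult[OF d a b]
    by (auto simp: f(3) t(3,4) mult.assoc)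
  then show ?thesis unfolding analytic_elems_def by blast
qed

lemma analytic_series_of_bool: "analytic_series 1 (\<lambda>j. norm c * of_bool (j = 0)) (\<lambda>j z. c * of_bool (j = 0))"
proof -
  have "summable (\<lambda>j. norm c * of_bool (j = 0) * R ^ j)" for R
    by (rule summable_finite[of "{0}"]) auto
  then show ?thesis by (auto simp: analytic_series_def norm_mult)
qed

lemma series_val_of_bool: "series_val (\<lambda>j z. c * of_bool (j = 0)) u m = c"
  unfolding series_val_def by (subst suminf_finite[of "{0}"]) auto

lemma analytic_fun_const: "analytic_fun (\<lambda>u m. c)"
  unfolding analytic_fun_def using analytic_series_of_bool[of c] series_val_of_bool[of c]
  by (intro exI conjI) (auto intro!: ext)

lemma analytic_elems_one: "elem_tensor \<one>\<^bsub>smooth_torus \<eta>\<^esub> (interval_one L) \<in> analytic_elems L"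
proof -
  have "analytic_series 1 (\<lambda>j. of_bool (j = 0)) (\<lambda>j z. of_bool (n = 0) * of_bool (j = 0))" for n :: int
    by (rule analytic_series_mono[OF analytic_series_of_bool])
       (auto intro!: summable_finite[of "{0}"])
  then have "analytic_elem L 1 0 (\<lambda>j. of_bool (j = 0)) (\<lambda>n j z. of_bool (n = 0) * of_bool (j = 0))
      (elem_tensor \<one>\<^bsub>smooth_torus \<eta>\<^esub> (interval_one L))"
    unfolding analytic_elem_def by (auto simp: series_val_of_bool elem_tensor_def smooth_torus_def)
  then show ?thesis unfolding analytic_elems_def by blast
qed

lemma analytic_elems_smult:
  assumes "t \<in> analytic_elems L"
  shows "(\<lambda>m n u. c * t m n u) \<in> analytic_elems L"
  using analytic_elems_mult[OF analytic_fun_const assms, of c 0 0] by simp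

section \<open>The coefficient functions\<close>

lemma deriv_periodic:
  fixes g :: "complex \<Rightarrow> complex"
  assumes "\<And>z. g (z + p) = g z"
  shows "(deriv ^^ j) g (z + p) = (deriv ^^ j) g z"
proof (induction j arbitrary: z)
  case (Suc j)
  let ?h = "(deriv ^^ j) g"
  have "(?h has_field_derivative D) (at (z + p)) \<longleftrightarrow> (?h has_field_derivative D) (at z)" for D
    using Suc by (simp add: DERIV_shift)
  then show ?case unfolding funpow.simps o_apply deriv_def[of ?h] by (simp only:)
qed (simp add: assms)

text \<open>Taylor expansion of g about 2 u + x. As g is bounded on every horizontal strip, Cauchy's
  estimates hold with every radius, uniformly in u, so the coefficients decay faster than any
  geometric sequence. Period 2 of g is period 1 in u.\<close>

lemma analytic_fun_entire:
  fixes g \<phi> :: "complex \<Rightarrow> complex" and x :: real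
  assumes d: "0 < \<delta>" and \<phi>: "\<phi> holomorphic_on strip \<delta>" "\<And>z. z \<in> strip \<delta> \<Longrightarrow> norm (\<phi> z) \<le> K"
      "\<And>z. \<phi> (z + 1) = \<phi> z"
    and g: "g holomorphic_on UNIV" "\<And>z. g (z + 2) = g z"
      "\<And>Y. \<exists>M. \<forall>z. \<bar>Im z\<bar> \<le> Y \<longrightarrow> norm (g z) \<le> M"
    and \<sigma>: "norm \<sigma> = 1"
  shows "analytic_fun (\<lambda>u m. \<phi> (of_real u) * g (2 * of_real u + of_real x + \<sigma> * of_real m))"
proof -
  define b where "b j z = \<phi> z * ((deriv ^^ j) g (2 * z + of_real x) / fact j * \<sigma> ^ j)" for j z
  \<comment> \<open>The constant M in a Cauchy bound M / R^j varies with R; the suprema form one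
    majorant that satisfies all these bounds at once.\<close>
  define S where "S j = (SUP z\<in>strip (2 * \<delta>). norm ((deriv ^^ j) g z / fact j))" for j
  have ne: "strip (2 * \<delta>) \<noteq> {}" using of_real_in_strip[of "2 * \<delta>" 0] d by auto
  have cauchy: "\<exists>M. \<forall>j. \<forall>z\<in>strip (2 * \<delta>). norm ((deriv ^^ j) g z / fact j) \<le> M / R ^ j" if R: "R > 0" for R
  proof -
    obtain M where M: "\<And>z. \<bar>Im z\<bar> \<le> 2 * \<delta> + R \<Longrightarrow> norm (g z) \<le> M" using g(3) by blast
    have "norm ((deriv ^^ j) g z / fact j) \<le> M / R ^ j" if z: "z \<in> strip (2 * \<delta>)" for j z
    proof -
      have "norm ((deriv ^^ j) g z) \<le> fact j * M / R ^ j"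
      proof (rule norm_higher_deriv_le[where U = "{w. \<bar>Im w\<bar> \<le> 2 * \<delta> + R}"])
        show "cball z R \<subseteq> {w. \<bar>Im w\<bar> \<le> 2 * \<delta> + R}"
        proof
          fix w assume "w \<in> cball z R"
          then have "norm (z - w) \<le> R" by (simp add: dist_norm)
          then have "\<bar>Im (z - w)\<bar> \<le> R" using abs_Im_le_cmod order_trans by blast
          then show "w \<in> {w. \<bar>Im w\<bar> \<le> 2 * \<delta> + R}" using z by (simp add: strip_def)
        qed
      qed (use R M g(1) in \<open>auto intro: holomorphic_on_subset\<close>)
      then show ?thesis by (simp add: norm_divide field_simps)
    qed
    then show ?thesis by blast
  qed
  have bdd: "bdd_above ((\<lambda>z. norm ((deriv ^^ j) g z / fact j)) ` strip (2 * \<delta>))" for j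
    using cauchy[of 1] by (fastforce intro: bdd_aboveI2)
  have S_upper: "norm ((deriv ^^ j) g z / fact j) \<le> S j" if "z \<in> strip (2 * \<delta>)" for j z
    unfolding S_def by (rule cSUP_upper[OF that bdd])
  have S0: "0 \<le> S j" for j
  proof -
    have "norm ((deriv ^^ j) g 0 / fact j) \<le> S j" using S_upper[of 0 j] d by (simp add: strip_def)
    then show ?thesis using norm_ge_zero order_trans by blast
  qed
  have "norm (\<phi> 0) \<le> K" using \<phi>(2)[of 0] d by (simp add: strip_def)
  then have K: "0 \<le> K" using norm_ge_zero order_trans by blast
  have "analytic_series \<delta> (\<lambda>j. K * S j) b"
    unfolding analytic_series_def
  proof (intro conjI allI ballI)
    show "b j holomorphic_on strip \<delta>" for j
    proof -
      have "(deriv ^^ j) g \<circ> (\<lambda>z. 2 * z + of_real x) holomorphic_on strip \<delta>"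
        by (rule holomorphic_on_compose_gen[where t = UNIV])
           (auto intro!: holomorphic_intros holomorphic_higher_deriv[OF g(1)])
      then show ?thesis
        unfolding b_def o_def by (intro holomorphic_intros \<phi>(1)) auto
    qed
    fix j z assume z: "z \<in> strip \<delta>"
    then have "2 * z + of_real x \<in> strip (2 * \<delta>)" by (simp add: strip_def)
    then show "norm (b j z) \<le> K * S j"
      unfolding b_def norm_mult using \<phi>(2)[OF z] S_upper[of _ j] K
      by (intro mult_mono) (auto simp: norm_power \<sigma>)
    have "(deriv ^^ j) g (2 * (z + 1) + of_real x) = (deriv ^^ j) g (2 * z + of_real x)"
      using deriv_periodic[of g 2 j "2 * z + of_real x", OF g(2)] by (simp add: algebra_simps)
    then show "b j (z + 1) = b j z" by (simp add: b_def \<phi>(3))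
  next
    fix R :: real
    \<comment> \<open>Any radius of at least 2 |R| gives the ratio 1/2; the added 1 makes it
      positive for R = 0.\<close>
    define R' where "R' = 2 * \<bar>R\<bar> + 1"
    have R': "R' > 0" by (simp add: R'_def add_nonneg_pos)
    obtain M where M: "\<And>j z. z \<in> strip (2 * \<delta>) \<Longrightarrow> norm ((deriv ^^ j) g z / fact j) \<le> M / R' ^ j"
      using cauchy[OF R'] by blast
    have le: "S j \<le> M / R' ^ j" for j
      unfolding S_def using M by (intro cSUP_least ne)
    have "norm (K * S j * R ^ j) \<le> K * M * (1/2) ^ j" for j
    proof -
      have "norm (K * S j * R ^ j) = K * (S j * \<bar>R\<bar> ^ j)"
        using K S0 by (simp add: abs_mult power_abs)
      also have "\<dots> \<le> K * (M / R' ^ j * (R' / 2) ^ j)"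
      proof (rule mult_left_mono[OF mult_mono[OF le] K])
        show "\<bar>R\<bar> ^ j \<le> (R' / 2) ^ j" by (rule power_mono) (simp_all add: R'_def)
        show "0 \<le> M / R' ^ j" using S0 le order_trans by blast
      qed simp
      also have "\<dots> = K * M * (1/2) ^ j"
        using R' by (simp add: power_divide)
      finally show ?thesis .
    qed
    moreover have "summable (\<lambda>j. K * M * (1/2 :: real) ^ j)"
      by (intro summable_mult summable_geometric) simp
    ultimately show "summable (\<lambda>j. K * S j * R ^ j)"
      by (rule summable_comparison_test'[rotated])
  qed
  moreover have "\<phi> (of_real u) * g (2 * of_real u + of_real x + \<sigma> * of_real m) = series_val b u m" for u m
  proof -
    let ?z = "2 * of_real u + of_real x :: complex"
    have "(\<lambda>j. (deriv ^^ j) g ?z / fact j * (?z + \<sigma> * of_real m - ?z) ^ j) sums g (?z + \<sigma> * of_real m)"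
      by (rule holomorphic_power_series[where r = "\<bar>m\<bar> + 1"])
         (use g(1) \<sigma> in \<open>auto intro: holomorphic_on_subset simp: dist_norm norm_mult\<close>)
    from sums_mult[OF this, of "\<phi> (of_real u)"] show ?thesis
      by (simp add: series_val_def b_def sums_iff power_mult_distrib mult_ac)
  qed
  ultimately show ?thesis
    unfolding analytic_fun_def using d by (intro exI conjI) (auto intro!: ext)
qed

text \<open>|D| has a positive minimum on the unit interval. Uniform continuity on a rectangle keeps
  |D| above half of it near the real axis, and periodicity carries every point of the strip into
  that rectangle.\<close>

lemma inverse_bounded_on_strip:
  assumes D: "continuous_on UNIV D" and per: "\<And>z. D (z + 1) = D z" and nz: "\<And>u :: real. D (of_real u) \<noteq> (0 :: complex)"
  shows "\<exists>\<delta>>0. \<exists>K. \<forall>z\<in>strip \<delta>. D z \<noteq> 0 \<and> norm (inverse (D z)) \<le> K"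
proof -
  define B where "B = cbox (Complex 0 (- 1)) (Complex 1 1)"
  have B: "z \<in> B \<longleftrightarrow> 0 \<le> Re z \<and> Re z \<le> 1 \<and> - 1 \<le> Im z \<and> Im z \<le> 1" for z
    by (auto simp: B_def in_cbox_complex_iff)
  have "compact (complex_of_real ` {0..1})" by (intro compact_continuous_image continuous_intros) auto
  moreover have "continuous_on (complex_of_real ` {0..1}) (\<lambda>z. norm (D z))"
    by (intro continuous_intros continuous_on_subset[OF D]) auto
  ultimately obtain x where x: "x \<in> {0..1}" "\<And>u. u \<in> {0..1} \<Longrightarrow> norm (D (of_real x)) \<le> norm (D (of_real u))"
    using continuous_attains_inf[of "complex_of_real ` {0..1}" "\<lambda>z. norm (D z)"] by auto
  define \<epsilon> where "\<epsilon> = norm (D (of_real x))"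
  have eps: "\<epsilon> > 0" using nz by (simp add: \<epsilon>_def)
  have "uniformly_continuous_on B D"
    unfolding B_def by (intro compact_uniformly_continuous continuous_on_subset[OF D] compact_cbox) auto
  then obtain e where e: "e > 0" "\<And>z w. z \<in> B \<Longrightarrow> w \<in> B \<Longrightarrow> dist w z < e \<Longrightarrow> dist (D w) (D z) < \<epsilon> / 2"
    unfolding uniformly_continuous_on_def using eps half_gt_zero by metis
  have per_nat: "D (z + of_nat n) = D z" for z n
    by (induction n) (auto simp: per add.assoc[symmetric] add.commute[of 1])
  have per_int: "D (z + of_int n) = D z" for z n
    using per_nat[of z "nat n"] per_nat[of "z + of_int n" "nat (- n)"] by (cases "n \<ge> 0") auto
  have "\<epsilon> / 2 \<le> norm (D z)" if z: "z \<in> strip (min e 1)" for z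
  proof -
    define w where "w = z + of_int (- \<lfloor>Re z\<rfloor>)"
    have w: "w \<in> B" "of_real (Re w) \<in> B" "Re w \<in> {0..1}"
      using z by (auto simp: B w_def strip_def) linarith+
    have "w - of_real (Re w) = \<i> * of_real (Im w)" by (simp add: complex_eq_iff)
    then have "dist w (of_real (Re w)) = \<bar>Im z\<bar>" by (simp add: dist_norm norm_mult w_def)
    then have "dist (D w) (D (of_real (Re w))) < \<epsilon> / 2" using e(2) w z by (auto simp: strip_def)
    moreover have "\<epsilon> \<le> norm (D (of_real (Re w)))" using x(2)[OF w(3)] by (simp add: \<epsilon>_def)
    ultimately have "\<epsilon> / 2 \<le> norm (D w)"
      using norm_triangle_ineq2[of "D (of_real (Re w))" "D w"] by (simp add: dist_norm norm_minus_commute)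
    then show ?thesis unfolding w_def per_int .
  qed
  then have "D z \<noteq> 0 \<and> norm (inverse (D z)) \<le> inverse (\<epsilon> / 2)" if "z \<in> strip (min e 1)" for z
    unfolding norm_inverse using that eps by (intro conjI le_imp_inverse_le) fastforce+
  then show ?thesis using e(1) by (intro exI[of _ "min e 1"] conjI exI[of _ "inverse (\<epsilon> / 2)"]) auto
qed

section \<open>The algebra of analytic elements\<close>

definition torus_interval_mult ::
    "real \<Rightarrow> (real \<Rightarrow> torus_elem) \<Rightarrow> (real \<Rightarrow> torus_elem) \<Rightarrow> real \<Rightarrow> torus_elem" where
  "torus_interval_mult \<eta> s t m n u = (\<Sum>\<^sub>\<infinity>k. s m k u * t m (n - k) (u + of_int k * \<eta>))"

lemma torus_interval_simps:
  "mult (torus_tensor_interval \<eta> L) s t = torus_interval_mult \<eta> s t"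
  "add (torus_tensor_interval \<eta> L) s t = (\<lambda>m n u. s m n u + t m n u)"
  "zero (torus_tensor_interval \<eta> L) = (\<lambda>m n u. 0)"
  "one (torus_tensor_interval \<eta> L) = (\<lambda>m n u. of_bool (n = 0) * interval_one L m)"
  "smult (torus_tensor_interval \<eta> L) c s = (\<lambda>m n u. c * s m n u)"
  "adj (torus_tensor_interval \<eta> L) s = (\<lambda>m n u. cnj (s m (- n) (u + of_int n * \<eta>)))"
  by (simp_all add: torus_tensor_interval_def smooth_torus_def Let_def elem_tensor_def fun_eq_iff
      torus_interval_mult_def)

lemma free_star_alg_simps:
  "carrier free_star_alg = UNIV" "mult free_star_alg x y = x * y" "add free_star_alg x y = x + y"
  "zero free_star_alg = 0" "one free_star_alg = 1"
  "smult free_star_alg c x = Poly_Mapping.single 0 c * x" "adj free_star_alg x = free_adj x"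
  by (simp_all add: free_star_alg_def)

lemma analytic_elems_support:
  assumes "t \<in> analytic_elems L"
  obtains N where "\<And>m n u. N < \<bar>n\<bar> \<Longrightarrow> t m n u = 0"
proof -
  obtain \<delta> N A a where "\<And>n j z. N < \<bar>n\<bar> \<Longrightarrow> a n j z = 0" "t = (\<lambda>m n u. series_val (a n) u m * interval_one L m)"
    using assms unfolding analytic_elems_def analytic_elem_def by blast
  then have "t m n u = 0" if "N < \<bar>n\<bar>" for m n u
    using that by (simp add: series_val_def)
  then show ?thesis by (rule that)
qed

lemma analytic_elems_outside:
  assumes "t \<in> analytic_elems L"
  shows "interval_one L m * t m n u = t m n u"
  using assms by (auto simp: analytic_elems_def analytic_elem_def interval_one_def)

lemma analytic_elems_zero: "(\<lambda>m n u. 0) \<in> analytic_elems L"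
  using analytic_elems_smult[OF analytic_elems_one, of 0 0 L] by simp

lemma analytic_elems_sum:
  assumes "finite K" "\<And>k. k \<in> K \<Longrightarrow> s k \<in> analytic_elems L"
  shows "(\<lambda>m n u. \<Sum>k\<in>K. s k m n u) \<in> analytic_elems L"
  using assms by (induction K) (auto intro: analytic_elems_zero analytic_elems_add)

lemma torus_interval_mult_eq_sum:
  assumes "\<And>m n u. N < \<bar>n\<bar> \<Longrightarrow> s m n u = 0" "N \<le> M"
  shows "torus_interval_mult \<eta> s t m n u = (\<Sum>k = - M..M. s m k u * t m (n - k) (u + of_int k * \<eta>))"
proof -
  have "torus_interval_mult \<eta> s t m n u = (\<Sum>\<^sub>\<infinity>k\<in>{- M..M}. s m k u * t m (n - k) (u + of_int k * \<eta>))"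
    unfolding torus_interval_mult_def using assms by (intro infsum_cong_neutral) auto
  then show ?thesis by simp
qed

lemma analytic_elems_torus_mult:
  assumes s: "s \<in> analytic_elems L" and t: "t \<in> analytic_elems L"
  shows "torus_interval_mult \<eta> s t \<in> analytic_elems L"
proof -
  obtain \<delta> N A a where a: "0 < \<delta>" "\<And>n. analytic_series \<delta> A (a n)" "\<And>n j z. N < \<bar>n\<bar> \<Longrightarrow> a n j z = 0"
      "s = (\<lambda>m n u. series_val (a n) u m * interval_one L m)"
    using s unfolding analytic_elems_def analytic_elem_def by blast
  have f: "analytic_fun (series_val (a k))" for k
    unfolding analytic_fun_def using a by blast
  have N: "s m n u = 0" if "N < \<bar>n\<bar>" for m n u
    using a(3) that by (simp add: a(4) series_val_def)
  have st: "s m k u * t m n v = series_val (a k) u m * t m n v" for k u m n v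
    using analytic_elems_outside[OF t, of m n v] by (simp add: a(4) mult.assoc)
  have "torus_interval_mult \<eta> s t =
      (\<lambda>m n u. \<Sum>k = - N..N. series_val (a k) u m * t m (n - k) (u + of_int k * \<eta>))"
    by (intro ext) (subst torus_interval_mult_eq_sum[OF N order_refl], simp_all only: st)
  moreover have "(\<lambda>m n u. \<Sum>k = - N..N. series_val (a k) u m * t m (n - k) (u + of_int k * \<eta>)) \<in> analytic_elems L"
    by (intro analytic_elems_sum analytic_elems_mult f t) auto
  ultimately show ?thesis by simp
qed

text \<open>Finite support of \<open>r\<close> and \<open>s\<close> makes both sides finite double
  sums; the arguments agree because translations by l \<eta> and j \<eta> compose to the one by (l +
  j) \<eta>.\<close>

lemma torus_interval_mult_assoc:
  assumes r: "r \<in> analytic_elems L" and s: "s \<in> analytic_elems L"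
  shows "torus_interval_mult \<eta> (torus_interval_mult \<eta> r s) t = torus_interval_mult \<eta> r (torus_interval_mult \<eta> s t)"
proof (intro ext)
  fix m n u
  obtain N M where N: "\<And>m n u. N < \<bar>n\<bar> \<Longrightarrow> r m n u = 0" and M: "\<And>m n u. M < \<bar>n\<bar> \<Longrightarrow> s m n u = 0"
    using analytic_elems_support r s by metis
  define K where "K = \<bar>N\<bar> + \<bar>M\<bar>"
  have rs: "torus_interval_mult \<eta> r s m k u = (\<Sum>l = - N..N. r m l u * s m (k - l) (u + of_int l * \<eta>))" for m k u
    by (rule torus_interval_mult_eq_sum[OF N order_refl])
  have rs0: "torus_interval_mult \<eta> r s m k u = 0" if "K < \<bar>k\<bar>" for m k u
    unfolding rs using that by (intro sum.neutral ballI) (auto simp: K_def intro!: M)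
  have "torus_interval_mult \<eta> (torus_interval_mult \<eta> r s) t m n u
      = (\<Sum>k = - K..K. \<Sum>l = - N..N. r m l u * s m (k - l) (u + of_int l * \<eta>) * t m (n - k) (u + of_int k * \<eta>))"
    by (subst torus_interval_mult_eq_sum[OF rs0 order_refl]) (simp_all add: rs sum_distrib_right)
  also have "\<dots> = (\<Sum>l = - N..N. \<Sum>k = - K..K. r m l u * s m (k - l) (u + of_int l * \<eta>) * t m (n - k) (u + of_int k * \<eta>))"
    by (rule sum.swap)
  also have "\<dots> = (\<Sum>l = - N..N. \<Sum>j = - M..M. r m l u * (s m j (u + of_int l * \<eta>) *
      t m (n - l - j) (u + of_int l * \<eta> + of_int j * \<eta>)))"
  \<comment> \<open>Here j = k - l. As \<open>K\<close> bounds |l| + |j|, every pair (l, j) is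
    reached; the surplus k have |k - l| > M and contribute 0.\<close>
  proof (rule sum.cong[OF refl])
    fix l assume l: "l \<in> {- N..N}"
    have fin: "finite {k \<in> {- K..K}. M < \<bar>k - l\<bar>}" by (rule finite_subset[of _ "{- K..K}"]) auto
    show "(\<Sum>k = - K..K. r m l u * s m (k - l) (u + of_int l * \<eta>) * t m (n - k) (u + of_int k * \<eta>)) =
      (\<Sum>j = - M..M. r m l u * (s m j (u + of_int l * \<eta>) * t m (n - l - j) (u + of_int l * \<eta> + of_int j * \<eta>)))"
      by (rule sum.reindex_bij_witness_not_neutral[where i = "\<lambda>j. j + l" and j = "\<lambda>k. k - l"
            and S' = "{k \<in> {- K..K}. M < \<bar>k - l\<bar>}" and T' = "{}", OF fin])
         (use l in \<open>auto simp: K_def M algebra_simps\<close>)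
  qed
  also have "\<dots> = torus_interval_mult \<eta> r (torus_interval_mult \<eta> s t) m n u"
    by (simp add: torus_interval_mult_eq_sum[of N r N, OF N order_refl]
        torus_interval_mult_eq_sum[of M s M, OF M order_refl] sum_distrib_left)
  finally show "torus_interval_mult \<eta> (torus_interval_mult \<eta> r s) t m n u =
      torus_interval_mult \<eta> r (torus_interval_mult \<eta> s t) m n u" .
qed

lemma torus_interval_adj_mult:
  "adj (torus_tensor_interval \<eta> L) (torus_interval_mult \<eta> s t) =
   torus_interval_mult \<eta> (adj (torus_tensor_interval \<eta> L) t) (adj (torus_tensor_interval \<eta> L) s)"
  unfolding torus_interval_simps(6)
proof (intro ext)
  fix m n u
  have e: "- n - (k - n) = - k" "u + of_int n * \<eta> + of_int (k - n) * \<eta> = u + of_int k * \<eta>"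
    "- (n - k) = k - n" "u + of_int k * \<eta> + of_int (n - k) * \<eta> = u + of_int n * \<eta>" for k
    by (simp_all add: algebra_simps)
  have "(\<Sum>\<^sub>\<infinity>k. cnj (s m k (u + of_int n * \<eta>) * t m (- n - k) (u + of_int n * \<eta> + of_int k * \<eta>))) =
    (\<Sum>\<^sub>\<infinity>k. cnj (t m (- k) (u + of_int k * \<eta>)) * cnj (s m (- (n - k)) (u + of_int k * \<eta> + of_int (n - k) * \<eta>)))"
    by (rule infsum_reindex_bij_witness[where i = "\<lambda>k. k + n" and j = "\<lambda>j. j - n", symmetric])
       (simp_all only: e complex_cnj_mult UNIV_I add_diff_cancel diff_add_cancel, simp only: mult.commute)
  then show "cnj (torus_interval_mult \<eta> s t m (- n) (u + of_int n * \<eta>)) =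
      torus_interval_mult \<eta> (\<lambda>m n u. cnj (t m (- n) (u + of_int n * \<eta>)))
        (\<lambda>m n u. cnj (s m (- n) (u + of_int n * \<eta>))) m n u"
    by (simp add: torus_interval_mult_def infsum_cnj[symmetric] del: infsum_cnj)
qed

text \<open>Additivity of infinite sums requires summability; finite supports replace all sums by
  sums over one common finite range.\<close>

lemma torus_interval_mult_add_left:
  assumes "s \<in> analytic_elems L" "s' \<in> analytic_elems L"
  shows "torus_interval_mult \<eta> (\<lambda>m n u. s m n u + s' m n u) t =
     (\<lambda>m n u. torus_interval_mult \<eta> s t m n u + torus_interval_mult \<eta> s' t m n u)"
proof -
  obtain N M where N: "\<And>m n u. N < \<bar>n\<bar> \<Longrightarrow> s m n u = 0" and M: "\<And>m n u. M < \<bar>n\<bar> \<Longrightarrow> s' m n u = 0"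
    using analytic_elems_support assms by metis
  have NM: "s m n u + s' m n u = 0" if "max N M < \<bar>n\<bar>" for m n u using that N M by simp
  show ?thesis
  proof (intro ext)
    fix m n u
    show "torus_interval_mult \<eta> (\<lambda>m n u. s m n u + s' m n u) t m n u =
       torus_interval_mult \<eta> s t m n u + torus_interval_mult \<eta> s' t m n u"
      by (simp only: torus_interval_mult_eq_sum[of "max N M" "\<lambda>m n u. s m n u + s' m n u", OF NM order_refl]
          torus_interval_mult_eq_sum[of N s "max N M", OF N max.cobounded1]
          torus_interval_mult_eq_sum[of M s' "max N M", OF M max.cobounded2] distrib_right sum.distrib)
  qed
qed

lemma torus_interval_mult_add_right:
  assumes "s \<in> analytic_elems L"
  shows "torus_interval_mult \<eta> s (\<lambda>m n u. t m n u + t' m n u) =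
     (\<lambda>m n u. torus_interval_mult \<eta> s t m n u + torus_interval_mult \<eta> s t' m n u)"
proof -
  obtain N where N: "\<And>m n u. N < \<bar>n\<bar> \<Longrightarrow> s m n u = 0"
    using analytic_elems_support assms by metis
  show ?thesis
    by (intro ext) (simp add: torus_interval_mult_eq_sum[of N s N, OF N order_refl] distrib_left sum.distrib)
qed

lemma torus_interval_mult_smult:
  "torus_interval_mult \<eta> (\<lambda>m n u. c * s m n u) t = (\<lambda>m n u. c * torus_interval_mult \<eta> s t m n u)"
  "torus_interval_mult \<eta> s (\<lambda>m n u. c * t m n u) = (\<lambda>m n u. c * torus_interval_mult \<eta> s t m n u)"
  unfolding torus_interval_mult_def infsum_cmult_right'[symmetric] by (simp_all only: mult_ac)

lemma torus_interval_mult_zero: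
  "torus_interval_mult \<eta> (\<lambda>m n u. 0) t = (\<lambda>m n u. 0)" "torus_interval_mult \<eta> s (\<lambda>m n u. 0) = (\<lambda>m n u. 0)"
  by (simp_all add: torus_interval_mult_def fun_eq_iff)

lemma torus_interval_mult_one_left:
  assumes "t \<in> analytic_elems L"
  shows "torus_interval_mult \<eta> \<one>\<^bsub>torus_tensor_interval \<eta> L\<^esub> t = t"
proof (intro ext)
  fix m n u
  have one: "(\<one>\<^bsub>torus_tensor_interval \<eta> L\<^esub>) m k u = 0" if "0 < \<bar>k\<bar>" for m k u
    using that by (simp add: torus_interval_simps)
  show "torus_interval_mult \<eta> \<one>\<^bsub>torus_tensor_interval \<eta> L\<^esub> t m n u = t m n u"
    using torus_interval_mult_eq_sum[of 0 "\<one>\<^bsub>torus_tensor_interval \<eta> L\<^esub>" 0 \<eta> t m n u, OF one order_refl]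
    by (simp add: torus_interval_simps analytic_elems_outside[OF assms])
qed

lemma torus_interval_mult_one_right:
  assumes "t \<in> analytic_elems L"
  shows "torus_interval_mult \<eta> t \<one>\<^bsub>torus_tensor_interval \<eta> L\<^esub> = t"
proof (intro ext)
  fix m n u
  have "torus_interval_mult \<eta> t \<one>\<^bsub>torus_tensor_interval \<eta> L\<^esub> m n u =
      (\<Sum>\<^sub>\<infinity>k\<in>{n}. t m k u * (\<one>\<^bsub>torus_tensor_interval \<eta> L\<^esub>) m (n - k) (u + of_int k * \<eta>))"
    unfolding torus_interval_mult_def by (rule infsum_cong_neutral) (auto simp: torus_interval_simps)
  then show "torus_interval_mult \<eta> t \<one>\<^bsub>torus_tensor_interval \<eta> L\<^esub> m n u = t m n u"
    using analytic_elems_outside[OF assms, of m n u] by (simp add: torus_interval_simps mult.commute)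
qed

section \<open>Homomorphisms from presented *-algebras\<close>

lemma poly_mapping_additive_induct [case_names zero single add]:
  fixes x :: "'a \<Rightarrow>\<^sub>0 'b :: comm_monoid_add"
  assumes "P 0" "\<And>w c. P (Poly_Mapping.single w c)" "\<And>x y. P x \<Longrightarrow> P y \<Longrightarrow> P (x + y)"
  shows "P x"
proof -
  have "x = (\<Sum>w\<in>Poly_Mapping.keys x. Poly_Mapping.single w (Poly_Mapping.lookup x w))"
    by (rule poly_mapping_eqI) (auto simp: lookup_sum lookup_single when_def in_keys_iff)
  moreover have "P (\<Sum>w\<in>W. Poly_Mapping.single w (Poly_Mapping.lookup x w))" if "finite W" for W
    using that by (induction W) (simp_all add: assms)
  ultimately show ?thesis by (metis finite_keys)
qed

lemma free_adj_0: "free_adj 0 = 0"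
  by (rule poly_mapping_eqI) (simp add: free_adj.rep_eq)

lemma free_adj_add: "free_adj (x + y) = free_adj x + free_adj y"
  by (rule poly_mapping_eqI) (simp add: free_adj.rep_eq lookup_add)

lemma free_adj_single: "free_adj (Poly_Mapping.single w c) = Poly_Mapping.single (rev_word w) (cnj c)"
  by (rule poly_mapping_eqI) (auto simp: free_adj.rep_eq lookup_single when_def)

lemma free_adj_times: "free_adj (x * y) = free_adj y * free_adj x"
proof (induction x rule: poly_mapping_additive_induct)
  case (single v a)
  show ?case
  proof (induction y rule: poly_mapping_additive_induct)
    case (single w b)
    then show ?case
      by (simp add: mult_single free_adj_single rev_word_def plus_free_word_def mult.commute)
  qed (simp_all add: distrib_left distrib_right free_adj_add free_adj_0)
qed (simp_all add: distrib_left distrib_right free_adj_add free_adj_0)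

lemma free_adj_free_adj: "free_adj (free_adj x) = x"
  by (rule poly_mapping_eqI) (simp add: free_adj.rep_eq)

lemma inv_free_star_alg: "inv\<^bsub>add_monoid free_star_alg\<^esub> x = - x"
proof -
  have "inv\<^bsub>add_monoid free_star_alg\<^esub> x = \<ominus>\<^bsub>free_star_alg\<^esub> x" by (simp add: a_inv_def)
  also have "\<dots> = - x"
    using abelian_group.minus_equality[OF ring.is_abelian_group[OF ring_free_star_alg], of "- x" x]
    by (simp add: free_star_alg_simps)
  finally show ?thesis .
qed

section \<open>Evaluation of the free algebra at a self-adjoint family\<close>

locale torus_family =
  fixes \<eta> L :: real and S :: "'g \<Rightarrow> real \<Rightarrow> torus_elem"
  assumes S_analytic: "S g \<in> analytic_elems L"
    and S_adj: "adj (torus_tensor_interval \<eta> L) (S g) = S g"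
    and L_pos: "0 < L"
begin

abbreviation T where "T \<equiv> torus_tensor_interval \<eta> L"

abbreviation A :: "(complex, 'g free_alg_elem) star_algebra" where "A \<equiv> free_star_alg"

fun word_eval :: "'g list \<Rightarrow> real \<Rightarrow> torus_elem" where
  "word_eval [] = \<one>\<^bsub>T\<^esub>"
| "word_eval (g # gs) = torus_interval_mult \<eta> (S g) (word_eval gs)"

definition free_eval :: "'g free_alg_elem \<Rightarrow> real \<Rightarrow> torus_elem" where
  "free_eval x = (\<lambda>m n u. \<Sum>w\<in>Poly_Mapping.keys x. Poly_Mapping.lookup x w * word_eval (letters w) m n u)"

lemma one_analytic: "\<one>\<^bsub>T\<^esub> \<in> analytic_elems L"
  using analytic_elems_one[of \<eta> L] by (simp add: torus_tensor_interval_def Let_def)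

lemma word_eval_analytic: "word_eval gs \<in> analytic_elems L"
  by (induction gs) (simp_all add: one_analytic analytic_elems_torus_mult S_analytic)

lemma word_eval_append: "word_eval (gs @ hs) = torus_interval_mult \<eta> (word_eval gs) (word_eval hs)"
proof (induction gs)
  case (Cons g gs)
  then show ?case
    using torus_interval_mult_assoc[OF S_analytic[of g] word_eval_analytic[of gs]] by simp
qed (simp add: torus_interval_mult_one_left[OF word_eval_analytic])

lemma word_eval_single: "word_eval [g] = S g"
  using torus_interval_mult_one_right[OF S_analytic] by simp

text \<open>The adjoint reverses products and fixes every letter; this is the reason for requiring
  \<open>S_adj\<close>.\<close>

lemma word_eval_rev: "word_eval (rev gs) = adj T (word_eval gs)"
proof (induction gs)
  case Nil
  then show ?case by (auto simp: torus_interval_simps interval_one_def fun_eq_iff)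
next
  case (Cons g gs)
  then show ?case
    by (simp add: word_eval_append word_eval_single torus_interval_adj_mult S_adj
        del: word_eval.simps(2)) (simp add: torus_interval_adj_mult S_adj)
qed

lemma free_eval_superset:
  assumes "finite W" "Poly_Mapping.keys x \<subseteq> W"
  shows "free_eval x m n u = (\<Sum>w\<in>W. Poly_Mapping.lookup x w * word_eval (letters w) m n u)"
  unfolding free_eval_def using assms
  by (intro sum.mono_neutral_left) (auto simp: in_keys_iff)

lemma free_eval_analytic: "free_eval x \<in> analytic_elems L"
  unfolding free_eval_def by (intro analytic_elems_sum analytic_elems_smult word_eval_analytic) simp

lemma free_eval_0: "free_eval 0 = \<zero>\<^bsub>T\<^esub>"
  by (simp add: free_eval_def torus_interval_simps)

lemma free_eval_single: "free_eval (Poly_Mapping.single w c) = c \<odot>\<^bsub>T\<^esub> word_eval (letters w)"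
  unfolding torus_interval_simps
  by (intro ext, subst free_eval_superset[of "{w}"]) auto

lemma free_eval_add: "free_eval (x + y) = free_eval x \<oplus>\<^bsub>T\<^esub> free_eval y"
proof -
  let ?W = "Poly_Mapping.keys x \<union> Poly_Mapping.keys y"
  show ?thesis
    unfolding torus_interval_simps
    using free_eval_superset[of ?W x] free_eval_superset[of ?W y]
      free_eval_superset[of ?W "x + y", OF _ Poly_Mapping.keys_add]
    by (intro ext) (simp add: lookup_add distrib_right sum.distrib)
qed

text \<open>Both sides are biadditive, so induction in each argument reduces the claim to words,
  whose product is concatenation.\<close>

lemma free_eval_mult: "free_eval (x * y) = free_eval x \<otimes>\<^bsub>T\<^esub> free_eval y"
proof (induction x rule: poly_mapping_additive_induct)
  case zero
  then show ?case by (simp add: free_eval_0 torus_interval_simps(1,3) torus_interval_mult_zero)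
next
  case (add x x')
  then show ?case
    using torus_interval_mult_add_left[OF free_eval_analytic free_eval_analytic]
    by (simp add: distrib_right free_eval_add torus_interval_simps)
next
  case (single v a)
  show ?case
  proof (induction y rule: poly_mapping_additive_induct)
    case zero
    then show ?case by (simp add: free_eval_0 torus_interval_simps(1,3) torus_interval_mult_zero)
  next
    case (add y y')
    then show ?case
      using torus_interval_mult_add_right[OF free_eval_analytic]
      by (simp add: distrib_left free_eval_add torus_interval_simps)
  next
    case (single w b)
    show ?case
      unfolding mult_single free_eval_single torus_interval_simps(1,5) torus_interval_mult_smult
      by (simp add: plus_free_word_def word_eval_append mult.assoc)
  qed
qed

lemma free_eval_1: "free_eval 1 = \<one>\<^bsub>T\<^esub>"
  using free_eval_single[of 0 1] by (simp add: torus_interval_simps(5) single_one) (simp add: zero_free_word_def)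

lemma free_eval_gen: "free_eval (free_gen g) = S g"
  using word_eval_single[of g] by (simp add: free_gen_def free_eval_single torus_interval_simps(5))

lemma free_eval_smult: "free_eval (c \<odot>\<^bsub>A\<^esub> x) = c \<odot>\<^bsub>T\<^esub> free_eval x"
proof -
  have "free_eval (c \<odot>\<^bsub>A\<^esub> x) = torus_interval_mult \<eta> (c \<odot>\<^bsub>T\<^esub> \<one>\<^bsub>T\<^esub>) (free_eval x)"
    by (simp add: free_star_alg_simps free_eval_mult free_eval_single zero_free_word_def torus_interval_simps(1))
  also have "\<dots> = c \<odot>\<^bsub>T\<^esub> torus_interval_mult \<eta> \<one>\<^bsub>T\<^esub> (free_eval x)"
    unfolding torus_interval_simps(5) by (rule torus_interval_mult_smult)
  finally show ?thesis
    by (simp only: torus_interval_mult_one_left[OF free_eval_analytic])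
qed

lemma free_eval_adj: "free_eval (free_adj x) = adj T (free_eval x)"
proof (induction x rule: poly_mapping_additive_induct)
  case zero
  then show ?case by (simp add: free_adj_0 free_eval_0) (simp add: torus_interval_simps)
next
  case (single w c)
  then show ?case
    by (simp add: free_adj_single free_eval_single rev_word_def word_eval_rev) (simp add: torus_interval_simps)
next
  case (add x y)
  then show ?case by (simp add: free_adj_add free_eval_add) (simp add: torus_interval_simps)
qed

lemma free_eval_diff_eq_0_iff: "free_eval (x - y) = \<zero>\<^bsub>T\<^esub> \<longleftrightarrow> free_eval x = free_eval y"
proof -
  have "free_eval x = free_eval (x - y) \<oplus>\<^bsub>T\<^esub> free_eval y"
    using free_eval_add[of "x - y" y] by simp
  then show ?thesis by (auto simp: torus_interval_simps fun_eq_iff)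
qed

text \<open>Checked directly from the rules for \<open>free_eval\<close>: ring laws in the target
  are established for analytic elements, so the general theorem on kernels of ring homomorphisms is
  bypassed.\<close>

lemma ideal_kernel: "ideal {x. free_eval x = \<zero>\<^bsub>T\<^esub>} A"
proof (rule idealI[OF ring_free_star_alg])
  show "subgroup {x. free_eval x = \<zero>\<^bsub>T\<^esub>} (add_monoid A)"
  proof
    fix x assume x: "x \<in> {x. free_eval x = \<zero>\<^bsub>T\<^esub>}"
    show "inv\<^bsub>add_monoid A\<^esub> x \<in> {x. free_eval x = \<zero>\<^bsub>T\<^esub>}"
      unfolding inv_free_star_alg
      using x free_eval_diff_eq_0_iff[of 0 x] by (simp add: free_eval_0)
  qed (auto simp: free_star_alg_simps free_eval_add free_eval_0 torus_interval_simps)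
qed (auto simp: free_star_alg_simps free_eval_mult torus_interval_simps torus_interval_mult_zero)

section \<open>Descent to the quotient by the generated ideal\<close>

context
  fixes R :: "'g free_alg_elem set"
  assumes R: "\<And>r. r \<in> R \<Longrightarrow> free_eval r = \<zero>\<^bsub>T\<^esub>"
begin

abbreviation I where "I \<equiv> star_ideal_generated A R"
abbreviation Q where "Q \<equiv> quotient_star_alg A I"

lemma I_kernel: "x \<in> I \<Longrightarrow> free_eval x = \<zero>\<^bsub>T\<^esub>"
proof -
  have "R \<union> adj A ` R \<subseteq> {x. free_eval x = \<zero>\<^bsub>T\<^esub>}"
    using R by (auto simp: free_star_alg_simps free_eval_adj torus_interval_simps)
  then have "I \<subseteq> {x. free_eval x = \<zero>\<^bsub>T\<^esub>}"
    unfolding star_ideal_generated_def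
    by (intro ring.genideal_minimal[OF ring_free_star_alg ideal_kernel])
  then show "x \<in> I \<Longrightarrow> free_eval x = \<zero>\<^bsub>T\<^esub>" by blast
qed

lemma ideal_I: "ideal I A"
  unfolding star_ideal_generated_def
  by (rule ring.genideal_ideal[OF ring_free_star_alg]) (simp add: free_star_alg_simps)

lemma I_closed: "x \<in> I \<Longrightarrow> y \<in> I \<Longrightarrow> x + y \<in> I" "x \<in> I \<Longrightarrow> y * x \<in> I" "x \<in> I \<Longrightarrow> x * y \<in> I"
  "0 \<in> I"
  using ideal.I_l_closed[OF ideal_I, of x y] ideal.I_r_closed[OF ideal_I, of x y]
    additive_subgroup.a_closed[OF ideal.axioms(1)[OF ideal_I], of x y]
    additive_subgroup.zero_closed[OF ideal.axioms(1)[OF ideal_I]]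
  by (auto simp: free_star_alg_simps)

lemma coset_eq: "I +>\<^bsub>A\<^esub> x = {i + x | i. i \<in> I}"
  by (auto simp: a_r_coset_def' free_star_alg_simps)

lemma coset_eq_iff: "I +>\<^bsub>A\<^esub> x = I +>\<^bsub>A\<^esub> y \<longleftrightarrow> x - y \<in> I"
proof
  assume "I +>\<^bsub>A\<^esub> x = I +>\<^bsub>A\<^esub> y"
  moreover have "x \<in> I +>\<^bsub>A\<^esub> x" unfolding coset_eq using I_closed(4) by force
  ultimately show "x - y \<in> I" unfolding coset_eq by force
next
  assume xy: "x - y \<in> I"
  have yx: "- 1 * (x - y) \<in> I" by (rule I_closed(2)[OF xy])
  have "i + x = i + (x - y) + y" "i + y = i + - 1 * (x - y) + x" for i by simp_all
  then show "I +>\<^bsub>A\<^esub> x = I +>\<^bsub>A\<^esub> y"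
    unfolding coset_eq using I_closed(1)[OF _ xy] I_closed(1)[OF _ yx] by blast
qed

lemma free_eval_coset: "I +>\<^bsub>A\<^esub> x = I +>\<^bsub>A\<^esub> y \<Longrightarrow> free_eval x = free_eval y"
  using coset_eq_iff I_kernel free_eval_diff_eq_0_iff by blast

text \<open>As \<open>free_adj\<close> is additive and reverses products, the preimage of
  \<open>I\<close> is an ideal; it contains the generators, whose set is stable under the adjoint,
  so minimality applies. This makes the adjoint of a coset well defined.\<close>

lemma I_adj: "x \<in> I \<Longrightarrow> free_adj x \<in> I"
proof -
  have "ideal {x. free_adj x \<in> I} A"
  proof (rule idealI[OF ring_free_star_alg])
    show "subgroup {x. free_adj x \<in> I} (add_monoid A)"
    proof
      fix x assume x: "x \<in> {x. free_adj x \<in> I}"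
      have "free_adj (- x) = - 1 * free_adj x" by (rule poly_mapping_eqI) (simp add: free_adj.rep_eq)
      then show "inv\<^bsub>add_monoid A\<^esub> x \<in> {x. free_adj x \<in> I}"
        unfolding inv_free_star_alg
        using x I_closed(2)[of "free_adj x" "- 1"] by simp
    qed (auto simp: free_star_alg_simps free_adj_add free_adj_0 I_closed)
  qed (auto simp: free_star_alg_simps free_adj_times I_closed)
  moreover have "R \<union> adj A ` R \<subseteq> {x. free_adj x \<in> I}"
    using ring.genideal_self[OF ring_free_star_alg, of "R \<union> adj A ` R"]
    by (auto simp: free_star_alg_simps star_ideal_generated_def free_adj_free_adj)
  ultimately have "I \<subseteq> {x. free_adj x \<in> I}"
    unfolding star_ideal_generated_def
    by (intro ring.genideal_minimal[OF ring_free_star_alg])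
  then show "x \<in> I \<Longrightarrow> free_adj x \<in> I" by blast
qed

lemma Q_carrier: "X \<in> carrier Q \<longleftrightarrow> (\<exists>x. X = I +>\<^bsub>A\<^esub> x)"
  by (auto simp: quotient_star_alg_def FactRing_def A_RCOSETS_def' free_star_alg_simps)

text \<open>Scalar multiple and adjoint of a coset are defined as unions over its members; all
  members yield the same coset, so each union collapses.\<close>

lemma Q_ops:
  "(I +>\<^bsub>A\<^esub> x) \<otimes>\<^bsub>Q\<^esub> (I +>\<^bsub>A\<^esub> y) = I +>\<^bsub>A\<^esub> (x * y)"
  "(I +>\<^bsub>A\<^esub> x) \<oplus>\<^bsub>Q\<^esub> (I +>\<^bsub>A\<^esub> y) = I +>\<^bsub>A\<^esub> (x + y)"
  "\<one>\<^bsub>Q\<^esub> = I +>\<^bsub>A\<^esub> 1"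
  "c \<odot>\<^bsub>Q\<^esub> (I +>\<^bsub>A\<^esub> x) = I +>\<^bsub>A\<^esub> (c \<odot>\<^bsub>A\<^esub> x)"
  "adj Q (I +>\<^bsub>A\<^esub> x) = I +>\<^bsub>A\<^esub> free_adj x"
proof -
  show "(I +>\<^bsub>A\<^esub> x) \<otimes>\<^bsub>Q\<^esub> (I +>\<^bsub>A\<^esub> y) = I +>\<^bsub>A\<^esub> (x * y)"
    using ideal.rcoset_mult_add[OF ideal_I, of x y]
    by (simp add: quotient_star_alg_def FactRing_def) (simp add: free_star_alg_simps)
  show "(I +>\<^bsub>A\<^esub> x) \<oplus>\<^bsub>Q\<^esub> (I +>\<^bsub>A\<^esub> y) = I +>\<^bsub>A\<^esub> (x + y)"
    using ideal.a_rcos_sum[OF ideal_I, of x y]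
    by (simp add: quotient_star_alg_def FactRing_def) (simp add: free_star_alg_simps)
  show "\<one>\<^bsub>Q\<^esub> = I +>\<^bsub>A\<^esub> 1"
    by (simp add: quotient_star_alg_def FactRing_def) (simp add: free_star_alg_simps)
  have mem: "x \<in> I +>\<^bsub>A\<^esub> x" for x unfolding coset_eq using I_closed(4) by force
  have "I +>\<^bsub>A\<^esub> (c \<odot>\<^bsub>A\<^esub> y) = I +>\<^bsub>A\<^esub> (c \<odot>\<^bsub>A\<^esub> x)" if "y \<in> I +>\<^bsub>A\<^esub> x" for y
    unfolding coset_eq_iff using that I_closed(2)
    by (auto simp: coset_eq free_star_alg_simps right_diff_distrib[symmetric])
  then have "(\<Union>y\<in>I +>\<^bsub>A\<^esub> x. I +>\<^bsub>A\<^esub> (c \<odot>\<^bsub>A\<^esub> y)) = I +>\<^bsub>A\<^esub> (c \<odot>\<^bsub>A\<^esub> x)"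
    using mem by blast
  then show "c \<odot>\<^bsub>Q\<^esub> (I +>\<^bsub>A\<^esub> x) = I +>\<^bsub>A\<^esub> (c \<odot>\<^bsub>A\<^esub> x)"
    by (simp add: quotient_star_alg_def)
  have "I +>\<^bsub>A\<^esub> (free_adj y) = I +>\<^bsub>A\<^esub> (free_adj x)" if "y \<in> I +>\<^bsub>A\<^esub> x" for y
    unfolding coset_eq_iff using that I_adj by (auto simp: coset_eq free_adj_add)
  then have "(\<Union>y\<in>I +>\<^bsub>A\<^esub> x. I +>\<^bsub>A\<^esub> (adj A y)) = I +>\<^bsub>A\<^esub> free_adj x"
    unfolding free_star_alg_simps using mem by blast
  then show "adj Q (I +>\<^bsub>A\<^esub> x) = I +>\<^bsub>A\<^esub> free_adj x"
    by (simp add: quotient_star_alg_def)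
qed

lemma presented_hom_exists:
  "\<exists>\<rho>. \<rho> \<in> star_alg_hom Q T \<and> \<rho> \<in> extensional (carrier Q) \<and> (\<forall>x. \<rho> (I +>\<^bsub>A\<^esub> x) = free_eval x)"
proof -
  \<comment> \<open>The value is taken at a chosen representative; it is independent of the choice
    because \<open>I\<close> lies in the kernel of \<open>free_eval\<close>.\<close>
  define \<rho> where "\<rho> = restrict (\<lambda>X. free_eval (SOME x. X = I +>\<^bsub>A\<^esub> x)) (carrier Q)"
  have rho: "\<rho> (I +>\<^bsub>A\<^esub> x) = free_eval x" for x
  proof -
    have "I +>\<^bsub>A\<^esub> x = I +>\<^bsub>A\<^esub> (SOME y. I +>\<^bsub>A\<^esub> x = I +>\<^bsub>A\<^esub> y)" by (rule someI) (rule refl)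
    then have "free_eval (SOME y. I +>\<^bsub>A\<^esub> x = I +>\<^bsub>A\<^esub> y) = free_eval x"
      by (rule free_eval_coset[symmetric])
    moreover have "I +>\<^bsub>A\<^esub> x \<in> carrier Q" using Q_carrier by blast
    ultimately show ?thesis by (simp only: \<rho>_def restrict_apply')
  qed
  have "\<rho> \<in> star_alg_hom Q T"
    unfolding star_alg_hom_def mem_Collect_eq
  proof (intro conjI allI ballI)
    show "\<rho> \<in> ring_hom Q T"
    proof (rule ring_hom_memI)
      fix X assume "X \<in> carrier Q"
      then show "\<rho> X \<in> carrier T"
        using analytic_elems_completed[OF L_pos free_eval_analytic] by (auto simp: Q_carrier rho)
    qed (auto simp: Q_carrier Q_ops rho free_eval_mult free_eval_add free_eval_1)
  qed (auto simp: Q_carrier Q_ops rho free_eval_smult free_eval_adj)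
  moreover have "\<rho> \<in> extensional (carrier Q)" by (simp add: \<rho>_def)
  ultimately show ?thesis using rho by blast
qed

text \<open>Uniqueness half of the universal property: words are products of generators, and every
  element is a linear combination of words.\<close>

lemma presented_hom_eval:
  assumes h: "h \<in> star_alg_hom Q T" and gen: "\<And>g. h (I +>\<^bsub>A\<^esub> free_gen g) = S g"
  shows "h (I +>\<^bsub>A\<^esub> x) = free_eval x"
proof -
  have car: "I +>\<^bsub>A\<^esub> x \<in> carrier Q" for x using Q_carrier by blast
  have hm: "h (I +>\<^bsub>A\<^esub> (x * y)) = h (I +>\<^bsub>A\<^esub> x) \<otimes>\<^bsub>T\<^esub> h (I +>\<^bsub>A\<^esub> y)"
    and ha: "h (I +>\<^bsub>A\<^esub> (x + y)) = h (I +>\<^bsub>A\<^esub> x) \<oplus>\<^bsub>T\<^esub> h (I +>\<^bsub>A\<^esub> y)"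
    and h1: "h (I +>\<^bsub>A\<^esub> 1) = \<one>\<^bsub>T\<^esub>"
    and hs: "h (I +>\<^bsub>A\<^esub> (c \<odot>\<^bsub>A\<^esub> x)) = c \<odot>\<^bsub>T\<^esub> h (I +>\<^bsub>A\<^esub> x)" for x y c
    using h car unfolding star_alg_hom_def ring_hom_def
    by (simp_all add: Q_ops[symmetric])
  have word: "h (I +>\<^bsub>A\<^esub> Poly_Mapping.single (Word gs) 1) = word_eval gs" for gs
  proof (induction gs)
    case Nil
    have "Poly_Mapping.single (Word []) 1 = (1 :: 'g free_alg_elem)"
      by (metis single_one zero_free_word_def)
    then show ?case by (simp add: h1)
  next
    case (Cons g gs)
    have "Poly_Mapping.single (Word (g # gs)) (1 :: complex) = free_gen g * Poly_Mapping.single (Word gs) 1"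
      by (simp add: free_gen_def mult_single plus_free_word_def)
    then show ?case by (simp add: hm gen Cons torus_interval_simps(1))
  qed
  have single: "h (I +>\<^bsub>A\<^esub> Poly_Mapping.single w c) = free_eval (Poly_Mapping.single w c)" for w c
  proof -
    have "Poly_Mapping.single w c = c \<odot>\<^bsub>A\<^esub> Poly_Mapping.single (Word (letters w)) 1"
      by (simp add: free_star_alg_simps mult_single)
    then show ?thesis by (simp only: hs word free_eval_single free_eval_smult free_word.sel) (simp add: torus_interval_simps)
  qed
  show ?thesis
  proof (induction x rule: poly_mapping_additive_induct)
    case zero
    then show ?case using single[of 0 0] by simp
  qed (simp_all add: single ha free_eval_add)
qed

end

end

section \<open>The Sklyanin relations\<close>

text \<open>Common form of the three addition theorems, with \<open>p\<close> the odd function. The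
  instances pair theta_1 with theta_2, theta_3 and theta_4, and serve the relations with k = 1, 2
  and 3 respectively.\<close>

locale theta_addition =
  fixes p q r s :: "complex \<Rightarrow> complex" and C :: complex
  assumes C: "C \<noteq> 0"
    and pq_add: "p (x + y) * q (x - y) * C = (p x * q x) * (r y * s y) + (r x * s x) * (p y * q y)"
    and rs_add: "r (x + y) * s (x - y) * C = (r x * s x) * (r y * s y) - (p x * q x) * (p y * q y)"
    and parity: "p (- x) = - p x" "q (- x) = q x" "r (- x) = r x" "s (- x) = s x"
begin

text \<open>Every cross product becomes bilinear in the values of pq and rs at x and at y, after
  which the identities below are polynomial ones.\<close>

lemma pq_eq: "p (x + y) * q (x - y) = ((p x * q x) * (r y * s y) + (r x * s x) * (p y * q y)) / C"
  and pq_eq': "p (x - y) * q (x + y) = ((p x * q x) * (r y * s y) - (r x * s x) * (p y * q y)) / C"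
  and rs_eq: "r (x + y) * s (x - y) = ((r x * s x) * (r y * s y) - (p x * q x) * (p y * q y)) / C"
  and rs_eq': "r (x - y) * s (x + y) = ((r x * s x) * (r y * s y) + (p x * q x) * (p y * q y)) / C"
  using pq_add[of x y] pq_add[of x "- y"] rs_add[of x y] rs_add[of x "- y"] C
  by (simp_all add: parity eq_divide_eq)

text \<open>For the coefficient of V^2, where the two theta arguments lie at distance h from their
  midpoint Y.\<close>

lemma quadratic:
  "r h * s h * (p (Y + h) * q (Y - h) - p (Y - h) * q (Y + h)) =
     p h * q h * (r (Y + h) * s (Y - h) + r (Y - h) * s (Y + h))"
  "r h * s h * (r (Y + h) * s (Y - h) - r (Y - h) * s (Y + h)) =
     - (p h * q h * (p (Y + h) * q (Y - h) + p (Y - h) * q (Y + h)))"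
  unfolding pq_eq pq_eq' rs_eq rs_eq' using C by (simp_all add: field_simps)

text \<open>For the coefficient of 1, where the theta arguments are Y + \<mu> and Y - \<mu>. Each
  combination is built so that \<mu> splits off as a factor and a product at Y - h, Y + h
  remains.\<close>

lemma mixed:
  "r h * s h * (p (Y + \<mu>) * q (Y - \<mu>) - p (Y - \<mu>) * q (Y + \<mu>)) -
     p h * q h * (r (Y + \<mu>) * s (Y - \<mu>) - r (Y - \<mu>) * s (Y + \<mu>)) = 2 * (p \<mu> * q \<mu>) * (r (Y - h) * s (Y + h))"
  "r h * s h * (r (Y + \<mu>) * s (Y - \<mu>) + r (Y - \<mu>) * s (Y + \<mu>)) +
     p h * q h * (p (Y + \<mu>) * q (Y - \<mu>) + p (Y - \<mu>) * q (Y + \<mu>)) = 2 * (r \<mu> * s \<mu>) * (r (Y - h) * s (Y + h))"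
  "r h * s h * (p (Y + \<mu>) * q (Y - \<mu>) + p (Y - \<mu>) * q (Y + \<mu>)) -
     p h * q h * (r (Y + \<mu>) * s (Y - \<mu>) + r (Y - \<mu>) * s (Y + \<mu>)) = 2 * (r \<mu> * s \<mu>) * (p (Y - h) * q (Y + h))"
  "r h * s h * (r (Y + \<mu>) * s (Y - \<mu>) - r (Y - \<mu>) * s (Y + \<mu>)) +
     p h * q h * (p (Y + \<mu>) * q (Y - \<mu>) - p (Y - \<mu>) * q (Y + \<mu>)) = - 2 * (p \<mu> * q \<mu>) * (p (Y - h) * q (Y + h))"
  unfolding pq_eq pq_eq' rs_eq rs_eq' using C by (simp_all add: field_simps)

end

primrec sk_theta :: "complex \<Rightarrow> sklyanin_index \<Rightarrow> complex \<Rightarrow> complex" where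
  "sk_theta \<tau> G0 = theta3 \<tau>"
| "sk_theta \<tau> G1 = theta4 \<tau>"
| "sk_theta \<tau> G2 = theta1 \<tau>"
| "sk_theta \<tau> G3 = theta2 \<tau>"

primrec sk_coeff :: "complex \<Rightarrow> sklyanin_index \<Rightarrow> complex \<Rightarrow> complex" where
  "sk_coeff \<tau> G0 h = theta1 \<tau> h"
| "sk_coeff \<tau> G1 h = - \<i> * theta2 \<tau> h"
| "sk_coeff \<tau> G2 h = theta3 \<tau> h"
| "sk_coeff \<tau> G3 h = - theta4 \<tau> h"

text \<open>With these signs the coefficient of \<open>V\<^sup>*\<close> arises from that of \<open>V\<close> by \<open>\<eta> \<mapsto> -\<eta>\<close>, \<open>m \<mapsto> -m\<close>.\<close>

primrec sk_sign :: "sklyanin_index \<Rightarrow> complex" where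
  "sk_sign G0 = - 1"
| "sk_sign G1 = - 1"
| "sk_sign G2 = 1"
| "sk_sign G3 = 1"

definition sk_fun :: "complex \<Rightarrow> real \<Rightarrow> sklyanin_index \<Rightarrow> complex \<Rightarrow> complex \<Rightarrow> complex \<Rightarrow> complex" where
  "sk_fun \<tau> c a h \<mu> u = sk_coeff \<tau> a h * (sk_theta \<tau> a (2 * u + h + \<mu>) / (theta_d \<tau> c u * theta_d \<tau> c (- u - h)))"

text \<open>\<open>P a b\<close> stands for one coefficient, at fixed m and u, of the product of the
  images of the generators a and b. The expression is linear in \<open>P\<close>, which permits
  checking relations coefficient by coefficient.\<close>

definition comm_rel ::
    "sklyanin_index \<times> sklyanin_index \<times> sklyanin_index \<times> complex \<Rightarrow> (sklyanin_index \<Rightarrow> sklyanin_index \<Rightarrow> complex) \<Rightarrow> complex" where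
  "comm_rel = (\<lambda>(k, l, m, J) P. (P l m - P m l) - \<i> * (P G0 k + P k G0))"

definition anticomm_rel ::
    "sklyanin_index \<times> sklyanin_index \<times> sklyanin_index \<times> complex \<Rightarrow> (sklyanin_index \<Rightarrow> sklyanin_index \<Rightarrow> complex) \<Rightarrow> complex" where
  "anticomm_rel = (\<lambda>(k, l, m, J) P. (P G0 k - P k G0) - \<i> * J * (P l m + P m l))"

definition sk_triples :: "complex \<Rightarrow> complex \<Rightarrow> (sklyanin_index \<times> sklyanin_index \<times> sklyanin_index \<times> complex) set" where
  "sk_triples \<tau> h =
    {(G1, G2, G3, (theta1 \<tau> h)\<^sup>2 * (theta2 \<tau> h)\<^sup>2 / ((theta3 \<tau> h)\<^sup>2 * (theta4 \<tau> h)\<^sup>2)),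
     (G2, G3, G1, - ((theta1 \<tau> h)\<^sup>2 * (theta3 \<tau> h)\<^sup>2 / ((theta2 \<tau> h)\<^sup>2 * (theta4 \<tau> h)\<^sup>2))),
     (G3, G1, G2, (theta1 \<tau> h)\<^sup>2 * (theta4 \<tau> h)\<^sup>2 / ((theta2 \<tau> h)\<^sup>2 * (theta3 \<tau> h)\<^sup>2))}"

text \<open>What remains of the coefficient of 1 once its dependence on \<mu> and h has been split
  off.\<close>

definition sk_ratio :: "complex \<Rightarrow> sklyanin_index \<Rightarrow> complex \<Rightarrow> complex" where
  "sk_ratio \<tau> k u = (if k = G1 then theta3 \<tau> (2 * u) else if k = G2 then theta2 \<tau> (2 * u) else theta1 \<tau> (2 * u)) / theta4 \<tau> (2 * u)"

text \<open>For k = 1, 2, 3 the structure constant J is, up to sign, the square of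
  \<open>sk_pair\<close> divided by \<open>sk_copair\<close>, both taken at \<eta>.\<close>

primrec sk_pair :: "complex \<Rightarrow> sklyanin_index \<Rightarrow> complex \<Rightarrow> complex" where
  "sk_pair \<tau> G0 x = 0"
| "sk_pair \<tau> G1 x = theta1 \<tau> x * theta2 \<tau> x"
| "sk_pair \<tau> G2 x = theta1 \<tau> x * theta3 \<tau> x"
| "sk_pair \<tau> G3 x = theta1 \<tau> x * theta4 \<tau> x"

primrec sk_copair :: "complex \<Rightarrow> sklyanin_index \<Rightarrow> complex \<Rightarrow> complex" where
  "sk_copair \<tau> G0 x = 0"
| "sk_copair \<tau> G1 x = theta3 \<tau> x * theta4 \<tau> x"
| "sk_copair \<tau> G2 x = theta2 \<tau> x * theta4 \<tau> x"
| "sk_copair \<tau> G3 x = theta2 \<tau> x * theta3 \<tau> x"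

lemmas sk_simps = sk_pair.simps sk_copair.simps sk_coeff.simps sk_theta.simps sk_sign.simps theta_minus

lemma sk_triples_minus: "sk_triples \<tau> (- h) = sk_triples \<tau> h"
  by (simp add: sk_triples_def theta_minus)

text \<open>J is characterised with its denominator cleared, so that it can enter a polynomial ideal
  membership problem.\<close>

lemma sk_triples_cases:
  assumes "x \<in> sk_triples \<tau> h" "theta2 \<tau> h \<noteq> 0" "theta3 \<tau> h \<noteq> 0" "theta4 \<tau> h \<noteq> 0"
  obtains (1) J where "x = (G1, G2, G3, J)" "J * (theta3 \<tau> h * theta4 \<tau> h)\<^sup>2 = (theta1 \<tau> h * theta2 \<tau> h)\<^sup>2"
    | (2) J where "x = (G2, G3, G1, J)" "J * (theta2 \<tau> h * theta4 \<tau> h)\<^sup>2 = - (theta1 \<tau> h * theta3 \<tau> h)\<^sup>2"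
    | (3) J where "x = (G3, G1, G2, J)" "J * (theta2 \<tau> h * theta3 \<tau> h)\<^sup>2 = (theta1 \<tau> h * theta4 \<tau> h)\<^sup>2"
  using assms unfolding sk_triples_def by (fastforce simp: power_mult_distrib)

locale sklyanin_theta =
  fixes \<tau> :: complex and c :: real and h :: complex
  assumes t: "Im \<tau> > 0" and c: "c \<noteq> 0" "(of_real c)\<^sup>2 = (theta3 \<tau> 0)\<^sup>2 * theta4 \<tau> 0"
    and h: "theta2 \<tau> h \<noteq> 0" "theta3 \<tau> h \<noteq> 0" "theta4 \<tau> h \<noteq> 0"
begin

lemma theta_0_nonzero: "theta2 \<tau> 0 \<noteq> 0" "theta3 \<tau> 0 \<noteq> 0" "theta4 \<tau> 0 \<noteq> 0"
  using theta2_nonzero[OF t, of 0] theta3_nonzero[OF t, of 0] theta4_nonzero[OF t, of 0] by auto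

sublocale add1: theta_addition "theta1 \<tau>" "theta2 \<tau>" "theta3 \<tau>" "theta4 \<tau>" "theta3 \<tau> 0 * theta4 \<tau> 0"
  using theta_0_nonzero theta12_34_add[OF t] by unfold_locales (auto simp: theta_minus)

sublocale add2: theta_addition "theta1 \<tau>" "theta3 \<tau>" "theta2 \<tau>" "theta4 \<tau>" "theta2 \<tau> 0 * theta4 \<tau> 0"
  using theta_0_nonzero theta13_24_add[OF t] by unfold_locales (auto simp: theta_minus)

sublocale add3: theta_addition "theta1 \<tau>" "theta4 \<tau>" "theta2 \<tau>" "theta3 \<tau>" "theta2 \<tau> 0 * theta3 \<tau> 0"
  using theta_0_nonzero theta14_23_add[OF t] by unfold_locales (auto simp: theta_minus)

text \<open>The four values of d are the same for every pair of generators and form the common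
  factor \<open>D\<close>; the numerators satisfy \<open>quadratic\<close>.\<close>

lemma sk_fun_rel_2:
  assumes "x \<in> sk_triples \<tau> h"
  shows "comm_rel x (\<lambda>a b. sk_fun \<tau> c a h \<mu> u * sk_fun \<tau> c b h \<mu> (u + h)) = 0"
    and "anticomm_rel x (\<lambda>a b. sk_fun \<tau> c a h \<mu> u * sk_fun \<tau> c b h \<mu> (u + h)) = 0"
proof -
  define Y where "Y = 2 * u + 2 * h + \<mu>"
  define D where "D = inverse (theta_d \<tau> c u * theta_d \<tau> c (- u - h) * theta_d \<tau> c (u + h) * theta_d \<tau> c (- (u + h) - h))"
  have P: "sk_fun \<tau> c a h \<mu> u * sk_fun \<tau> c b h \<mu> (u + h) =
      sk_coeff \<tau> a h * sk_coeff \<tau> b h * (sk_theta \<tau> a (Y - h) * sk_theta \<tau> b (Y + h)) * D" for a b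
  proof -
    have e: "2 * u + h + \<mu> = Y - h" "2 * (u + h) + h + \<mu> = Y + h" by (simp_all add: Y_def algebra_simps)
    show ?thesis unfolding sk_fun_def D_def e divide_inverse inverse_mult_distrib by (simp only: mult_ac)
  qed
  have i2: "\<i> * \<i> = - 1" by simp
  note q = add1.quadratic[of h Y] add2.quadratic[of h Y] add3.quadratic[of h Y]
  show "comm_rel x (\<lambda>a b. sk_fun \<tau> c a h \<mu> u * sk_fun \<tau> c b h \<mu> (u + h)) = 0"
    using assms h
  proof (cases rule: sk_triples_cases)
    case 1
    show ?thesis unfolding P 1 comm_rel_def prod.case sk_simps using q(1) i2 by Groebner_Basis.algebra
  next
    case 2
    \<comment> \<open>For k = 2 the indices l, m carry the even functions theta_2 and theta_4, so
      the two identities of \<open>quadratic\<close> exchange their roles.\<close>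
    show ?thesis unfolding P 2 comm_rel_def prod.case sk_simps using q(4) i2 by Groebner_Basis.algebra
  next
    case 3
    show ?thesis unfolding P 3 comm_rel_def prod.case sk_simps using q(5) i2 by Groebner_Basis.algebra
  qed
  show "anticomm_rel x (\<lambda>a b. sk_fun \<tau> c a h \<mu> u * sk_fun \<tau> c b h \<mu> (u + h)) = 0"
    using assms h
  proof (cases rule: sk_triples_cases)
    case (1 J)
    \<comment> \<open>This factor supplies one half of the denominator of J;
      \<open>quadratic\<close> supplies the other half.\<close>
    have "theta3 \<tau> h * theta4 \<tau> h * anticomm_rel x (\<lambda>a b. sk_fun \<tau> c a h \<mu> u * sk_fun \<tau> c b h \<mu> (u + h)) = 0"
      unfolding P 1(1) anticomm_rel_def prod.case sk_simps using q(2) 1(2) i2 by Groebner_Basis.algebra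
    then show ?thesis using h by simp
  next
    case (2 J)
    have "theta2 \<tau> h * theta4 \<tau> h * anticomm_rel x (\<lambda>a b. sk_fun \<tau> c a h \<mu> u * sk_fun \<tau> c b h \<mu> (u + h)) = 0"
      unfolding P 2(1) anticomm_rel_def prod.case sk_simps using q(3) 2(2) i2 by Groebner_Basis.algebra
    then show ?thesis using h by simp
  next
    case (3 J)
    have "theta2 \<tau> h * theta3 \<tau> h * anticomm_rel x (\<lambda>a b. sk_fun \<tau> c a h \<mu> u * sk_fun \<tau> c b h \<mu> (u + h)) = 0"
      unfolding P 3(1) anticomm_rel_def prod.case sk_simps using q(6) 3(2) i2 by Groebner_Basis.algebra
    then show ?thesis using h by simp
  qed
qed

text \<open>For k = h this is the contribution of V V^-1 to the coefficient of 1; for -h and -\<mu>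
  it is that of V^-1 V, up to the signs of a and b.\<close>

definition sk_mixed :: "complex \<Rightarrow> complex \<Rightarrow> complex \<Rightarrow> sklyanin_index \<Rightarrow> sklyanin_index \<Rightarrow> complex" where
  "sk_mixed k \<mu> u a b = sk_sign b * (sk_fun \<tau> c a k \<mu> u * sk_fun \<tau> c b (- k) (- \<mu>) (u + k))"

text \<open>The four factors regroup as d(u) d(-u) and d(u + k) d(-(u + k)), each evaluated by
  \<open>theta_d_times_minus\<close>.\<close>

lemma sk_mixed_eq:
  "sk_mixed k \<mu> u a b = sk_sign b * (sk_coeff \<tau> a k * sk_coeff \<tau> b (- k)) *
     (sk_theta \<tau> a (2 * u + k + \<mu>) * sk_theta \<tau> b (2 * u + k - \<mu>)) /
     (theta4 \<tau> (2 * u) * theta4 \<tau> (2 * u + k + k))"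
proof -
  have e: "2 * (u + k) + - k + - \<mu> = 2 * u + k - \<mu>" "- (u + k) - - k = - u" by (simp_all add: algebra_simps)
  have "sk_mixed k \<mu> u a b = sk_sign b * (sk_coeff \<tau> a k * sk_coeff \<tau> b (- k)) *
     (sk_theta \<tau> a (2 * u + k + \<mu>) * sk_theta \<tau> b (2 * u + k - \<mu>)) /
     ((theta_d \<tau> c u * theta_d \<tau> c (- u)) * (theta_d \<tau> c (u + k) * theta_d \<tau> c (- (u + k))))"
    unfolding sk_mixed_def sk_fun_def e by (simp add: divide_inverse mult_ac)
  moreover have "2 * (u + k) = 2 * u + k + k" by simp
  ultimately show ?thesis
    unfolding theta_d_times_minus[OF t c] by (simp only:)
qed

text \<open>In all three cases \<open>mixed\<close> yields the factor theta_4(2 u + 2 k), which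
  cancels against the denominator. The rest is a product of functions of \<mu>, of k and of u
  separately.\<close>

lemma sk_mixed_rel:
  assumes "x \<in> sk_triples \<tau> h" and k: "k = h \<or> k = - h" and nz: "theta4 \<tau> (2 * u + k + k) \<noteq> 0" "theta4 \<tau> (2 * u) \<noteq> 0"
  shows "comm_rel x (sk_mixed k \<mu> u) = (case fst x of G1 \<Rightarrow> - 2 * sk_pair \<tau> G1 \<mu> | i \<Rightarrow> - 2 * \<i> * sk_copair \<tau> i \<mu>) * sk_ratio \<tau> (fst x) u"
    and "anticomm_rel x (sk_mixed k \<mu> u) = (case fst x of G1 \<Rightarrow> 2 * \<i> * sk_copair \<tau> G1 \<mu> | i \<Rightarrow> - 2 * sk_pair \<tau> i \<mu>) *
      (sk_pair \<tau> (fst x) k / sk_copair \<tau> (fst x) k) * sk_ratio \<tau> (fst x) u"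
proof -
  define Y where "Y = 2 * u + k"
  define D where "D = inverse (theta4 \<tau> (2 * u) * theta4 \<tau> (2 * u + k + k))"
  have hk: "theta2 \<tau> k \<noteq> 0" "theta3 \<tau> k \<noteq> 0" "theta4 \<tau> k \<noteq> 0" and x: "x \<in> sk_triples \<tau> k"
    using h k assms(1) by (auto simp: theta_minus sk_triples_minus)
  have P: "sk_mixed k \<mu> u a b = sk_sign b * (sk_coeff \<tau> a k * sk_coeff \<tau> b (- k)) *
      (sk_theta \<tau> a (Y + \<mu>) * sk_theta \<tau> b (Y - \<mu>)) * D" for a b
    unfolding sk_mixed_eq D_def Y_def divide_inverse ..
  have Yk: "Y - k = 2 * u" "Y + k = 2 * u + k + k" by (simp_all add: Y_def)
  have R: "f * theta4 \<tau> (Y + k) * D = f / theta4 \<tau> (2 * u)" for f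
    using nz by (simp add: D_def Yk field_simps)
  have cancel: "X = A * (z / w) * T" if "w \<noteq> 0" "w * X = A * z * T" for w X A z T :: complex
    using that by (simp add: field_simps)
  have i2: "\<i> * \<i> = - 1" by simp
  note m = add1.mixed[of k Y \<mu>] add2.mixed[of k Y \<mu>] add3.mixed[of k Y \<mu>]
  show "comm_rel x (sk_mixed k \<mu> u) = (case fst x of G1 \<Rightarrow> - 2 * sk_pair \<tau> G1 \<mu> | i \<Rightarrow> - 2 * \<i> * sk_copair \<tau> i \<mu>) * sk_ratio \<tau> (fst x) u"
    using x hk
  proof (cases rule: sk_triples_cases)
    case (1 J)
    have "comm_rel x (sk_mixed k \<mu> u) = - 2 * sk_pair \<tau> G1 \<mu> * (theta3 \<tau> (Y - k) * theta4 \<tau> (Y + k) * D)"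
      unfolding P 1(1) comm_rel_def prod.case sk_simps using m(1) i2 by Groebner_Basis.algebra
    then show ?thesis unfolding R unfolding Yk by (simp add: 1(1) sk_ratio_def)
  next
    case (2 J)
    have "comm_rel x (sk_mixed k \<mu> u) = - 2 * \<i> * sk_copair \<tau> G2 \<mu> * (theta2 \<tau> (Y - k) * theta4 \<tau> (Y + k) * D)"
      unfolding P 2(1) comm_rel_def prod.case sk_simps using m(6) i2 by Groebner_Basis.algebra
    then show ?thesis unfolding R unfolding Yk by (simp add: 2(1) sk_ratio_def)
  next
    case (3 J)
    \<comment> \<open>Now theta_4 is the partner of theta_1, so the identities of
      \<open>mixed\<close> ending in p(Y - h) q(Y + h) are the ones that produce it.\<close>
    have "comm_rel x (sk_mixed k \<mu> u) = - 2 * \<i> * sk_copair \<tau> G3 \<mu> * (theta1 \<tau> (Y - k) * theta4 \<tau> (Y + k) * D)"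
      unfolding P 3(1) comm_rel_def prod.case sk_simps using m(11) i2 by Groebner_Basis.algebra
    then show ?thesis unfolding R unfolding Yk by (simp add: 3(1) sk_ratio_def)
  qed
  show "anticomm_rel x (sk_mixed k \<mu> u) = (case fst x of G1 \<Rightarrow> 2 * \<i> * sk_copair \<tau> G1 \<mu> | i \<Rightarrow> - 2 * sk_pair \<tau> i \<mu>) *
      (sk_pair \<tau> (fst x) k / sk_copair \<tau> (fst x) k) * sk_ratio \<tau> (fst x) u"
    using x hk
  proof (cases rule: sk_triples_cases)
    case (1 J)
    have "sk_copair \<tau> G1 k * anticomm_rel x (sk_mixed k \<mu> u) =
        2 * \<i> * sk_copair \<tau> G1 \<mu> * sk_pair \<tau> G1 k * (theta3 \<tau> (Y - k) * theta4 \<tau> (Y + k) * D)"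
      unfolding P 1(1) anticomm_rel_def prod.case sk_simps using m(2) 1(2) i2 by Groebner_Basis.algebra
    from cancel[OF _ this[unfolded R]] show ?thesis unfolding Yk using hk by (simp add: 1(1) sk_ratio_def)
  next
    case (2 J)
    have "sk_copair \<tau> G2 k * anticomm_rel x (sk_mixed k \<mu> u) =
        - 2 * sk_pair \<tau> G2 \<mu> * sk_pair \<tau> G2 k * (theta2 \<tau> (Y - k) * theta4 \<tau> (Y + k) * D)"
      unfolding P 2(1) anticomm_rel_def prod.case sk_simps using m(5) 2(2) i2 by Groebner_Basis.algebra
    from cancel[OF _ this[unfolded R]] show ?thesis unfolding Yk using hk by (simp add: 2(1) sk_ratio_def)
  next
    case (3 J)
    have "sk_copair \<tau> G3 k * anticomm_rel x (sk_mixed k \<mu> u) =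
        - 2 * sk_pair \<tau> G3 \<mu> * sk_pair \<tau> G3 k * (theta1 \<tau> (Y - k) * theta4 \<tau> (Y + k) * D)"
      unfolding P 3(1) anticomm_rel_def prod.case sk_simps using m(12) 3(2) i2 by Groebner_Basis.algebra
    from cancel[OF _ this[unfolded R]] show ?thesis unfolding Yk using hk by (simp add: 3(1) sk_ratio_def)
  qed
qed

text \<open>The contributions are \<open>sk_mixed\<close> at (h, \<mu>) and at (-h, -\<mu>); the
  change of sign negates \<open>sk_pair\<close> and fixes \<open>sk_copair\<close>. For k = 1 the
  generator signs multiply to 1 in every product and the expression is odd; for k = 2, 3 they
  multiply to -1 and it is even. Either way the two cancel.\<close>

lemma sk_fun_rel_0:
  assumes x: "x \<in> sk_triples \<tau> h"
    and nz: "theta4 \<tau> (2 * u + h + h) \<noteq> 0" "theta4 \<tau> (2 * u - h - h) \<noteq> 0" "theta4 \<tau> (2 * u) \<noteq> 0"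
  shows "comm_rel x (\<lambda>a b. sk_fun \<tau> c a h \<mu> u * (sk_sign b * sk_fun \<tau> c b (- h) (- \<mu>) (u + h)) +
      sk_sign a * sk_fun \<tau> c a (- h) (- \<mu>) u * sk_fun \<tau> c b h \<mu> (u - h)) = 0"
    and "anticomm_rel x (\<lambda>a b. sk_fun \<tau> c a h \<mu> u * (sk_sign b * sk_fun \<tau> c b (- h) (- \<mu>) (u + h)) +
      sk_sign a * sk_fun \<tau> c a (- h) (- \<mu>) u * sk_fun \<tau> c b h \<mu> (u - h)) = 0"
proof -
  have 2: "sk_sign b * sk_sign b = 1" for b by (cases b) auto
  have P: "sk_fun \<tau> c a h \<mu> u * (sk_sign b * sk_fun \<tau> c b (- h) (- \<mu>) (u + h)) +
      sk_sign a * sk_fun \<tau> c a (- h) (- \<mu>) u * sk_fun \<tau> c b h \<mu> (u - h) =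
      sk_mixed h \<mu> u a b + sk_sign a * sk_sign b * sk_mixed (- h) (- \<mu>) u a b" for a b
  proof -
    have "sk_sign a * sk_sign b * sk_mixed (- h) (- \<mu>) u a b =
        sk_sign b * sk_sign b * (sk_sign a * sk_fun \<tau> c a (- h) (- \<mu>) u * sk_fun \<tau> c b h \<mu> (u - h))"
      by (simp add: sk_mixed_def mult_ac)
    then show ?thesis unfolding 2 by (simp add: sk_mixed_def mult_ac)
  qed
  have m1: "comm_rel x (sk_mixed h \<mu> u) = (case fst x of G1 \<Rightarrow> - 2 * sk_pair \<tau> G1 \<mu> | i \<Rightarrow> - 2 * \<i> * sk_copair \<tau> i \<mu>) * sk_ratio \<tau> (fst x) u"
    "anticomm_rel x (sk_mixed h \<mu> u) = (case fst x of G1 \<Rightarrow> 2 * \<i> * sk_copair \<tau> G1 \<mu> | i \<Rightarrow> - 2 * sk_pair \<tau> i \<mu>) *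
      (sk_pair \<tau> (fst x) h / sk_copair \<tau> (fst x) h) * sk_ratio \<tau> (fst x) u"
    using sk_mixed_rel[OF x, of h u \<mu>] nz by simp_all
  have m2: "comm_rel x (sk_mixed (- h) (- \<mu>) u) = (case fst x of G1 \<Rightarrow> - 2 * sk_pair \<tau> G1 (- \<mu>) | i \<Rightarrow> - 2 * \<i> * sk_copair \<tau> i (- \<mu>)) * sk_ratio \<tau> (fst x) u"
    "anticomm_rel x (sk_mixed (- h) (- \<mu>) u) = (case fst x of G1 \<Rightarrow> 2 * \<i> * sk_copair \<tau> G1 (- \<mu>) | i \<Rightarrow> - 2 * sk_pair \<tau> i (- \<mu>)) *
      (sk_pair \<tau> (fst x) (- h) / sk_copair \<tau> (fst x) (- h)) * sk_ratio \<tau> (fst x) u"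
    using sk_mixed_rel[OF x, of "- h" u "- \<mu>"] nz by simp_all
  have par: "sk_pair \<tau> i (- y) = - sk_pair \<tau> i y" "sk_copair \<tau> i (- y) = sk_copair \<tau> i y" for i y
    by (cases i; simp add: theta_minus)+
  show "comm_rel x (\<lambda>a b. sk_fun \<tau> c a h \<mu> u * (sk_sign b * sk_fun \<tau> c b (- h) (- \<mu>) (u + h)) +
      sk_sign a * sk_fun \<tau> c a (- h) (- \<mu>) u * sk_fun \<tau> c b h \<mu> (u - h)) = 0"
    unfolding P using x h
  proof (cases rule: sk_triples_cases)
    case (1 J)
    have "comm_rel x (\<lambda>a b. sk_mixed h \<mu> u a b + sk_sign a * sk_sign b * sk_mixed (- h) (- \<mu>) u a b) =
        comm_rel x (sk_mixed h \<mu> u) + comm_rel x (sk_mixed (- h) (- \<mu>) u)"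
      by (simp add: 1(1) comm_rel_def algebra_simps)
    then show "comm_rel x (\<lambda>a b. sk_mixed h \<mu> u a b + sk_sign a * sk_sign b * sk_mixed (- h) (- \<mu>) u a b) = 0"
      unfolding m1 m2 par by (simp add: 1(1))
  next
    case (2 J)
    have "comm_rel x (\<lambda>a b. sk_mixed h \<mu> u a b + sk_sign a * sk_sign b * sk_mixed (- h) (- \<mu>) u a b) =
        comm_rel x (sk_mixed h \<mu> u) - comm_rel x (sk_mixed (- h) (- \<mu>) u)"
      by (simp add: 2(1) comm_rel_def algebra_simps)
    then show "comm_rel x (\<lambda>a b. sk_mixed h \<mu> u a b + sk_sign a * sk_sign b * sk_mixed (- h) (- \<mu>) u a b) = 0"
      unfolding m1 m2 par by (simp add: 2(1))
  next
    case (3 J)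
    have "comm_rel x (\<lambda>a b. sk_mixed h \<mu> u a b + sk_sign a * sk_sign b * sk_mixed (- h) (- \<mu>) u a b) =
        comm_rel x (sk_mixed h \<mu> u) - comm_rel x (sk_mixed (- h) (- \<mu>) u)"
      by (simp add: 3(1) comm_rel_def algebra_simps)
    then show "comm_rel x (\<lambda>a b. sk_mixed h \<mu> u a b + sk_sign a * sk_sign b * sk_mixed (- h) (- \<mu>) u a b) = 0"
      unfolding m1 m2 par by (simp add: 3(1))
  qed
  show "anticomm_rel x (\<lambda>a b. sk_fun \<tau> c a h \<mu> u * (sk_sign b * sk_fun \<tau> c b (- h) (- \<mu>) (u + h)) +
      sk_sign a * sk_fun \<tau> c a (- h) (- \<mu>) u * sk_fun \<tau> c b h \<mu> (u - h)) = 0"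
    unfolding P using x h
  proof (cases rule: sk_triples_cases)
    case (1 J)
    have "anticomm_rel x (\<lambda>a b. sk_mixed h \<mu> u a b + sk_sign a * sk_sign b * sk_mixed (- h) (- \<mu>) u a b) =
        anticomm_rel x (sk_mixed h \<mu> u) + anticomm_rel x (sk_mixed (- h) (- \<mu>) u)"
      by (simp add: 1(1) anticomm_rel_def algebra_simps)
    then show "anticomm_rel x (\<lambda>a b. sk_mixed h \<mu> u a b + sk_sign a * sk_sign b * sk_mixed (- h) (- \<mu>) u a b) = 0"
      unfolding m1 m2 par by (simp add: 1(1))
  next
    case (2 J)
    have "anticomm_rel x (\<lambda>a b. sk_mixed h \<mu> u a b + sk_sign a * sk_sign b * sk_mixed (- h) (- \<mu>) u a b) =
        anticomm_rel x (sk_mixed h \<mu> u) - anticomm_rel x (sk_mixed (- h) (- \<mu>) u)"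
      by (simp add: 2(1) anticomm_rel_def algebra_simps)
    then show "anticomm_rel x (\<lambda>a b. sk_mixed h \<mu> u a b + sk_sign a * sk_sign b * sk_mixed (- h) (- \<mu>) u a b) = 0"
      unfolding m1 m2 par by (simp add: 2(1))
  next
    case (3 J)
    have "anticomm_rel x (\<lambda>a b. sk_mixed h \<mu> u a b + sk_sign a * sk_sign b * sk_mixed (- h) (- \<mu>) u a b) =
        anticomm_rel x (sk_mixed h \<mu> u) - anticomm_rel x (sk_mixed (- h) (- \<mu>) u)"
      by (simp add: 3(1) anticomm_rel_def algebra_simps)
    then show "anticomm_rel x (\<lambda>a b. sk_mixed h \<mu> u a b + sk_sign a * sk_sign b * sk_mixed (- h) (- \<mu>) u a b) = 0"
      unfolding m1 m2 par by (simp add: 3(1))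
  qed
qed

end

section \<open>The homomorphism\<close>

definition torus_pair :: "real \<Rightarrow> (real \<Rightarrow> real \<Rightarrow> complex) \<Rightarrow> (real \<Rightarrow> real \<Rightarrow> complex) \<Rightarrow> real \<Rightarrow> torus_elem" where
  "torus_pair L f g = (\<lambda>m n u. interval_one L m * (of_bool (n = 1) * f u m + of_bool (n = - 1) * g u m))"

lemma tensor_fun_mult:
  "tensor_fun L f \<otimes>\<^bsub>torus_tensor_interval \<eta> L\<^esub> t = (\<lambda>m n u. interval_one L m * f u m * t m n u)"
proof (intro ext)
  fix m n u
  have 0: "tensor_fun L f m k u = 0" if "0 < \<bar>k\<bar>" for m k u
    using that by (simp add: tensor_fun_def torus_fun_def)
  show "(tensor_fun L f \<otimes>\<^bsub>torus_tensor_interval \<eta> L\<^esub> t) m n u = interval_one L m * f u m * t m n u"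
    using torus_interval_mult_eq_sum[of 0 "tensor_fun L f" 0 \<eta> t m n u, OF 0 order_refl]
    by (simp add: torus_interval_simps tensor_fun_def torus_fun_def mult_ac)
qed

lemma tensor_pair_eq:
  "tensor_fun L f \<otimes>\<^bsub>torus_tensor_interval \<eta> L\<^esub> tensor_V L \<oplus>\<^bsub>torus_tensor_interval \<eta> L\<^esub>
   tensor_fun L g \<otimes>\<^bsub>torus_tensor_interval \<eta> L\<^esub> adj (torus_tensor_interval \<eta> L) (tensor_V L) = torus_pair L f g"
  unfolding tensor_fun_mult
  by (auto simp: torus_interval_simps tensor_V_def torus_V_def elem_tensor_def torus_pair_def interval_one_def fun_eq_iff)

lemma torus_pair_mult:
  "torus_interval_mult \<eta> (torus_pair L f g) (torus_pair L f' g') m n u = interval_one L m *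
     (of_bool (n = 2) * (f u m * f' (u + \<eta>) m) + of_bool (n = 0) * (f u m * g' (u + \<eta>) m + g u m * f' (u - \<eta>) m) +
      of_bool (n = - 2) * (g u m * g' (u - \<eta>) m))"
proof -
  have 0: "torus_pair L f g m k u = 0" if "1 < \<bar>k\<bar>" for m k u
    using that by (auto simp: torus_pair_def)
  have s: "{- 1..1 :: int} = {- 1, 0, 1}" by auto
  show ?thesis
    using torus_interval_mult_eq_sum[of 1 "torus_pair L f g" 1 \<eta> "torus_pair L f' g'" m n u, OF 0 order_refl]
    unfolding s by (auto simp: torus_pair_def interval_one_def)
qed

lemma torus_pair_analytic:
  assumes "analytic_fun f" "analytic_fun g"
  shows "torus_pair L f g \<in> analytic_elems L"
proof -
  \<comment> \<open>A translate in n of the unit is a power of V, and the unit is the same for every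
    rotation angle, here 0.\<close>
  have "torus_pair L f g = (\<lambda>m n u. f u m * elem_tensor \<one>\<^bsub>smooth_torus 0\<^esub> (interval_one L) m (n - 1) (u + 0) +
      g u m * elem_tensor \<one>\<^bsub>smooth_torus 0\<^esub> (interval_one L) m (n - - 1) (u + 0))"
    by (auto simp: torus_pair_def elem_tensor_def smooth_torus_def fun_eq_iff)
  then show ?thesis
    using analytic_elems_add[OF analytic_elems_mult[OF assms(1) analytic_elems_one]
        analytic_elems_mult[OF assms(2) analytic_elems_one]] by (simp only:)
qed

text \<open>The adjoint of g V^-1 is V conj(g), whose coefficient in front of V is conj(g)
  translated by \<eta>; the hypothesis says that the adjoint exchanges the two summands.\<close>

lemma torus_pair_adj:
  assumes "\<And>u m. cnj (g (u + \<eta>) m) = f u m"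
  shows "adj (torus_tensor_interval \<eta> L) (torus_pair L f g) = torus_pair L f g"
proof -
  have "cnj (f (u - \<eta>) m) = g u m" for u m
    using assms[of "u - \<eta>" m] by (metis complex_cnj_cnj diff_add_cancel)
  then show ?thesis
    using assms by (auto simp: torus_interval_simps torus_pair_def interval_one_def fun_eq_iff)
qed

lemma sk_theta_shift_2: "sk_theta \<tau> a (z + 2) = sk_theta \<tau> a z"
proof -
  have "z + 2 = z + 1 + 1" by simp
  then show ?thesis by (cases a) (simp_all only: sk_theta.simps theta_shift_1 minus_minus)
qed

text \<open>Instance of \<open>analytic_fun_entire\<close> with the reciprocal of the denominator as
  \<phi> and the theta function as g; a unimodular \<sigma> covers i m and -i m alike.\<close>

lemma analytic_fun_sk:
  fixes x c :: real
  assumes t: "Im \<tau> > 0" and c: "c \<noteq> 0" "(of_real c)\<^sup>2 = (theta3 \<tau> 0)\<^sup>2 * theta4 \<tau> 0" and \<sigma>: "norm \<sigma> = 1"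
  shows "analytic_fun (\<lambda>u m. s * sk_fun \<tau> c a (of_real x) (\<sigma> * of_real m) (of_real u))"
proof -
  define D where "D z = theta_d \<tau> c z * theta_d \<tau> c (- z - of_real x)" for z
  have Dhol: "D holomorphic_on A" for A unfolding D_def by (intro holomorphic_intros t)
  have per: "D (z + 1) = D z" for z
  proof -
    have "- (z + 1) - of_real x + 1 = - z - of_real x" by simp
    then show ?thesis
      using theta_d_shift_1[of \<tau> c z] theta_d_shift_1[of \<tau> c "- (z + 1) - of_real x"] by (simp only: D_def)
  qed
  have nz: "D (of_real u) \<noteq> 0" for u
    unfolding D_def using theta_d_nonzero[OF t c] by simp
  obtain \<delta> K where d: "0 < \<delta>" "\<And>z. z \<in> strip \<delta> \<Longrightarrow> D z \<noteq> 0 \<and> norm (inverse (D z)) \<le> K"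
    using inverse_bounded_on_strip[OF holomorphic_on_imp_continuous_on[OF Dhol] per nz] by blast
  define C where "C = s * sk_coeff \<tau> a (of_real x)"
  have "analytic_fun (\<lambda>u m. (C * inverse (D (of_real u))) * sk_theta \<tau> a (2 * of_real u + of_real x + \<sigma> * of_real m))"
  proof (rule analytic_fun_entire[OF d(1)])
    show "(\<lambda>z. C * inverse (D z)) holomorphic_on strip \<delta>"
      using d(2) by (intro holomorphic_intros Dhol) auto
    show "norm (C * inverse (D z)) \<le> norm C * K" if "z \<in> strip \<delta>" for z
      unfolding norm_mult using d(2)[OF that] by (intro mult_left_mono) auto
    show "sk_theta \<tau> a holomorphic_on UNIV"
      using holomorphic_theta[OF t holomorphic_on_id, of UNIV] by (cases a) simp_all
    show "\<exists>M. \<forall>z. \<bar>Im z\<bar> \<le> Y \<longrightarrow> norm (sk_theta \<tau> a z) \<le> M" for Y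
      using norm_theta_le[OF t, of Y] by (cases a) auto
  qed (simp_all add: per sk_theta_shift_2 \<sigma>)
  then show ?thesis
    by (simp add: sk_fun_def C_def D_def divide_inverse mult_ac)
qed

text \<open>For a fixed triple the pairs l, m and 0, k have the same product of signs, so the sign
  is a common factor of the whole relation.\<close>

lemma comm_rel_sign:
  assumes "x \<in> sk_triples \<tau> h"
  shows "comm_rel x P = 0 \<Longrightarrow> comm_rel x (\<lambda>a b. sk_sign a * sk_sign b * P a b) = 0"
    and "anticomm_rel x P = 0 \<Longrightarrow> anticomm_rel x (\<lambda>a b. sk_sign a * sk_sign b * P a b) = 0"
proof -
  obtain e where e: "comm_rel x (\<lambda>a b. sk_sign a * sk_sign b * P a b) = e * comm_rel x P"
    "anticomm_rel x (\<lambda>a b. sk_sign a * sk_sign b * P a b) = e * anticomm_rel x P"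
  proof
    let ?e = "if fst x = G1 then 1 else - 1 :: complex"
    show "comm_rel x (\<lambda>a b. sk_sign a * sk_sign b * P a b) = ?e * comm_rel x P"
      "anticomm_rel x (\<lambda>a b. sk_sign a * sk_sign b * P a b) = ?e * anticomm_rel x P"
      using assms by (auto simp: sk_triples_def comm_rel_def anticomm_rel_def algebra_simps)
  qed
  then show "comm_rel x P = 0 \<Longrightarrow> comm_rel x (\<lambda>a b. sk_sign a * sk_sign b * P a b) = 0"
    "anticomm_rel x P = 0 \<Longrightarrow> anticomm_rel x (\<lambda>a b. sk_sign a * sk_sign b * P a b) = 0" by simp_all
qed

lemma rel_scale:
  "comm_rel x (\<lambda>a b. e * P a b) = e * comm_rel x P" "anticomm_rel x (\<lambda>a b. e * P a b) = e * anticomm_rel x P"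
  by (cases x; simp add: comm_rel_def anticomm_rel_def algebra_simps)+

lemma (in torus_family) free_eval_minus: "free_eval (x - y) m n u = free_eval x m n u - free_eval y m n u"
  using free_eval_add[of "x - y" y] by (simp add: torus_interval_simps)

section \<open>The images of the generators and the homomorphism\<close>

locale sklyanin_family =
  fixes \<tau> :: complex and \<eta> c :: real
  assumes Re_tau: "Re \<tau> = 0" and Im_tau: "Im \<tau> > 0"
    and eta: "0 < \<eta>" "\<eta> < 1" "\<eta> \<noteq> 1 / 2"
    and c_pos: "c > 0" and c_sq: "(complex_of_real c)\<^sup>2 = (theta3 \<tau> 0)\<^sup>2 * theta4 \<tau> 0"
begin

abbreviation "h \<equiv> complex_of_real \<eta>"

definition sk_plus :: "sklyanin_index \<Rightarrow> real \<Rightarrow> real \<Rightarrow> complex" where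
  "sk_plus a u m = sk_fun \<tau> c a h (\<i> * of_real m) (of_real u)"

definition sk_minus :: "sklyanin_index \<Rightarrow> real \<Rightarrow> real \<Rightarrow> complex" where
  "sk_minus a u m = sk_sign a * sk_fun \<tau> c a (- h) (- (\<i> * of_real m)) (of_real u)"

definition sk_elem :: "sklyanin_index \<Rightarrow> real \<Rightarrow> torus_elem" where
  "sk_elem a = torus_pair (cmod \<tau>) (sk_plus a) (sk_minus a)"

text \<open>In the open unit interval cos (pi v) vanishes only at 1/2, hence theta_2(\<eta>) is
  nonzero. The version for -h serves the coefficient of V^-2.\<close>

lemma sklyanin_theta_h: "sklyanin_theta \<tau> c h" and sklyanin_theta_minus_h: "sklyanin_theta \<tau> c (- h)"
proof -
  have "theta2 \<tau> h \<noteq> 0"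
    using theta2_nonzero[OF Im_tau, of \<eta>] cos_pi_eq_0_unit_interval[of \<eta>] eta by blast
  moreover have "theta3 \<tau> h \<noteq> 0" "theta4 \<tau> h \<noteq> 0"
    by (simp_all add: theta3_nonzero theta4_nonzero Im_tau)
  ultimately show "sklyanin_theta \<tau> c h" "sklyanin_theta \<tau> c (- h)"
    using Im_tau c_pos c_sq by unfold_locales (auto simp: theta_minus)
qed

text \<open>For real arguments conjugation negates the argument of d, so d(u + \<eta>) d(-u) becomes
  d(-u - \<eta>) d(u), which is the denominator in front of V.\<close>

lemma cnj_sk_minus: "cnj (sk_minus a (u + \<eta>) m) = sk_plus a u m"
proof -
  have th: "cnj (sk_theta \<tau> a z) = sk_theta \<tau> a (cnj z)" for z
    by (cases a) (simp_all add: cnj_theta[OF Re_tau])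
  have co: "cnj (sk_sign a * sk_coeff \<tau> a (- h)) = sk_coeff \<tau> a h"
    by (cases a) (simp_all add: cnj_theta[OF Re_tau] theta_minus)
  have e: "cnj (2 * of_real (u + \<eta>) + - h + - (\<i> * of_real m)) = 2 * of_real u + h + \<i> * of_real m"
    "- cnj (of_real (u + \<eta>)) = - of_real u - h" "- cnj (- of_real (u + \<eta>) - - h) = of_real u"
    by (simp_all add: algebra_simps)
  have "cnj (sk_minus a (u + \<eta>) m) = cnj (sk_sign a * sk_coeff \<tau> a (- h)) *
      (sk_theta \<tau> a (cnj (2 * of_real (u + \<eta>) + - h + - (\<i> * of_real m))) /
       (theta_d \<tau> c (- cnj (of_real (u + \<eta>))) * theta_d \<tau> c (- cnj (- of_real (u + \<eta>) - - h))))"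
    unfolding sk_minus_def sk_fun_def by (simp only: complex_cnj_mult complex_cnj_divide th cnj_theta_d[OF Re_tau] mult.assoc)
  then show ?thesis
    unfolding co e sk_plus_def sk_fun_def by (simp only: mult.commute)
qed

sublocale torus_family \<eta> "cmod \<tau>" sk_elem
proof
  show "0 < cmod \<tau>" using Im_tau by auto
  fix a
  have "analytic_fun (\<lambda>u m. 1 * sk_fun \<tau> c a (of_real \<eta>) (\<i> * of_real m) (of_real u))"
    "analytic_fun (\<lambda>u m. sk_sign a * sk_fun \<tau> c a (of_real (- \<eta>)) (- \<i> * of_real m) (of_real u))"
    using Im_tau c_pos c_sq by (intro analytic_fun_sk; simp)+
  then have "analytic_fun (sk_plus a)" "analytic_fun (sk_minus a)"
    by (simp_all add: sk_plus_def[abs_def] sk_minus_def[abs_def])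
  then show "sk_elem a \<in> analytic_elems (cmod \<tau>)"
    unfolding sk_elem_def by (rule torus_pair_analytic)
  show "adj (torus_tensor_interval \<eta> (cmod \<tau>)) (sk_elem a) = sk_elem a"
    unfolding sk_elem_def by (rule torus_pair_adj) (rule cnj_sk_minus)
qed

lemma sk_elem_relations:
  assumes x: "x \<in> sk_triples \<tau> h"
  shows "comm_rel x (\<lambda>a b. torus_interval_mult \<eta> (sk_elem a) (sk_elem b) m n u) = 0"
    and "anticomm_rel x (\<lambda>a b. torus_interval_mult \<eta> (sk_elem a) (sk_elem b) m n u) = 0"
proof -
  interpret p: sklyanin_theta \<tau> c h by (rule sklyanin_theta_h)
  interpret n: sklyanin_theta \<tau> c "- h" by (rule sklyanin_theta_minus_h)
  have x': "x \<in> sk_triples \<tau> (- h)" using x by (simp add: sk_triples_minus)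
  define \<mu> U where "\<mu> = \<i> * complex_of_real m" and "U = complex_of_real u"
  have nz: "theta4 \<tau> (2 * U + h + h) \<noteq> 0" "theta4 \<tau> (2 * U - h - h) \<noteq> 0" "theta4 \<tau> (2 * U) \<noteq> 0"
    by (simp_all add: theta4_nonzero Im_tau U_def)
  have f2: "sk_plus a u m * sk_plus b (u + \<eta>) m = sk_fun \<tau> c a h \<mu> U * sk_fun \<tau> c b h \<mu> (U + h)" for a b
    by (simp add: sk_plus_def \<mu>_def U_def)
  have f0: "sk_plus a u m * sk_minus b (u + \<eta>) m + sk_minus a u m * sk_plus b (u - \<eta>) m =
      sk_fun \<tau> c a h \<mu> U * (sk_sign b * sk_fun \<tau> c b (- h) (- \<mu>) (U + h)) +
      sk_sign a * sk_fun \<tau> c a (- h) (- \<mu>) U * sk_fun \<tau> c b h \<mu> (U - h)" for a b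
    by (simp add: sk_plus_def sk_minus_def \<mu>_def U_def)
  \<comment> \<open>The coefficient of V^-2 is that of V^2 at (-h, -\<mu>), up to the signs handled
    by \<open>comm_rel_sign\<close>.\<close>
  have f_2: "sk_minus a u m * sk_minus b (u - \<eta>) m =
      sk_sign a * sk_sign b * (sk_fun \<tau> c a (- h) (- \<mu>) U * sk_fun \<tau> c b (- h) (- \<mu>) (U + - h))" for a b
    by (simp add: sk_minus_def \<mu>_def U_def mult_ac)
  note rels = p.sk_fun_rel_2[OF x] p.sk_fun_rel_0[OF x nz]
    comm_rel_sign(1)[OF x n.sk_fun_rel_2(1)[OF x']] comm_rel_sign(2)[OF x n.sk_fun_rel_2(2)[OF x']]
  consider "n = 2" | "n = 0" | "n = - 2" | "n \<noteq> 2" "n \<noteq> 0" "n \<noteq> - 2" by blast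
  then have "comm_rel x (\<lambda>a b. torus_interval_mult \<eta> (sk_elem a) (sk_elem b) m n u) = 0 \<and>
      anticomm_rel x (\<lambda>a b. torus_interval_mult \<eta> (sk_elem a) (sk_elem b) m n u) = 0"
    unfolding sk_elem_def torus_pair_mult rel_scale
  proof cases
    case 4
    then show "interval_one (cmod \<tau>) m * comm_rel x (\<lambda>a b. of_bool (n = 2) * (sk_plus a u m * sk_plus b (u + \<eta>) m) +
        of_bool (n = 0) * (sk_plus a u m * sk_minus b (u + \<eta>) m + sk_minus a u m * sk_plus b (u - \<eta>) m) +
        of_bool (n = - 2) * (sk_minus a u m * sk_minus b (u - \<eta>) m)) = 0 \<and>
      interval_one (cmod \<tau>) m * anticomm_rel x (\<lambda>a b. of_bool (n = 2) * (sk_plus a u m * sk_plus b (u + \<eta>) m) +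
        of_bool (n = 0) * (sk_plus a u m * sk_minus b (u + \<eta>) m + sk_minus a u m * sk_plus b (u - \<eta>) m) +
        of_bool (n = - 2) * (sk_minus a u m * sk_minus b (u - \<eta>) m)) = 0"
      by (cases x) (simp add: comm_rel_def anticomm_rel_def)
  qed (simp_all add: f2 f0 f_2 rels del: add_uminus_conv_diff)
  then show "comm_rel x (\<lambda>a b. torus_interval_mult \<eta> (sk_elem a) (sk_elem b) m n u) = 0"
    "anticomm_rel x (\<lambda>a b. torus_interval_mult \<eta> (sk_elem a) (sk_elem b) m n u) = 0" by blast+
qed

lemma free_eval_relations:
  assumes "r \<in> sklyanin_relations \<tau> \<eta>"
  shows "free_eval r = \<zero>\<^bsub>T\<^esub>"
proof -
  obtain k l i J where x: "(k, l, i, J) \<in> sk_triples \<tau> h" and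
    r: "r = (free_gen l * free_gen i - free_gen i * free_gen l) - \<i> \<odot>\<^bsub>A\<^esub> (free_gen G0 * free_gen k + free_gen k * free_gen G0) \<or>
      r = (free_gen G0 * free_gen k - free_gen k * free_gen G0) - (\<i> * J) \<odot>\<^bsub>A\<^esub> (free_gen l * free_gen i + free_gen i * free_gen l)"
  proof -
    have "sk_triples \<tau> h = {(G1, G2, G3, J23 \<tau> \<eta>), (G2, G3, G1, J31 \<tau> \<eta>), (G3, G1, G2, J12 \<tau> \<eta>)}"
      by (simp add: sk_triples_def J12_def J23_def J31_def)
    then show ?thesis
      using assms that unfolding sklyanin_relations_def Let_def by blast
  qed
  show ?thesis
    using r sk_elem_relations[OF x]
    by (auto simp: torus_interval_simps fun_eq_iff free_eval_minus free_eval_smult free_eval_add free_eval_mult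
        free_eval_gen comm_rel_def anticomm_rel_def)
qed

lemma sklyanin_algebra_Q: "sklyanin_algebra \<tau> \<eta> = quotient_star_alg A (star_ideal_generated A (sklyanin_relations \<tau> \<eta>))"
  by (simp add: sklyanin_algebra_def sklyanin_ideal_def)

lemma sklyanin_gen_coset: "sklyanin_gen \<tau> \<eta> g = star_ideal_generated A (sklyanin_relations \<tau> \<eta>) +>\<^bsub>A\<^esub> free_gen g"
  by (simp add: sklyanin_gen_def sklyanin_ideal_def)

lemma sklyanin_hom_unique_exists:
  "\<exists>!\<rho>. \<rho> \<in> star_alg_hom (sklyanin_algebra \<tau> \<eta>) T \<and> \<rho> \<in> extensional (carrier (sklyanin_algebra \<tau> \<eta>)) \<and>
     (\<forall>g. \<rho> (sklyanin_gen \<tau> \<eta> g) = sk_elem g)"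
proof -
  let ?I = "star_ideal_generated A (sklyanin_relations \<tau> \<eta>)"
  obtain \<rho> where \<rho>: "\<rho> \<in> star_alg_hom (sklyanin_algebra \<tau> \<eta>) T" "\<rho> \<in> extensional (carrier (sklyanin_algebra \<tau> \<eta>))"
      "\<And>x. \<rho> (?I +>\<^bsub>A\<^esub> x) = free_eval x"
    using presented_hom_exists[OF free_eval_relations] unfolding sklyanin_algebra_Q by blast
  show ?thesis
  proof (rule ex1I[of _ \<rho>])
    fix \<sigma> assume \<sigma>: "\<sigma> \<in> star_alg_hom (sklyanin_algebra \<tau> \<eta>) T \<and> \<sigma> \<in> extensional (carrier (sklyanin_algebra \<tau> \<eta>)) \<and>
      (\<forall>g. \<sigma> (sklyanin_gen \<tau> \<eta> g) = sk_elem g)"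
    have "\<sigma> (?I +>\<^bsub>A\<^esub> x) = free_eval x" for x
      by (rule presented_hom_eval[OF free_eval_relations]) (use \<sigma> in \<open>auto simp: sklyanin_algebra_Q sklyanin_gen_coset\<close>)
    then show "\<sigma> = \<rho>"
      using \<sigma> \<rho> Q_carrier[OF free_eval_relations] unfolding sklyanin_algebra_Q
      by (intro extensionalityI[of \<sigma> "carrier (quotient_star_alg A ?I)"]) auto
  qed (use \<rho> in \<open>auto simp: sklyanin_gen_coset free_eval_gen\<close>)
qed

end

theorem theorem10p7:
  fixes \<tau> :: complex and \<eta> c :: real
  assumes "Re \<tau> = 0" and "Im \<tau> > 0"
    and "0 < \<eta>" and "\<eta> < 1" and "\<eta> \<noteq> 1/2"
    and "c > 0" and "(complex_of_real c)\<^sup>2 = (theta3 \<tau> 0)\<^sup>2 * theta4 \<tau> 0"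
  shows "let L = cmod \<tau>; T = torus_tensor_interval \<eta> L;
             Sk = sklyanin_algebra \<tau> \<eta>; S = sklyanin_gen \<tau> \<eta>;
             d = theta_d \<tau> c; h = complex_of_real \<eta>;
             V = tensor_V L; Vs = adj T V;
             F = (\<lambda>g. tensor_fun L (\<lambda>u m. g (complex_of_real u) (complex_of_real m)))
         in \<exists>!\<rho>. \<rho> \<in> star_alg_hom Sk T \<and> \<rho> \<in> extensional (carrier Sk) \<and>
           \<rho> (S G0) =
             F (\<lambda>u m. theta1 \<tau> h * (theta3 \<tau> (2*u + h + \<i>*m) / (d u * d (- u - h)))) \<otimes>\<^bsub>T\<^esub> V \<oplus>\<^bsub>T\<^esub>
             F (\<lambda>u m. theta1 \<tau> h * (theta3 \<tau> (2*u - h - \<i>*m) / (d u * d (- u + h)))) \<otimes>\<^bsub>T\<^esub> Vs \<and>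
           \<rho> (S G1) =
             F (\<lambda>u m. - \<i> * theta2 \<tau> h * (theta4 \<tau> (2*u + h + \<i>*m) / (d u * d (- u - h)))) \<otimes>\<^bsub>T\<^esub> V \<oplus>\<^bsub>T\<^esub>
             F (\<lambda>u m. \<i> * theta2 \<tau> h * (theta4 \<tau> (2*u - h - \<i>*m) / (d u * d (- u + h)))) \<otimes>\<^bsub>T\<^esub> Vs \<and>
           \<rho> (S G2) =
             F (\<lambda>u m. theta3 \<tau> h * (theta1 \<tau> (2*u + h + \<i>*m) / (d u * d (- u - h)))) \<otimes>\<^bsub>T\<^esub> V \<oplus>\<^bsub>T\<^esub>
             F (\<lambda>u m. theta3 \<tau> h * (theta1 \<tau> (2*u - h - \<i>*m) / (d u * d (- u + h)))) \<otimes>\<^bsub>T\<^esub> Vs \<and>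
           \<rho> (S G3) =
             F (\<lambda>u m. - theta4 \<tau> h * (theta2 \<tau> (2*u + h + \<i>*m) / (d u * d (- u - h)))) \<otimes>\<^bsub>T\<^esub> V \<oplus>\<^bsub>T\<^esub>
             F (\<lambda>u m. - theta4 \<tau> h * (theta2 \<tau> (2*u - h - \<i>*m) / (d u * d (- u + h)))) \<otimes>\<^bsub>T\<^esub> Vs"
proof -
  interpret sklyanin_family \<tau> \<eta> c
    using assms by unfold_locales
  have all: "(\<forall>g. P g) \<longleftrightarrow> P G0 \<and> P G1 \<and> P G2 \<and> P G3" for P :: "sklyanin_index \<Rightarrow> bool"
    by (metis sklyanin_index.exhaust)
  show ?thesis
    unfolding Let_def tensor_pair_eq
    using sklyanin_hom_unique_exists unfolding all
    \<comment> \<open>The parities of the theta functions at -\<eta> combine with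
      \<open>sk_sign\<close> to the stated coefficients of V^-1.\<close>
    by (simp add: sk_elem_def sk_plus_def[abs_def] sk_minus_def[abs_def] sk_fun_def theta_minus)
qed

end
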